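(* Let $(\mathcal{A},\mathcal{B},E)$ be an operator valued probability space and let $(x_i)_{i=1,\dots,n}$ be a sequence of random variables in $\mathcal{A}$ which is identically distributed and monotonically independent with respect to $E$. Let $\phi$ be a state on $\mathcal{A}$ such that $\phi(\cdot)=\phi(E[\cdot])$. Then $(x_i)_{i=1,\dots,n}$ is monotonically spreadable with respect to $\phi$.
   Context: **Operator valued notions.** An operator valued probability space $(\mathcal{A},\mathcal{B},E)$ consists of an algebra $\mathcal{A}$ (not necessarily unital), a subalgebra $\mathcal{B}\subseteq\mathcal{A}$ and a linear map $E:\mathcal{A}\to\mathcal{B}$ with $E[b_1ab_2]=b_1E[a]b_2$ and $E[b]=b$ for all $a\in\mathcal{A}$, $b,b_1,b_2\in\mathcal{B}$. $\mathcal{B}\langle X\rangle_0$ is the linear span of monomials $b_0Xb_1X\cdots Xb_n$, $n\ge1$, where each $b_j$ is in $\mathcal{B}$ or a scalar. $(x_i)$ is identically distributed w.r.t. $E$ if $E[p(x_i)]=E[p(x_j)]$ for all $i,j$ and $p\in\mathcal{B}\langle X\rangle_0$. It is monotonically independent w.r.t. $E$ if $$E[p_1(x_{i_1})\cdots p_k(x_{i_k})\cdots p_m(x_{i_m})]=E[p_1(x_{i_1})\cdots p_{k-1}(x_{i_{k-1}})\,E[p_k(x_{i_k})]\,p_{k+1}(x_{i_{k+1}})\cdots p_m(x_{i_m})]$$ whenever $p_1,\dots,p_m\in\mathcal{B}\langle X\rangle_0$, $i_1\ne i_2\ne\cdots\ne i_m$ (consecutive indices distinct) and $i_{k-1}<i_k>i_{k+1}$,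 where for $k=1$ or $k=m$ the inequality involving the non-existent index is omitted. **Monotone spreadability.** The joint distribution of $x_1,\dots,x_n$ w.r.t. $\phi$ is the linear functional on noncommutative polynomials $\mathbb{C}\langle X_1,\dots,X_n\rangle$ with $\mu_{x_1,\dots,x_n}(p)=\phi(p(x_1,\dots,x_n))$ on monomials of positive degree and $\mu_{x_1,\dots,x_n}(1)=1$. For $k<n$, $M_i(n,k)$ is the universal unital $C^*$-algebra generated by elements $u_{i,j}$ ($1\le i\le n$, $1\le j\le k$) such that: (1) each $u_{i,j}$ is an orthogonal projection; (2) with $P_j=\sum_{i=1}^n u_{i,j}$, $P_ju_{i',j'}=u_{i',j'}$ if $j'\le j$; (3) $P_jP_1=P_1$ for all $1\le j\le k$; (4) $u_{i,j}u_{i',j'}=0$ if $j<j'$ and $i\ge i'$. Put $\mathbf{P}=P_1$. Let $\alpha^{(m)}_{n,k}:\mathbb{C}\langle X_1,\dots,X_k\rangle\to\mathbb{C}\langle X_1,\dots,X_n\rangle\otimes M_i(n,k)$ be the unital homomorphism with $X_j\mapsto\sum_{i=1}^nX_i\otimes u_{i,j}$. $(x_1,\dots,x_n)$ is monotonically spreadable if for all $k=1,\dots,n-1$ and all $p\in\mathbb{C}\langle X_1,\dots,X_k\rangle$, $\mu_{x_1,\dots,x_k}(p)\mathbf{P}=\mathbf{P}\,\big[(\mu_{x_1,\dots,x_n}\otimes id)(\alpha^{(m)}_{n,k}(p))\big]\,\mathbf{P}$. *)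

theory Defs
  imports
    Complex_Main
    "HOL-Library.Poly_Mapping"
    "HOL-Algebra.QuotRing"
    "HOL-Algebra.Module"
begin

section \<open>Noncommutative polynomials\<close>

text \<open>The free monoid, written additively so that, with the convolution product of
  \<^theory>\<open>HOL-Library.Poly_Mapping\<close>, finitely supported functions on it form the free
  unital complex algebra.\<close>

datatype 'g fmon = FMon (letters: "'g list")

instantiation fmon :: (type) monoid_add
begin
definition "0 = FMon []"
definition "v + w = FMon (letters v @ letters w)"
instance by standard (auto simp: zero_fmon_def plus_fmon_def)
end

type_synonym 'g ncpoly = "'g fmon \<Rightarrow>\<^sub>0 complex"

definition ncpolys :: "'g set \<Rightarrow> 'g ncpoly set" where
  "ncpolys G = {p. \<forall>w\<in>Poly_Mapping.keys p. set (letters w) \<subseteq> G}"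

definition ncvar :: "'g \<Rightarrow> 'g ncpoly" where
  "ncvar g = Poly_Mapping.single (FMon [g]) 1"

definition ncconst :: "complex \<Rightarrow> 'g ncpoly" where
  "ncconst c = Poly_Mapping.single 0 c"


section \<open>Operator valued probability spaces\<close>

locale complex_algebra = vector_space scl
  for scl :: "complex \<Rightarrow> 'a::ring \<Rightarrow> 'a" +
  assumes scl_mult_left: "scl c (a * b) = scl c a * b"
    and scl_mult_right: "scl c (a * b) = a * scl c b"

definition subalgebra :: "(complex \<Rightarrow> 'a::ring \<Rightarrow> 'a) \<Rightarrow> 'a set \<Rightarrow> bool" where
  "subalgebra scl B \<longleftrightarrow> module.subspace scl B \<and> (\<forall>a\<in>B. \<forall>b\<in>B. a * b \<in> B)"

locale operator_valued_probability_space = complex_algebra scl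
  for scl :: "complex \<Rightarrow> 'a::ring \<Rightarrow> 'a" +
  fixes B :: "'a set" and E :: "'a \<Rightarrow> 'a"
  assumes subalgebra_B: "subalgebra scl B"
    and linear_E: "Vector_Spaces.linear scl scl E"
    and E_in_B: "E a \<in> B"
    and E_bimodule: "b1 \<in> B \<Longrightarrow> b2 \<in> B \<Longrightarrow> E (b1 * a * b2) = b1 * E a * b2"
    and E_id: "b \<in> B \<Longrightarrow> E b = b"

text \<open>The algebra carries no involution and need not have a unit, so a state is a linear
  functional which is normalised as soon as there is a unit \<open>e\<close>.\<close>

definition is_state :: "(complex \<Rightarrow> 'a::ring \<Rightarrow> 'a) \<Rightarrow> ('a \<Rightarrow> complex) \<Rightarrow> bool" where
  "is_state scl \<phi> \<longleftrightarrow> Vector_Spaces.linear scl (*) \<phi> \<and>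
     (\<forall>e. (\<forall>a. e * a = a \<and> a * e = a) \<longrightarrow> \<phi> e = 1)"

text \<open>Formal monomials \<open>b\<^sub>0 X b\<^sub>1 X \<dots> X b\<^sub>n\<close> with \<open>n \<ge> 1\<close>, each \<open>b\<^sub>j\<close> being an element
  of \<open>B\<close> or a scalar: \<open>MonX b\<^sub>0 b\<^sub>1\<close> is \<open>b\<^sub>0 X b\<^sub>1\<close> and \<open>MonCons b m\<close> is \<open>b X m\<close>.
  Elements of \<open>B\<langle>X\<rangle>\<^sub>0\<close> are represented by formal linear combinations of such monomials;
  evaluation is compatible with the multilinearity relations between them.\<close>

datatype 'b coef = Elem 'b | Scalar complex

datatype 'b bmonom = MonX "'b coef" "'b coef" | MonCons "'b coef" "'b bmonom"

type_synonym 'b bpoly = "'b bmonom \<Rightarrow>\<^sub>0 complex"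

definition bpolys0 :: "'b set \<Rightarrow> 'b bpoly set" where
  "bpolys0 B = {p. \<forall>m\<in>Poly_Mapping.keys p. set_bmonom m \<subseteq> B}"

context
  fixes scl :: "complex \<Rightarrow> 'a::ring \<Rightarrow> 'a"
begin

fun coef_left :: "'a coef \<Rightarrow> 'a \<Rightarrow> 'a" where
  "coef_left (Elem b) a = b * a"
| "coef_left (Scalar c) a = scl c a"

fun coef_right :: "'a \<Rightarrow> 'a coef \<Rightarrow> 'a" where
  "coef_right a (Elem b) = a * b"
| "coef_right a (Scalar c) = scl c a"

fun bmonom_eval :: "'a \<Rightarrow> 'a bmonom \<Rightarrow> 'a" where
  "bmonom_eval x (MonX b b') = coef_left b (coef_right x b')"
| "bmonom_eval x (MonCons b m) = coef_left b (x * bmonom_eval x m)"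

definition bpoly_eval :: "'a \<Rightarrow> 'a bpoly \<Rightarrow> 'a" where
  "bpoly_eval x p = (\<Sum>m\<in>Poly_Mapping.keys p. scl (Poly_Mapping.lookup p m) (bmonom_eval x m))"

end

text \<open>Products of nonempty lists in a ring without unit.\<close>

fun list_prod :: "'a::ring list \<Rightarrow> 'a" where
  "list_prod [] = undefined"
| "list_prod [a] = a"
| "list_prod (a # b # as) = a * list_prod (b # as)"

definition identically_distributed ::
  "(complex \<Rightarrow> 'a::ring \<Rightarrow> 'a) \<Rightarrow> 'a set \<Rightarrow> ('a \<Rightarrow> 'a) \<Rightarrow> nat \<Rightarrow> (nat \<Rightarrow> 'a) \<Rightarrow> bool" where
  "identically_distributed scl B E n x \<longleftrightarrow>
     (\<forall>i\<in>{1..n}. \<forall>j\<in>{1..n}. \<forall>p\<in>bpolys0 B.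
        E (bpoly_eval scl (x i) p) = E (bpoly_eval scl (x j) p))"

definition monotonically_independent ::
  "(complex \<Rightarrow> 'a::ring \<Rightarrow> 'a) \<Rightarrow> 'a set \<Rightarrow> ('a \<Rightarrow> 'a) \<Rightarrow> nat \<Rightarrow> (nat \<Rightarrow> 'a) \<Rightarrow> bool" where
  "monotonically_independent scl B E n x \<longleftrightarrow>
     (\<forall>m (p :: nat \<Rightarrow> 'a bpoly) (i :: nat \<Rightarrow> nat). \<forall>k\<in>{1..m}.
        (\<forall>l\<in>{1..m}. p l \<in> bpolys0 B \<and> i l \<in> {1..n}) \<longrightarrow>
        (\<forall>l\<in>{1..<m}. i l \<noteq> i (l + 1)) \<longrightarrow>
        (1 < k \<longrightarrow> i (k - 1) < i k) \<longrightarrow>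
        (k < m \<longrightarrow> i k > i (k + 1)) \<longrightarrow>
        E (list_prod (map (\<lambda>l. bpoly_eval scl (x (i l)) (p l)) [1..<m + 1])) =
        E (list_prod (map (\<lambda>l. if l = k then E (bpoly_eval scl (x (i k)) (p k))
                                else bpoly_eval scl (x (i l)) (p l)) [1..<m + 1])))"


section \<open>Unital C*-algebras given by generators and relations\<close>

record 'm cstar_alg = "(complex, 'm) module" +
  adjoint :: "'m \<Rightarrow> 'm"
  cnorm :: "'m \<Rightarrow> real"

locale unital_cstar_algebra = ring A for A :: "('m, 'z) cstar_alg_scheme" (structure) +
  assumes smult_closed: "a \<in> carrier A \<Longrightarrow> c \<odot> a \<in> carrier A"
    and smult_l_distr: "a \<in> carrier A \<Longrightarrow> (c + d) \<odot> a = c \<odot> a \<oplus> d \<odot> a"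
    and smult_r_distr: "a \<in> carrier A \<Longrightarrow> b \<in> carrier A \<Longrightarrow> c \<odot> (a \<oplus> b) = c \<odot> a \<oplus> c \<odot> b"
    and smult_assoc1: "a \<in> carrier A \<Longrightarrow> (c * d) \<odot> a = c \<odot> (d \<odot> a)"
    and smult_one: "a \<in> carrier A \<Longrightarrow> 1 \<odot> a = a"
    and smult_mult_left: "a \<in> carrier A \<Longrightarrow> b \<in> carrier A \<Longrightarrow> c \<odot> (a \<otimes> b) = (c \<odot> a) \<otimes> b"
    and smult_mult_right: "a \<in> carrier A \<Longrightarrow> b \<in> carrier A \<Longrightarrow> c \<odot> (a \<otimes> b) = a \<otimes> (c \<odot> b)"
    and adjoint_closed: "a \<in> carrier A \<Longrightarrow> adjoint A a \<in> carrier A"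
    and adjoint_adjoint: "a \<in> carrier A \<Longrightarrow> adjoint A (adjoint A a) = a"
    and adjoint_add: "a \<in> carrier A \<Longrightarrow> b \<in> carrier A \<Longrightarrow>
          adjoint A (a \<oplus> b) = adjoint A a \<oplus> adjoint A b"
    and adjoint_smult: "a \<in> carrier A \<Longrightarrow> adjoint A (c \<odot> a) = cnj c \<odot> adjoint A a"
    and adjoint_mult: "a \<in> carrier A \<Longrightarrow> b \<in> carrier A \<Longrightarrow>
          adjoint A (a \<otimes> b) = adjoint A b \<otimes> adjoint A a"
    and cnorm_nonneg: "a \<in> carrier A \<Longrightarrow> 0 \<le> cnorm A a"
    and cnorm_eq_0: "a \<in> carrier A \<Longrightarrow> cnorm A a = 0 \<longleftrightarrow> a = \<zero>"
    and cnorm_add: "a \<in> carrier A \<Longrightarrow> b \<in> carrier A \<Longrightarrow> cnorm A (a \<oplus> b) \<le> cnorm A a + cnorm A b"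
    and cnorm_smult: "a \<in> carrier A \<Longrightarrow> cnorm A (c \<odot> a) = cmod c * cnorm A a"
    and cnorm_mult: "a \<in> carrier A \<Longrightarrow> b \<in> carrier A \<Longrightarrow> cnorm A (a \<otimes> b) \<le> cnorm A a * cnorm A b"
    and cnorm_cstar: "a \<in> carrier A \<Longrightarrow> cnorm A (adjoint A a \<otimes> a) = (cnorm A a)\<^sup>2"
    and complete: "(\<And>i::nat. X i \<in> carrier A) \<Longrightarrow>
          (\<And>e. e > 0 \<Longrightarrow> \<exists>L. \<forall>i\<ge>L. \<forall>j\<ge>L. cnorm A (X i \<ominus> X j) < e) \<Longrightarrow>
          \<exists>l\<in>carrier A. (\<lambda>i. cnorm A (X i \<ominus> l)) \<longlonglongrightarrow> 0"

text \<open>The free unital *-algebra on \<open>G\<close>: the letter \<open>(g, False)\<close> is the generator \<open>g\<close> and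
  \<open>(g, True)\<close> its formal adjoint.\<close>

type_synonym 'g star_poly = "('g \<times> bool) ncpoly"

definition star_polys :: "'g set \<Rightarrow> 'g star_poly set" where
  "star_polys G = ncpolys (G \<times> UNIV)"

definition star_gen :: "'g \<Rightarrow> 'g star_poly" where
  "star_gen g = ncvar (g, False)"

definition star_word :: "('g \<times> bool) fmon \<Rightarrow> ('g \<times> bool) fmon" where
  "star_word w = FMon (rev (map (\<lambda>(g, b). (g, \<not> b)) (letters w)))"

definition star_adj :: "'g star_poly \<Rightarrow> 'g star_poly" where
  "star_adj p = (\<Sum>w\<in>Poly_Mapping.keys p. Poly_Mapping.single (star_word w) (cnj (Poly_Mapping.lookup p w)))"

definition cstar_seminorm :: "'g set \<Rightarrow> ('g star_poly \<Rightarrow> real) \<Rightarrow> bool" where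
  "cstar_seminorm G s \<longleftrightarrow>
     (\<forall>a\<in>star_polys G. 0 \<le> s a \<and> (\<forall>c. s (ncconst c * a) = cmod c * s a) \<and>
        s (star_adj a * a) = (s a)\<^sup>2) \<and>
     (\<forall>a\<in>star_polys G. \<forall>b\<in>star_polys G. s (a + b) \<le> s a + s b \<and> s (a * b) \<le> s a * s b)"

text \<open>The universal unital C*-algebra on generators \<open>G\<close> subject to the relations \<open>r = 0\<close>,
  \<open>r \<in> R\<close>, is the separated completion of the free unital *-algebra on \<open>G\<close> with respect to the
  largest C*-seminorm vanishing on \<open>R\<close>: Cauchy sequences modulo null sequences. It exists
  only if that supremum is finite.\<close>

definition univ_norm :: "'g set \<Rightarrow> 'g star_poly set \<Rightarrow> 'g star_poly \<Rightarrow> real" where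
  "univ_norm G R a = Sup {s a | s. cstar_seminorm G s \<and> (\<forall>r\<in>R. s r = 0)}"

definition cauchy_seqs :: "'g set \<Rightarrow> 'g star_poly set \<Rightarrow> (nat \<Rightarrow> 'g star_poly) ring" where
  "cauchy_seqs G R =
     \<lparr>carrier = {a. (\<forall>i. a i \<in> star_polys G) \<and>
        (\<forall>e>0. \<exists>L. \<forall>i\<ge>L. \<forall>j\<ge>L. univ_norm G R (a i - a j) < e)},
      mult = (\<lambda>a b i. a i * b i), one = (\<lambda>_. 1), zero = (\<lambda>_. 0), add = (\<lambda>a b i. a i + b i)\<rparr>"

definition null_seqs :: "'g set \<Rightarrow> 'g star_poly set \<Rightarrow> (nat \<Rightarrow> 'g star_poly) set" where
  "null_seqs G R = {a. (\<forall>i. a i \<in> star_polys G) \<and> (\<lambda>i. univ_norm G R (a i)) \<longlonglongrightarrow> 0}"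

definition seq_class :: "'g set \<Rightarrow> 'g star_poly set \<Rightarrow> (nat \<Rightarrow> 'g star_poly) \<Rightarrow> (nat \<Rightarrow> 'g star_poly) set"
  where "seq_class G R a = null_seqs G R +>\<^bsub>cauchy_seqs G R\<^esub> a"

definition univ_cstar :: "'g set \<Rightarrow> 'g star_poly set \<Rightarrow> (nat \<Rightarrow> 'g star_poly) set cstar_alg" where
  "univ_cstar G R =
     (let Q = cauchy_seqs G R Quot null_seqs G R in
     \<lparr>carrier = carrier Q, mult = mult Q, one = one Q, zero = zero Q, add = add Q,
      smult = (\<lambda>c A. \<Union>a\<in>A. seq_class G R (\<lambda>i. ncconst c * a i)),
      adjoint = (\<lambda>A. \<Union>a\<in>A. seq_class G R (\<lambda>i. star_adj (a i))),
      cnorm = (\<lambda>A. the_elem ((\<lambda>a. lim (\<lambda>i. univ_norm G R (a i))) ` A))\<rparr>)"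

definition univ_class :: "'g set \<Rightarrow> 'g star_poly set \<Rightarrow> 'g star_poly \<Rightarrow> (nat \<Rightarrow> 'g star_poly) set" where
  "univ_class G R a = seq_class G R (\<lambda>_. a)"


section \<open>The algebras \<open>M\<^sub>i(n,k)\<close>\<close>

definition Mi_gens :: "nat \<Rightarrow> nat \<Rightarrow> (nat \<times> nat) set" where
  "Mi_gens n k = {1..n} \<times> {1..k}"

definition Mi_rels :: "nat \<Rightarrow> nat \<Rightarrow> (nat \<times> nat) star_poly set" where
  "Mi_rels n k =
     (let u = (\<lambda>i j. star_gen (i, j)); P = (\<lambda>j. \<Sum>i=1..n. u i j); I = {1..n}; J = {1..k} in
       {star_adj (u i j) - u i j | i j. i \<in> I \<and> j \<in> J} \<union>
       {u i j * u i j - u i j | i j. i \<in> I \<and> j \<in> J} \<union>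
       {P j * u i' j' - u i' j' | j i' j'. j \<in> J \<and> i' \<in> I \<and> j' \<in> J \<and> j' \<le> j} \<union>
       {P j * P 1 - P 1 | j. j \<in> J} \<union>
       {u i j * u i' j' | i j i' j'. i \<in> I \<and> j \<in> J \<and> i' \<in> I \<and> j' \<in> J \<and> j < j' \<and> i' \<le> i})"

type_synonym Mi_elem = "(nat \<Rightarrow> (nat \<times> nat) star_poly) set"

definition Mi :: "nat \<Rightarrow> nat \<Rightarrow> Mi_elem cstar_alg" where
  "Mi n k = univ_cstar (Mi_gens n k) (Mi_rels n k)"

definition Mi_u :: "nat \<Rightarrow> nat \<Rightarrow> nat \<Rightarrow> nat \<Rightarrow> Mi_elem" where
  "Mi_u n k i j = univ_class (Mi_gens n k) (Mi_rels n k) (star_gen (i, j))"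

definition Mi_P :: "nat \<Rightarrow> nat \<Rightarrow> nat \<Rightarrow> Mi_elem" where
  "Mi_P n k j = (\<Oplus>\<^bsub>Mi n k\<^esub> i \<in> {1..n}. Mi_u n k i j)"


section \<open>Monotone spreadability\<close>

definition joint_distribution :: "('a::ring \<Rightarrow> complex) \<Rightarrow> (nat \<Rightarrow> 'a) \<Rightarrow> nat ncpoly \<Rightarrow> complex" where
  "joint_distribution \<phi> x p =
     (\<Sum>w\<in>Poly_Mapping.keys p. Poly_Mapping.lookup p w * (if w = 0 then 1 else \<phi> (list_prod (map x (letters w)))))"

text \<open>The algebra \<open>\<complex>\<langle>X\<^sub>g : g \<in> G\<rangle> \<otimes> M\<close>. As the words form a basis of the left factor, its
  elements are the finite sums \<open>\<Sum>\<^sub>w X\<^sub>w \<otimes> f w\<close> with unique coefficients \<open>f w\<close> in \<open>M\<close>, and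
  they are represented by \<open>f\<close>.\<close>

definition nc_tensor :: "'g set \<Rightarrow> ('m, 'z) cstar_alg_scheme \<Rightarrow> (complex, 'g fmon \<Rightarrow> 'm) module" where
  "nc_tensor G M =
     \<lparr>carrier = {f. (\<forall>w. f w \<in> carrier M) \<and> finite {w. f w \<noteq> \<zero>\<^bsub>M\<^esub>} \<and>
        (\<forall>w. f w \<noteq> \<zero>\<^bsub>M\<^esub> \<longrightarrow> set (letters w) \<subseteq> G)},
      mult = (\<lambda>f g w. \<Oplus>\<^bsub>M\<^esub> q \<in> {q. fst q + snd q = w}. f (fst q) \<otimes>\<^bsub>M\<^esub> g (snd q)),
      one = (\<lambda>w. if w = 0 then \<one>\<^bsub>M\<^esub> else \<zero>\<^bsub>M\<^esub>),
      zero = (\<lambda>_. \<zero>\<^bsub>M\<^esub>),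
      add = (\<lambda>f g w. f w \<oplus>\<^bsub>M\<^esub> g w),
      smult = (\<lambda>c f w. c \<odot>\<^bsub>M\<^esub> f w)\<rparr>"

definition pure_tensor :: "('m, 'z) cstar_alg_scheme \<Rightarrow> 'g ncpoly \<Rightarrow> 'm \<Rightarrow> ('g fmon \<Rightarrow> 'm)" where
  "pure_tensor M p a = (\<lambda>w. Poly_Mapping.lookup p w \<odot>\<^bsub>M\<^esub> a)"

text \<open>The unital homomorphism extending a given assignment of the variables.\<close>

definition nc_hom :: "(complex, 't, 'z) module_scheme \<Rightarrow> ('g \<Rightarrow> 't) \<Rightarrow> 'g ncpoly \<Rightarrow> 't" where
  "nc_hom T h p =
     (\<Oplus>\<^bsub>T\<^esub> w \<in> Poly_Mapping.keys p. Poly_Mapping.lookup p w \<odot>\<^bsub>T\<^esub> foldr (\<lambda>g t. h g \<otimes>\<^bsub>T\<^esub> t) (letters w) \<one>\<^bsub>T\<^esub>)"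

definition alpha :: "nat \<Rightarrow> nat \<Rightarrow> nat ncpoly \<Rightarrow> (nat fmon \<Rightarrow> Mi_elem)" where
  "alpha n k =
     (let T = nc_tensor {1..n} (Mi n k) in
      nc_hom T (\<lambda>j. \<Oplus>\<^bsub>T\<^esub> i \<in> {1..n}. pure_tensor (Mi n k) (ncvar i) (Mi_u n k i j)))"

text \<open>\<open>\<mu> \<otimes> id\<close> for a linear functional \<open>\<mu>\<close> on noncommutative polynomials.\<close>

definition tensor_id :: "('m, 'z) cstar_alg_scheme \<Rightarrow> ('g ncpoly \<Rightarrow> complex) \<Rightarrow> ('g fmon \<Rightarrow> 'm) \<Rightarrow> 'm" where
  "tensor_id M \<mu> f =
     (\<Oplus>\<^bsub>M\<^esub> w \<in> {w. f w \<noteq> \<zero>\<^bsub>M\<^esub>}. \<mu> (Poly_Mapping.single w 1) \<odot>\<^bsub>M\<^esub> f w)"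

definition monotonically_spreadable ::
  "('a::ring \<Rightarrow> complex) \<Rightarrow> nat \<Rightarrow> (nat \<Rightarrow> 'a) \<Rightarrow> bool" where
  "monotonically_spreadable \<phi> n x \<longleftrightarrow>
     (\<forall>k\<in>{1..n - 1}. \<forall>p\<in>ncpolys {1..k}.
        joint_distribution \<phi> x p \<odot>\<^bsub>Mi n k\<^esub> Mi_P n k 1 =
        Mi_P n k 1 \<otimes>\<^bsub>Mi n k\<^esub>
          tensor_id (Mi n k) (joint_distribution \<phi> x) (alpha n k p) \<otimes>\<^bsub>Mi n k\<^esub>
        Mi_P n k 1)"


section \<open>Facts about universal C*-algebras\<close>

text \<open>For an admissible presentation the construction above is a unital C*-algebra in which the
  relations hold, and it has the universal property; the presentation of \<open>M\<^sub>i(n,k)\<close> is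
  admissible.\<close>

subsection \<open>The free unital *-algebra\<close>

lemma star_word_star_word [simp]: "star_word (star_word w) = w"
  by (cases w) (auto simp: star_word_def rev_map o_def case_prod_beta intro!: map_idI)

lemma star_word_add: "star_word (v + w) = star_word w + star_word v"
  by (simp add: star_word_def plus_fmon_def)

lemma star_word_0 [simp]: "star_word 0 = 0"
  by (simp add: star_word_def zero_fmon_def)


lemma lookup_star_adj: "Poly_Mapping.lookup (star_adj p) w = cnj (Poly_Mapping.lookup p (star_word w))"
proof -
  have "Poly_Mapping.lookup (star_adj p) w =
      (\<Sum>v\<in>Poly_Mapping.keys p. cnj (Poly_Mapping.lookup p v) when star_word v = w)"
    by (simp add: star_adj_def lookup_sum lookup_single)
  also have "\<dots> = (\<Sum>v\<in>Poly_Mapping.keys p. if v = star_word w then cnj (Poly_Mapping.lookup p v) else 0)"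
    by (intro sum.cong) (auto simp: when_def)
  also have "\<dots> = cnj (Poly_Mapping.lookup p (star_word w))"
    by (auto simp: sum.delta in_keys_iff)
  finally show ?thesis .
qed

lemma star_adj_add: "star_adj (a + b) = star_adj a + star_adj b"
  by (rule poly_mapping_eqI) (simp add: lookup_star_adj lookup_add)

lemma star_adj_0 [simp]: "star_adj 0 = 0"
  by (rule poly_mapping_eqI) (simp add: lookup_star_adj)

lemma star_adj_uminus: "star_adj (- a) = - star_adj a"
  by (rule poly_mapping_eqI) (simp add: lookup_star_adj)

lemma star_adj_diff: "star_adj (a - b) = star_adj a - star_adj b"
  by (rule poly_mapping_eqI) (simp add: lookup_star_adj lookup_minus)

lemma star_adj_star_adj [simp]: "star_adj (star_adj a) = a"
  by (rule poly_mapping_eqI) (simp add: lookup_star_adj)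

lemma star_adj_single: "star_adj (Poly_Mapping.single w c) = Poly_Mapping.single (star_word w) (cnj c)"
  by (rule poly_mapping_eqI) (auto simp: lookup_star_adj lookup_single when_def)

lemma star_adj_const: "star_adj (ncconst c) = ncconst (cnj c)"
  by (simp add: ncconst_def star_adj_single)

lemma star_adj_1 [simp]: "star_adj 1 = 1"
  using star_adj_const[of 1] by (simp add: ncconst_def)

lemma ncpoly_induct [case_names 0 single add]:
  fixes p :: "'g ncpoly"
  assumes "P 0" "\<And>w c. P (Poly_Mapping.single w c)" "\<And>p q. P p \<Longrightarrow> P q \<Longrightarrow> P (p + q)"
  shows "P p"
proof -
  have p: "p = (\<Sum>w\<in>Poly_Mapping.keys p. Poly_Mapping.single w (Poly_Mapping.lookup p w))"
    by (rule poly_mapping_eqI) (simp add: lookup_sum lookup_single when_def sum.delta' in_keys_iff)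
  have "P (\<Sum>w\<in>S. Poly_Mapping.single w (Poly_Mapping.lookup p w))" if "finite S" for S
    using that by induction (auto intro: assms)
  then show ?thesis by (subst p) auto
qed

lemma star_adj_mult: "star_adj (a * b) = star_adj b * star_adj a"
proof (induction a rule: ncpoly_induct)
  case (single v c)
  show ?case
    by (induction b rule: ncpoly_induct)
       (auto simp: star_adj_single mult_single star_word_add star_adj_add algebra_simps)
qed (auto simp: star_adj_add algebra_simps)

lemma ncconst_comm: "ncconst c * a = a * ncconst c"
  by (induction a rule: ncpoly_induct) (auto simp: ncconst_def mult_single algebra_simps)

lemma ncconst_mult: "ncconst (c * d) = ncconst c * ncconst d"
  by (simp add: ncconst_def mult_single)

lemma ncconst_add: "ncconst (c + d) = ncconst c + ncconst d"
  by (simp add: ncconst_def single_add)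

lemma ncconst_1 [simp]: "ncconst 1 = 1"
  by (simp add: ncconst_def)

lemma ncconst_m1 [simp]: "ncconst (-1) = -1"
  by (metis ncconst_1 ncconst_def single_uminus)

lemma ncpolys_add: "a \<in> ncpolys G \<Longrightarrow> b \<in> ncpolys G \<Longrightarrow> a + b \<in> ncpolys G"
  using keys_add[of a b] by (auto simp: ncpolys_def)

lemma ncpolys_mult: "a \<in> ncpolys G \<Longrightarrow> b \<in> ncpolys G \<Longrightarrow> a * b \<in> ncpolys G"
  using keys_mult[of a b] by (fastforce simp: ncpolys_def plus_fmon_def)

lemma ncpolys_const: "ncconst c \<in> ncpolys G"
  by (auto simp: ncpolys_def ncconst_def zero_fmon_def)

lemma ncpolys_uminus: "a \<in> ncpolys G \<Longrightarrow> - a \<in> ncpolys G"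
  by (auto simp: ncpolys_def in_keys_iff)

lemma star_polys_closed [simp, intro]:
  "0 \<in> star_polys G" "1 \<in> star_polys G" "ncconst c \<in> star_polys G"
  "a \<in> star_polys G \<Longrightarrow> - a \<in> star_polys G"
  "a \<in> star_polys G \<Longrightarrow> b \<in> star_polys G \<Longrightarrow> a + b \<in> star_polys G"
  "a \<in> star_polys G \<Longrightarrow> b \<in> star_polys G \<Longrightarrow> a - b \<in> star_polys G"
  "a \<in> star_polys G \<Longrightarrow> b \<in> star_polys G \<Longrightarrow> a * b \<in> star_polys G"
  using ncpolys_add[of a "G \<times> UNIV" "- b"]
  by (auto simp: star_polys_def ncpolys_add ncpolys_mult ncpolys_const ncpolys_uminus
      simp flip: ncconst_1) (auto simp: ncpolys_def)

lemma star_polys_adj [simp, intro]: "a \<in> star_polys G \<Longrightarrow> star_adj a \<in> star_polys G"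
proof -
  assume a: "a \<in> star_polys G"
  show ?thesis unfolding star_polys_def ncpolys_def
  proof safe
    fix w g b assume w: "w \<in> Poly_Mapping.keys (star_adj a)" and "(g, b) \<in> set (letters w)"
    from this(2) have "(g, \<not> b) \<in> set (letters (star_word w))"
      by (force simp: star_word_def)
    moreover have "star_word w \<in> Poly_Mapping.keys a"
      using w by (simp add: in_keys_iff lookup_star_adj)
    ultimately show "g \<in> G" using a by (auto simp: star_polys_def ncpolys_def)
  qed auto
qed

lemma star_polys_gen [simp, intro]: "g \<in> G \<Longrightarrow> star_gen g \<in> star_polys G"
  by (auto simp: star_polys_def ncpolys_def star_gen_def ncvar_def)

lemma star_polys_sum: "(\<And>i. i \<in> S \<Longrightarrow> f i \<in> star_polys G) \<Longrightarrow> sum f S \<in> star_polys G"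
  by (induction S rule: infinite_finite_induct) auto

subsection \<open>The universal seminorm\<close>

locale cstar_seminormed =
  fixes G :: "'g set" and s :: "'g star_poly \<Rightarrow> real"
  assumes cstar: "cstar_seminorm G s"
begin

lemma nonneg: "a \<in> star_polys G \<Longrightarrow> 0 \<le> s a"
  and scale: "a \<in> star_polys G \<Longrightarrow> s (ncconst c * a) = cmod c * s a"
  and cstar_id: "a \<in> star_polys G \<Longrightarrow> s (star_adj a * a) = (s a)\<^sup>2"
  and triangle: "a \<in> star_polys G \<Longrightarrow> b \<in> star_polys G \<Longrightarrow> s (a + b) \<le> s a + s b"
  and submult: "a \<in> star_polys G \<Longrightarrow> b \<in> star_polys G \<Longrightarrow> s (a * b) \<le> s a * s b"
  using cstar by (auto simp: cstar_seminorm_def)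

lemma zero: "s 0 = 0"
  using scale[of 0 0] by simp

lemma uminus: "a \<in> star_polys G \<Longrightarrow> s (- a) = s a"
  using scale[of a "-1"] by simp

lemma diff: "a \<in> star_polys G \<Longrightarrow> b \<in> star_polys G \<Longrightarrow> s (a - b) \<le> s a + s b"
  using triangle[of a "- b"] uminus[of b] by simp

lemma diff_commute: "a \<in> star_polys G \<Longrightarrow> b \<in> star_polys G \<Longrightarrow> s (a - b) = s (b - a)"
  using uminus[of "a - b"] by simp

lemma abs_diff: "a \<in> star_polys G \<Longrightarrow> b \<in> star_polys G \<Longrightarrow> \<bar>s a - s b\<bar> \<le> s (a - b)"
  using triangle[of "a - b" b] triangle[of "b - a" a] diff_commute[of a b] by auto

lemma adj_le: "a \<in> star_polys G \<Longrightarrow> s a \<le> s (star_adj a)"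
proof -
  assume a: "a \<in> star_polys G"
  have "s a * s a \<le> s (star_adj a) * s a"
    using submult[of "star_adj a" a] cstar_id[of a] a by (simp add: power2_eq_square)
  then show ?thesis using nonneg[OF a] nonneg[OF star_polys_adj[OF a]]
    by (cases "s a = 0") auto
qed

lemma adj: "a \<in> star_polys G \<Longrightarrow> s (star_adj a) = s a"
  using adj_le[of a] adj_le[of "star_adj a"] by fastforce

end

text \<open>Admissible presentations, i.e. those for which the universal C*-algebra exists.\<close>

locale cstar_presentation =
  fixes G :: "'g set" and R :: "'g star_poly set"
  assumes rels: "R \<subseteq> star_polys G"
    and bdd: "a \<in> star_polys G \<Longrightarrow> bdd_above {s a | s. cstar_seminorm G s \<and> (\<forall>r\<in>R. s r = 0)}"
begin

abbreviation "S \<equiv> {s. cstar_seminorm G s \<and> (\<forall>r\<in>R. s r = 0)}"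
abbreviation "N \<equiv> univ_norm G R"

lemma univ_norm_eq: "N a = (SUP s\<in>S. s a)"
  by (simp add: univ_norm_def image_Collect)

lemma S_nonempty: "S \<noteq> {}"
proof -
  have "(\<lambda>_. 0) \<in> S" by (simp add: cstar_seminorm_def)
  then show ?thesis by blast
qed

lemma S_D: "s \<in> S \<Longrightarrow> cstar_seminormed G s"
  by (simp add: cstar_seminormed_def)

lemma le_N: "s \<in> S \<Longrightarrow> a \<in> star_polys G \<Longrightarrow> s a \<le> N a"
  unfolding univ_norm_eq using bdd[of a] by (intro cSUP_upper) (auto simp: image_Collect)

lemma N_le: "(\<And>s. s \<in> S \<Longrightarrow> s a \<le> c) \<Longrightarrow> N a \<le> c"
  unfolding univ_norm_eq using S_nonempty by (intro cSUP_least)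

lemma N_nonneg: "a \<in> star_polys G \<Longrightarrow> 0 \<le> N a"
  using S_nonempty le_N[of _ a] cstar_seminormed.nonneg[OF S_D, of _ a] by fastforce

lemma N_rel: "r \<in> R \<Longrightarrow> N r = 0"
  using N_le[of r 0] N_nonneg[of r] rels by fastforce

lemma cstar_seminorm_N: "cstar_seminorm G N"
  unfolding cstar_seminorm_def
proof (intro conjI ballI allI)
  fix a assume a: "a \<in> star_polys G"
  show "0 \<le> N a" by (rule N_nonneg[OF a])
  have le: "N (ncconst c * b) \<le> cmod c * N b" if "b \<in> star_polys G" for b c
    using that by (intro N_le) (auto simp: cstar_seminormed.scale[OF S_D] intro!: mult_left_mono le_N)
  fix c
  show "N (ncconst c * a) = cmod c * N a"
  proof (cases "c = 0")
    case True
    then show ?thesis using le[of a 0] N_nonneg[of "ncconst 0 * a"] a by simp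
  next
    case False
    have "N a = N (ncconst (inverse c) * (ncconst c * a))"
      using False by (simp flip: mult.assoc ncconst_mult)
    also have "\<dots> \<le> cmod (inverse c) * N (ncconst c * a)"
      by (rule le) (use a in auto)
    finally have "cmod c * N a \<le> N (ncconst c * a)"
      using False by (simp add: norm_divide inverse_eq_divide field_simps)
    with le[OF a] show ?thesis by (simp add: antisym)
  qed
next
  fix a assume a: "a \<in> star_polys G"
  show "N (star_adj a * a) = (N a)\<^sup>2"
  proof (rule antisym)
    show "N (star_adj a * a) \<le> (N a)\<^sup>2"
      using a by (intro N_le) (auto simp: cstar_seminormed.cstar_id[OF S_D]
         intro!: power_mono le_N cstar_seminormed.nonneg[OF S_D])
    have "N a \<le> sqrt (N (star_adj a * a))"
    proof (rule N_le)
      fix s assume s: "s \<in> S"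
      have "(s a)\<^sup>2 \<le> N (star_adj a * a)"
        using le_N[OF s, of "star_adj a * a"] a by (simp add: cstar_seminormed.cstar_id[OF S_D[OF s]])
      then show "s a \<le> sqrt (N (star_adj a * a))" by (rule real_le_rsqrt)
    qed
    then have "(N a)\<^sup>2 \<le> (sqrt (N (star_adj a * a)))\<^sup>2"
      by (intro power_mono N_nonneg a)
    then show "(N a)\<^sup>2 \<le> N (star_adj a * a)" using a by (simp add: N_nonneg)
  qed
next
  fix a b assume ab: "a \<in> star_polys G" "b \<in> star_polys G"
  show "N (a + b) \<le> N a + N b"
  proof (rule N_le)
    fix s assume s: "s \<in> S"
    show "s (a + b) \<le> N a + N b"
      using cstar_seminormed.triangle[OF S_D[OF s] ab] le_N[OF s ab(1)] le_N[OF s ab(2)] by linarith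
  qed
  show "N (a * b) \<le> N a * N b"
  proof (rule N_le)
    fix s assume s: "s \<in> S"
    have "s (a * b) \<le> s a * s b" by (rule cstar_seminormed.submult[OF S_D[OF s] ab])
    also have "\<dots> \<le> N a * N b"
      using ab by (intro mult_mono le_N s N_nonneg cstar_seminormed.nonneg[OF S_D[OF s]])
    finally show "s (a * b) \<le> N a * N b" .
  qed
qed

sublocale N: cstar_seminormed G N
  by unfold_locales (rule cstar_seminorm_N)

end
subsection \<open>The completion\<close>

context cstar_presentation
begin

abbreviation "C \<equiv> cauchy_seqs G R"
abbreviation "I \<equiv> null_seqs G R"
abbreviation "U \<equiv> univ_cstar G R"
abbreviation "cl \<equiv> seq_class G R"

lemma C_simps [simp]:
  "mult C = (\<lambda>a b i. a i * b i)" "one C = (\<lambda>_. 1)" "zero C = (\<lambda>_. 0)" "add C = (\<lambda>a b i. a i + b i)"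
  by (simp_all add: cauchy_seqs_def)

lemma C_iff: "a \<in> carrier C \<longleftrightarrow> (\<forall>i. a i \<in> star_polys G) \<and>
    (\<forall>e>0. \<exists>L. \<forall>i\<ge>L. \<forall>j\<ge>L. N (a i - a j) < e)"
  by (simp add: cauchy_seqs_def)

lemma C_poly: "a \<in> carrier C \<Longrightarrow> a i \<in> star_polys G"
  by (simp add: C_iff)

lemma C_I: "(\<And>i. a i \<in> star_polys G) \<Longrightarrow>
    (\<And>e. e > 0 \<Longrightarrow> \<exists>L. \<forall>i\<ge>L. \<forall>j\<ge>L. N (a i - a j) < e) \<Longrightarrow> a \<in> carrier C"
  by (simp add: C_iff)

lemma C_D:
  assumes "a \<in> carrier C" "e > 0"
  obtains L where "\<And>i j. i \<ge> L \<Longrightarrow> j \<ge> L \<Longrightarrow> N (a i - a j) < e"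
  using assms unfolding C_iff by meson

lemma C_convergent:
  assumes a: "a \<in> carrier C"
  shows "convergent (\<lambda>i. N (a i))"
proof -
  have "Cauchy (\<lambda>i. N (a i))"
  proof (rule metric_CauchyI)
    fix e :: real assume "e > 0"
    then obtain L where L: "\<And>i j. i \<ge> L \<Longrightarrow> j \<ge> L \<Longrightarrow> N (a i - a j) < e"
      using C_D[OF a] by metis
    have "dist (N (a i)) (N (a j)) < e" if "i \<ge> L" "j \<ge> L" for i j
      using N.abs_diff[OF C_poly[OF a] C_poly[OF a], of i j] L[OF that] by (simp add: dist_real_def)
    then show "\<exists>M. \<forall>m\<ge>M. \<forall>n\<ge>M. dist (N (a m)) (N (a n)) < e" by blast
  qed
  then show ?thesis by (rule Cauchy_convergent)
qed

lemma C_bound: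
  assumes a: "a \<in> carrier C"
  obtains K where "K > 0" "\<And>i. N (a i) \<le> K"
proof -
  obtain K where "K > 0" "\<And>i. \<bar>N (a i)\<bar> \<le> K"
    using C_convergent[OF a] convergent_imp_Bseq BseqE by (metis real_norm_def)
  then show thesis using that[of K] by (meson abs_le_D1)
qed

lemma C_add:
  assumes a: "a \<in> carrier C" and b: "b \<in> carrier C"
  shows "(\<lambda>i. a i + b i) \<in> carrier C"
proof (rule C_I)
  fix e :: real assume "e > 0"
  then have e: "e / 2 > 0" by simp
  obtain L where L: "\<And>i j. i \<ge> L \<Longrightarrow> j \<ge> L \<Longrightarrow> N (a i - a j) < e / 2" using C_D[OF a e] by blast
  obtain M where M: "\<And>i j. i \<ge> M \<Longrightarrow> j \<ge> M \<Longrightarrow> N (b i - b j) < e / 2" using C_D[OF b e] by blast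
  have "N (a i + b i - (a j + b j)) < e" if "i \<ge> max L M" "j \<ge> max L M" for i j
  proof -
    have "N (a i + b i - (a j + b j)) = N ((a i - a j) + (b i - b j))" by (simp add: algebra_simps)
    also have "\<dots> \<le> N (a i - a j) + N (b i - b j)"
      using a b by (intro N.triangle star_polys_closed C_poly)
    also have "\<dots> < e" using L[of i j] M[of i j] that by simp
    finally show ?thesis .
  qed
  then show "\<exists>L. \<forall>i\<ge>L. \<forall>j\<ge>L. N (a i + b i - (a j + b j)) < e" by blast
qed (use a b in \<open>auto simp: C_poly\<close>)

lemma C_mult:
  assumes a: "a \<in> carrier C" and b: "b \<in> carrier C"
  shows "(\<lambda>i. a i * b i) \<in> carrier C"
proof (rule C_I)
  fix e :: real assume "e > 0"
  obtain K where K: "K > 0" "\<And>i. N (a i) \<le> K" using C_bound[OF a] by blast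
  obtain K' where K': "K' > 0" "\<And>i. N (b i) \<le> K'" using C_bound[OF b] by blast
  have e: "e / (2 * K) > 0" "e / (2 * K') > 0" using K K' \<open>e > 0\<close> by auto
  obtain L where L: "\<And>i j. i \<ge> L \<Longrightarrow> j \<ge> L \<Longrightarrow> N (a i - a j) < e / (2 * K')" using C_D[OF a e(2)] by blast
  obtain M where M: "\<And>i j. i \<ge> M \<Longrightarrow> j \<ge> M \<Longrightarrow> N (b i - b j) < e / (2 * K)" using C_D[OF b e(1)] by blast
  have "N (a i * b i - a j * b j) < e" if "i \<ge> max L M" "j \<ge> max L M" for i j
  proof -
    note cl = star_polys_closed C_poly[OF a] C_poly[OF b]
    have "N (a i * b i - a j * b j) = N (a i * (b i - b j) + (a i - a j) * b j)"
      by (simp add: algebra_simps)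
    also have "\<dots> \<le> N (a i * (b i - b j)) + N ((a i - a j) * b j)"
      by (intro N.triangle cl)
    also have "\<dots> \<le> N (a i) * N (b i - b j) + N (a i - a j) * N (b j)"
      by (intro add_mono N.submult cl)
    also have "\<dots> \<le> K * N (b i - b j) + N (a i - a j) * K'"
      by (intro add_mono mult_mono order.refl K K' N.nonneg cl less_imp_le[OF K(1)])
    also have "\<dots> < K * (e / (2 * K)) + e / (2 * K') * K'"
      using L[of i j] M[of i j] that K K'
      by (intro add_strict_mono mult_strict_left_mono mult_strict_right_mono) auto
    also have "\<dots> = e" using K K' by simp
    finally show ?thesis .
  qed
  then show "\<exists>L. \<forall>i\<ge>L. \<forall>j\<ge>L. N (a i * b i - a j * b j) < e" by blast
qed (use a b in \<open>auto simp: C_poly\<close>)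

lemma C_const: "p \<in> star_polys G \<Longrightarrow> (\<lambda>_. p) \<in> carrier C"
  by (rule C_I) (auto simp: N.zero)

lemma C_uminus: "a \<in> carrier C \<Longrightarrow> (\<lambda>i. - a i) \<in> carrier C"
  using C_mult[OF C_const[of "-1"], of a] by auto

lemma C_diff: "a \<in> carrier C \<Longrightarrow> b \<in> carrier C \<Longrightarrow> (\<lambda>i. a i - b i) \<in> carrier C"
  using C_add[OF _ C_uminus, of a b] by simp

lemma C_scale: "a \<in> carrier C \<Longrightarrow> (\<lambda>i. ncconst c * a i) \<in> carrier C"
  using C_mult[OF C_const[of "ncconst c"], of a] by auto

lemma C_adj: "a \<in> carrier C \<Longrightarrow> (\<lambda>i. star_adj (a i)) \<in> carrier C"
  by (auto simp: C_iff N.adj simp flip: star_adj_diff)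

lemma ring_C: "ring C"
proof (rule ringI)
  show "abelian_group C"
  proof (rule abelian_groupI)
    fix a assume a: "a \<in> carrier C"
    show "\<exists>y\<in>carrier C. y \<oplus>\<^bsub>C\<^esub> a = \<zero>\<^bsub>C\<^esub>"
      by (rule bexI[OF _ C_uminus[OF a]]) simp
  qed (auto simp: C_add algebra_simps C_const)
  show "Group.monoid C"
    by (rule monoidI) (auto simp: C_mult algebra_simps C_const)
qed (auto simp: algebra_simps)

lemma I_iff: "a \<in> I \<longleftrightarrow> (\<forall>i. a i \<in> star_polys G) \<and> (\<lambda>i. N (a i)) \<longlonglongrightarrow> 0"
  by (simp add: null_seqs_def)

lemma I_squeeze:
  assumes "\<And>i. a i \<in> star_polys G" "f \<longlonglongrightarrow> 0" "\<And>i. N (a i) \<le> f i"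
  shows "a \<in> I"
  unfolding I_iff
proof (intro conjI allI)
  show "(\<lambda>i. N (a i)) \<longlonglongrightarrow> 0"
    by (rule tendsto_sandwich[OF _ _ tendsto_const assms(2)]) (use assms N.nonneg in auto)
qed (use assms in auto)

lemma I_C: "a \<in> I \<Longrightarrow> a \<in> carrier C"
proof (rule C_I)
  assume a: "a \<in> I"
  fix e :: real assume "e > 0"
  have "(\<lambda>i. N (a i)) \<longlonglongrightarrow> 0" using a by (simp add: I_iff)
  from LIMSEQ_D[OF this, of "e / 2"] \<open>e > 0\<close>
  obtain L where L: "\<And>i. i \<ge> L \<Longrightarrow> N (a i) < e / 2" by fastforce
  have "N (a i - a j) < e" if "i \<ge> L" "j \<ge> L" for i j
    using N.diff[of "a i" "a j"] L[OF that(1)] L[OF that(2)] a by (simp add: I_iff)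
  then show "\<exists>L. \<forall>i\<ge>L. \<forall>j\<ge>L. N (a i - a j) < e" by blast
qed (simp add: I_iff)

lemma I_add: "a \<in> I \<Longrightarrow> b \<in> I \<Longrightarrow> (\<lambda>i. a i + b i) \<in> I"
  using tendsto_add[of "\<lambda>i. N (a i)" 0 sequentially "\<lambda>i. N (b i)" 0]
  by (intro I_squeeze[where f = "\<lambda>i. N (a i) + N (b i)"]) (auto simp: I_iff N.triangle)

lemma I_mult_left:
  assumes a: "a \<in> carrier C" and b: "b \<in> I"
  shows "(\<lambda>i. a i * b i) \<in> I"
proof -
  obtain K where K: "K > 0" "\<And>i. N (a i) \<le> K" using C_bound[OF a] by blast
  show ?thesis
  proof (rule I_squeeze)
    show "(\<lambda>i. K * N (b i)) \<longlonglongrightarrow> 0"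
      using tendsto_mult_left[of "\<lambda>i. N (b i)" 0 sequentially K] b by (simp add: I_iff)
    show "N (a i * b i) \<le> K * N (b i)" for i
      using N.submult[of "a i" "b i"] mult_right_mono[OF K(2)[of i], of "N (b i)"] b C_poly[OF a]
        N.nonneg[of "b i"] by (fastforce simp: I_iff)
  qed (use a b in \<open>auto simp: C_poly I_iff\<close>)
qed

lemma I_mult_right:
  assumes a: "a \<in> carrier C" and b: "b \<in> I"
  shows "(\<lambda>i. b i * a i) \<in> I"
proof -
  obtain K where K: "K > 0" "\<And>i. N (a i) \<le> K" using C_bound[OF a] by blast
  show ?thesis
  proof (rule I_squeeze)
    show "(\<lambda>i. N (b i) * K) \<longlonglongrightarrow> 0"
      using tendsto_mult_right[of "\<lambda>i. N (b i)" 0 sequentially K] b by (simp add: I_iff)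
    show "N (b i * a i) \<le> N (b i) * K" for i
      using N.submult[of "b i" "a i"] mult_left_mono[OF K(2)[of i], of "N (b i)"] b C_poly[OF a]
        N.nonneg[of "b i"] by (fastforce simp: I_iff)
  qed (use a b in \<open>auto simp: C_poly I_iff\<close>)
qed

lemma I_uminus: "a \<in> I \<Longrightarrow> (\<lambda>i. - a i) \<in> I"
  using I_mult_left[OF C_const[of "-1"], of a] by auto

lemma I_adj: "a \<in> I \<Longrightarrow> (\<lambda>i. star_adj (a i)) \<in> I"
  by (auto simp: I_iff N.adj)

lemma I_0: "(\<lambda>_. 0) \<in> I"
  by (simp add: I_iff N.zero)

lemma C_a_inv: "a \<in> carrier C \<Longrightarrow> \<ominus>\<^bsub>C\<^esub> a = (\<lambda>i. - a i)"
proof -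
  interpret C: ring C by (rule ring_C)
  assume "a \<in> carrier C"
  then show ?thesis by (intro C.minus_equality) (auto simp: C_uminus)
qed

lemma ideal_I: "ideal I C"
proof (rule idealI)
  interpret C: ring C by (rule ring_C)
  show "ring C" by (rule ring_C)
  show "subgroup I (add_monoid C)"
  proof
    show "inv\<^bsub>add_monoid C\<^esub> a \<in> I" if "a \<in> I" for a
      using C_a_inv[OF I_C[OF that]] I_uminus[OF that] by (simp add: a_inv_def)
  qed (auto simp: I_C I_add I_0)
qed (auto simp: I_mult_left I_mult_right)

sublocale I: ideal I C
  by (rule ideal_I)

lemma U_simps:
  "carrier U = carrier (C Quot I)" "mult U = mult (C Quot I)" "one U = one (C Quot I)"
  "zero U = zero (C Quot I)" "add U = add (C Quot I)"
  "smult U c A = (\<Union>a\<in>A. cl (\<lambda>i. ncconst c * a i))"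
  "adjoint U A = (\<Union>a\<in>A. cl (\<lambda>i. star_adj (a i)))"
  "cnorm U A = the_elem ((\<lambda>a. lim (\<lambda>i. N (a i))) ` A)"
  by (simp_all add: univ_cstar_def Let_def)

lemma ring_U: "ring U"
proof -
  interpret Q: ring "C Quot I" by (rule I.quotient_is_ring)
  show ?thesis
  proof (rule ringI)
    show "abelian_group U"
    proof (rule abelian_groupI)
      fix a assume "a \<in> carrier U"
      then show "\<exists>y\<in>carrier U. y \<oplus>\<^bsub>U\<^esub> a = \<zero>\<^bsub>U\<^esub>"
        unfolding U_simps by (intro bexI[of _ "\<ominus>\<^bsub>C Quot I\<^esub> a"]) (auto simp: Q.l_neg)
    qed (simp_all add: U_simps Q.a_ac Q.a_assoc)
    show "Group.monoid U"
      by (rule monoidI) (simp_all add: U_simps Q.m_assoc)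
  qed (simp_all add: U_simps Q.l_distr Q.r_distr)
qed

sublocale U: ring U
  by (rule ring_U)

lemma cl_iff: "a \<in> carrier C \<Longrightarrow> b \<in> cl a \<longleftrightarrow> (\<lambda>i. b i - a i) \<in> I"
proof
  assume "b \<in> cl a"
  then show "(\<lambda>i. b i - a i) \<in> I"
    by (auto simp: seq_class_def a_r_coset_def r_coset_def)
next
  assume a: "(\<lambda>i. b i - a i) \<in> I"
  have "b = (\<lambda>i. (b i - a i) + a i)" by simp
  with a show "b \<in> cl a"
    unfolding seq_class_def a_r_coset_def r_coset_def by fastforce
qed

lemma cl_C: "a \<in> carrier C \<Longrightarrow> b \<in> cl a \<Longrightarrow> b \<in> carrier C"
  using C_add[of "\<lambda>i. b i - a i" a] by (auto simp: cl_iff I_C)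

lemma cl_self: "a \<in> carrier C \<Longrightarrow> a \<in> cl a"
  by (simp add: cl_iff I_0)

lemma cl_eq:
  assumes "a \<in> carrier C" "b \<in> carrier C" "(\<lambda>i. a i - b i) \<in> I"
  shows "cl a = cl b"
proof (rule Set.set_eqI)
  fix x
  have "(\<lambda>i. x i - a i) \<in> I \<longleftrightarrow> (\<lambda>i. x i - b i) \<in> I"
    using I_add[OF _ assms(3), of "\<lambda>i. x i - a i"] I_add[OF _ I_uminus[OF assms(3)], of "\<lambda>i. x i - b i"]
    by (auto simp: algebra_simps)
  then show "x \<in> cl a \<longleftrightarrow> x \<in> cl b" using assms by (simp add: cl_iff)
qed

lemma cl_eq_iff:
  assumes "a \<in> carrier C" "b \<in> carrier C"
  shows "cl a = cl b \<longleftrightarrow> (\<lambda>i. a i - b i) \<in> I"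
  using cl_eq[OF assms] cl_self[OF assms(1)] cl_iff[OF assms(2), of a] by auto

lemma carrier_U: "carrier U = cl ` carrier C"
  by (auto simp: U_simps FactRing_def A_RCOSETS_def RCOSETS_def a_r_coset_def seq_class_def)

lemma U_mult [simp]: "a \<in> carrier C \<Longrightarrow> b \<in> carrier C \<Longrightarrow> cl a \<otimes>\<^bsub>U\<^esub> cl b = cl (\<lambda>i. a i * b i)"
  using I.rcoset_mult_add[of a b] by (simp add: U_simps FactRing_def seq_class_def)

lemma U_add [simp]: "a \<in> carrier C \<Longrightarrow> b \<in> carrier C \<Longrightarrow> cl a \<oplus>\<^bsub>U\<^esub> cl b = cl (\<lambda>i. a i + b i)"
  using I.a_rcos_sum[of a b] by (simp add: U_simps FactRing_def seq_class_def)

lemma U_one: "\<one>\<^bsub>U\<^esub> = cl (\<lambda>_. 1)"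
  by (simp add: U_simps FactRing_def seq_class_def)

lemma U_zero: "\<zero>\<^bsub>U\<^esub> = cl (\<lambda>_. 0)"
  using cl_iff[OF C_const[of 0]] by (auto simp: U_simps FactRing_def)

lemma U_smult [simp]:
  assumes a: "a \<in> carrier C"
  shows "c \<odot>\<^bsub>U\<^esub> cl a = cl (\<lambda>i. ncconst c * a i)"
proof -
  have eq: "cl (\<lambda>i. ncconst c * b i) = cl (\<lambda>i. ncconst c * a i)" if b: "b \<in> cl a" for b
  proof (rule cl_eq)
    show "(\<lambda>i. ncconst c * b i - ncconst c * a i) \<in> I"
      using I_mult_left[OF C_const[of "ncconst c"], of "\<lambda>i. b i - a i"] b a
      by (simp add: cl_iff right_diff_distrib)
  qed (use a cl_C[OF a b] in \<open>auto simp: C_scale\<close>)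
  have "(\<Union>b\<in>cl a. cl (\<lambda>i. ncconst c * b i)) = cl (\<lambda>i. ncconst c * a i)" 
    by (intro SUP_eq_const eq) (use cl_self[OF a] in blast)
  then show ?thesis by (simp only: U_simps)
qed

lemma U_adjoint [simp]:
  assumes a: "a \<in> carrier C"
  shows "adjoint U (cl a) = cl (\<lambda>i. star_adj (a i))"
proof -
  have eq: "cl (\<lambda>i. star_adj (b i)) = cl (\<lambda>i. star_adj (a i))" if b: "b \<in> cl a" for b
  proof (rule cl_eq)
    show "(\<lambda>i. star_adj (b i) - star_adj (a i)) \<in> I"
      using I_adj[of "\<lambda>i. b i - a i"] b a by (simp add: cl_iff star_adj_diff)
  qed (use a cl_C[OF a b] in \<open>auto simp: C_adj\<close>)
  have "(\<Union>b\<in>cl a. cl (\<lambda>i. star_adj (b i))) = cl (\<lambda>i. star_adj (a i))" 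
    by (intro SUP_eq_const eq) (use cl_self[OF a] in blast)
  then show ?thesis by (simp only: U_simps)
qed

lemma U_cnorm:
  assumes a: "a \<in> carrier C"
  shows "cnorm U (cl a) = lim (\<lambda>i. N (a i))"
proof -
  have "lim (\<lambda>i. N (b i)) = lim (\<lambda>i. N (a i))" if b: "b \<in> cl a" for b
  proof -
    have "(\<lambda>i. N (b i - a i)) \<longlonglongrightarrow> 0" using b a by (simp add: cl_iff I_iff)
    then have "(\<lambda>i. N (b i) - N (a i)) \<longlonglongrightarrow> 0"
      by (rule tendsto_0_le[where K = 1])
         (use N.abs_diff C_poly[OF a] C_poly[OF cl_C[OF a b]] in
           \<open>auto intro!: always_eventually intro: order.trans[OF _ abs_ge_self]\<close>)
    moreover have "(\<lambda>i. N (a i)) \<longlonglongrightarrow> lim (\<lambda>i. N (a i))"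
      using C_convergent[OF a] by (simp add: convergent_LIMSEQ_iff)
    ultimately have "(\<lambda>i. (N (b i) - N (a i)) + N (a i)) \<longlonglongrightarrow> 0 + lim (\<lambda>i. N (a i))"
      by (rule tendsto_add)
    then show ?thesis by (simp add: limI)
  qed
  then have "(\<lambda>a. lim (\<lambda>i. N (a i))) ` cl a = {lim (\<lambda>i. N (a i))}"
    using cl_self[OF a] by blast
  then show ?thesis by (simp add: U_simps)
qed

lemma U_cnorm_lim: "a \<in> carrier C \<Longrightarrow> (\<lambda>i. N (a i)) \<longlonglongrightarrow> cnorm U (cl a)"
  using C_convergent[of a] by (simp add: U_cnorm convergent_LIMSEQ_iff)

lemma U_uminus [simp]: "a \<in> carrier C \<Longrightarrow> \<ominus>\<^bsub>U\<^esub> cl a = cl (\<lambda>i. - a i)"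
  by (intro U.minus_equality) (auto simp: C_uminus U_zero carrier_U)

lemma U_diff [simp]: "a \<in> carrier C \<Longrightarrow> b \<in> carrier C \<Longrightarrow> cl a \<ominus>\<^bsub>U\<^esub> cl b = cl (\<lambda>i. a i - b i)"
  by (simp add: a_minus_def C_uminus)

lemma U_complete:
  assumes X: "\<And>i::nat. X i \<in> carrier U"
    and Cau: "\<And>e. e > 0 \<Longrightarrow> \<exists>L. \<forall>i\<ge>L. \<forall>j\<ge>L. cnorm U (X i \<ominus>\<^bsub>U\<^esub> X j) < e"
  shows "\<exists>l\<in>carrier U. (\<lambda>i. cnorm U (X i \<ominus>\<^bsub>U\<^esub> l)) \<longlonglongrightarrow> 0"
proof -
  have "\<forall>i. \<exists>a. a \<in> carrier C \<and> X i = cl a" using X by (auto simp: carrier_U)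
  then obtain a where a: "\<And>i. a i \<in> carrier C" "\<And>i. X i = cl (a i)" by metis
  have "\<exists>m. \<forall>p\<ge>m. \<forall>q\<ge>m. N (a i p - a i q) < inverse (real (Suc i))" for i
    using C_D[OF a(1)[of i], of "inverse (real (Suc i))"] by (metis inverse_positive_iff_positive of_nat_0_less_iff zero_less_Suc)
  then obtain m where m: "\<And>i p q. p \<ge> m i \<Longrightarrow> q \<ge> m i \<Longrightarrow> N (a i p - a i q) < inverse (real (Suc i))"
    by metis
  define y where "y i = a i (m i)" for i
  have y: "y i \<in> star_polys G" for i unfolding y_def by (rule C_poly[OF a(1)])
  note sp = star_polys_closed C_poly[OF a(1)] y
  have eps: "\<exists>L. \<forall>i\<ge>L. inverse (real (Suc i)) < e" if "e > 0" for e
    using LIMSEQ_D[OF LIMSEQ_inverse_real_of_nat that] by auto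
  have close: "\<exists>L. \<forall>i\<ge>L. \<forall>j\<ge>L. \<exists>P. \<forall>p\<ge>P. N (a i p - a j p) < e" if e: "e > 0" for e
  proof -
    obtain L where L: "\<And>i j. i \<ge> L \<Longrightarrow> j \<ge> L \<Longrightarrow> cnorm U (X i \<ominus>\<^bsub>U\<^esub> X j) < e" using Cau[OF e] by blast
    have "\<exists>P. \<forall>p\<ge>P. N (a i p - a j p) < e" if "i \<ge> L" "j \<ge> L" for i j
    proof -
      have "(\<lambda>p. N (a i p - a j p)) \<longlonglongrightarrow> cnorm U (X i \<ominus>\<^bsub>U\<^esub> X j)"
        using U_cnorm_lim[OF C_diff[OF a(1)[of i] a(1)[of j]]] by (simp add: a)
      from order_tendstoD(2)[OF this L[OF that]] show ?thesis
        by (simp add: eventually_sequentially)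
    qed
    then show ?thesis by blast
  qed
  have yC: "y \<in> carrier C"
  proof (rule C_I[OF y])
    fix e :: real assume "e > 0"
    then have e: "e / 3 > 0" by simp
    obtain L1 where L1: "\<And>i. i \<ge> L1 \<Longrightarrow> inverse (real (Suc i)) < e / 3" using eps[OF e] by blast
    obtain L2 where L2: "\<And>i j. i \<ge> L2 \<Longrightarrow> j \<ge> L2 \<Longrightarrow> \<exists>P. \<forall>p\<ge>P. N (a i p - a j p) < e / 3"
      using close[OF e] by blast
    have "N (y i - y j) < e" if ij: "i \<ge> max L1 L2" "j \<ge> max L1 L2" for i j
    proof -
      obtain P where P: "\<And>p. p \<ge> P \<Longrightarrow> N (a i p - a j p) < e / 3" using L2[of i j] ij by auto
      define p where "p = max P (max (m i) (m j))"
      have p: "p \<ge> P" "p \<ge> m i" "p \<ge> m j" by (auto simp: p_def)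
      have "N (y i - y j) = N ((a i (m i) - a i p) + ((a i p - a j p) + (a j p - a j (m j))))"
        by (simp add: y_def)
      also have "\<dots> \<le> N (a i (m i) - a i p) + N ((a i p - a j p) + (a j p - a j (m j)))"
        by (intro N.triangle sp)
      also have "\<dots> \<le> N (a i (m i) - a i p) + (N (a i p - a j p) + N (a j p - a j (m j)))"
        by (intro add_left_mono N.triangle sp)
      also have "\<dots> < e"
        using m[of i "m i" p] m[of j p "m j"] P[of p] p L1[of i] L1[of j] ij by simp
      finally show ?thesis .
    qed
    then show "\<exists>L. \<forall>i\<ge>L. \<forall>j\<ge>L. N (y i - y j) < e" by blast
  qed
  have "(\<lambda>i. cnorm U (X i \<ominus>\<^bsub>U\<^esub> cl y)) \<longlonglongrightarrow> 0"
  proof (rule LIMSEQ_I)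
    fix e :: real assume "e > 0"
    then have e: "e / 4 > 0" by simp
    obtain L1 where L1: "\<And>i. i \<ge> L1 \<Longrightarrow> inverse (real (Suc i)) < e / 4" using eps[OF e] by blast
    obtain L2 where L2: "\<And>i j. i \<ge> L2 \<Longrightarrow> j \<ge> L2 \<Longrightarrow> N (y i - y j) < e / 4" using C_D[OF yC e] by blast
    have "norm (cnorm U (X i \<ominus>\<^bsub>U\<^esub> cl y) - 0) < e" if i: "i \<ge> max L1 L2" for i
    proof -
      have lim: "(\<lambda>p. N (a i p - y p)) \<longlonglongrightarrow> cnorm U (X i \<ominus>\<^bsub>U\<^esub> cl y)"
        using U_cnorm_lim[OF C_diff[OF a(1)[of i] yC]] by (simp add: a yC)
      have "N (a i p - y p) \<le> e / 2" if p: "p \<ge> max (m i) L2" for p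
      proof -
        have "N (a i p - y p) = N ((a i p - a i (m i)) + (y i - y p))" by (simp add: y_def)
        also have "\<dots> \<le> N (a i p - a i (m i)) + N (y i - y p)" by (intro N.triangle sp)
        also have "\<dots> \<le> e / 2" using m[of i p "m i"] L1[of i] L2[of i p] i p by simp
        finally show ?thesis .
      qed
      then have "cnorm U (X i \<ominus>\<^bsub>U\<^esub> cl y) \<le> e / 2" by (intro LIMSEQ_le_const2[OF lim]) blast
      moreover have "cnorm U (X i \<ominus>\<^bsub>U\<^esub> cl y) \<ge> 0"
        by (rule LIMSEQ_le_const[OF lim]) (intro exI allI impI N.nonneg sp)
      ultimately show ?thesis using \<open>e > 0\<close> by simp
    qed
    then show "\<exists>no. \<forall>i\<ge>no. norm (cnorm U (X i \<ominus>\<^bsub>U\<^esub> cl y) - 0) < e" by blast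
  qed
  with yC show ?thesis by (auto simp: carrier_U)
qed

lemmas C_closed = C_add C_mult C_diff C_uminus C_scale C_adj C_const

theorem unital_cstar_algebra_univ_cstar: "unital_cstar_algebra U"
proof (unfold_locales, goal_cases)
  case (7 a b c)
  have "ncconst c * (p * q) = p * (ncconst c * q)" for p q :: "'g star_poly"
    by (metis mult.assoc ncconst_comm)
  then show ?case using 7 by (auto simp: carrier_U C_closed)
next
  case (11 a c)
  have "star_adj (ncconst c * p) = ncconst (cnj c) * star_adj p" for p :: "'g star_poly"
    by (simp add: star_adj_mult star_adj_const ncconst_comm)
  then show ?case using 11 by (auto simp: carrier_U C_closed)
next
  case (13 a)
  then obtain x where x: "x \<in> carrier C" "a = cl x" by (auto simp: carrier_U)
  show ?case unfolding x by (rule LIMSEQ_le_const[OF U_cnorm_lim[OF x(1)]]) (intro exI allI impI N.nonneg C_poly x)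
next
  case (14 a)
  then obtain x where x: "x \<in> carrier C" "a = cl x" by (auto simp: carrier_U)
  have "cnorm U a = 0 \<longleftrightarrow> (\<lambda>i. N (x i)) \<longlonglongrightarrow> 0"
    using U_cnorm_lim[OF x(1)] by (auto simp: x dest: LIMSEQ_unique)
  then show ?case using x by (simp add: U_zero cl_eq_iff C_const I_iff C_poly)
next
  case (15 a b)
  then obtain x y where x: "x \<in> carrier C" "a = cl x" "y \<in> carrier C" "b = cl y" by (auto simp: carrier_U)
  have "cnorm U (cl (\<lambda>i. x i + y i)) \<le> cnorm U (cl x) + cnorm U (cl y)"
    using x by (intro LIMSEQ_le[OF U_cnorm_lim tendsto_add[OF U_cnorm_lim U_cnorm_lim]])
      (auto simp: C_closed C_poly N.triangle)
  then show ?case using x by simp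
next
  case (16 a c)
  then obtain x where x: "x \<in> carrier C" "a = cl x" by (auto simp: carrier_U)
  have "(\<lambda>i. N (ncconst c * x i)) \<longlonglongrightarrow> cmod c * cnorm U a"
    using x U_cnorm_lim[of x] by (simp add: N.scale C_poly tendsto_mult_left)
  then show ?case using x U_cnorm_lim[OF C_scale, of x c] by (auto dest: LIMSEQ_unique)
next
  case (17 a b)
  then obtain x y where x: "x \<in> carrier C" "a = cl x" "y \<in> carrier C" "b = cl y" by (auto simp: carrier_U)
  have "cnorm U (cl (\<lambda>i. x i * y i)) \<le> cnorm U (cl x) * cnorm U (cl y)"
    using x by (intro LIMSEQ_le[OF U_cnorm_lim tendsto_mult[OF U_cnorm_lim U_cnorm_lim]])
      (auto simp: C_closed C_poly N.submult)
  then show ?case using x by simp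
next
  case (18 a)
  then obtain x where x: "x \<in> carrier C" "a = cl x" by (auto simp: carrier_U)
  have "(\<lambda>i. N (star_adj (x i) * x i)) \<longlonglongrightarrow> (cnorm U a)\<^sup>2"
    using x tendsto_power[OF U_cnorm_lim[of x], of 2] by (simp add: N.cstar_id C_poly)
  then show ?case using x U_cnorm_lim[OF C_mult[OF C_adj], of x x]
    by (auto simp: C_closed dest: LIMSEQ_unique)
next
  case (19 X)
  then show ?case by (rule U_complete)
next
  case (1 a c)
  then obtain x where x: "x \<in> carrier C" "a = cl x" by (auto simp: carrier_U)
  then show ?case by (simp add: carrier_U C_scale)
next
  case (8 a)
  then obtain x where x: "x \<in> carrier C" "a = cl x" by (auto simp: carrier_U)
  then show ?case by (simp add: carrier_U C_adj)
qed (unfold carrier_U, (elim imageE, simp add: C_closed ncconst_add ncconst_mult star_adj_add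
      star_adj_mult distrib_left distrib_right mult.assoc)+)

end
context cstar_seminormed
begin

lemma one_le: "s 1 \<le> 1"
proof -
  have "s 1 = (s 1)\<^sup>2" using cstar_id[of 1] by simp
  then show ?thesis using nonneg[of 1] by (auto simp: power2_eq_square)
qed

lemma word_le:
  assumes "\<And>g. g \<in> G \<Longrightarrow> s (star_gen g) \<le> 1" "set ls \<subseteq> G \<times> UNIV"
  shows "s (Poly_Mapping.single (FMon ls) 1) \<le> 1"
  using assms(2)
proof (induction ls)
  case Nil
  show ?case using one_le by (simp flip: zero_fmon_def)
next
  case (Cons l ls)
  obtain g b where l: "l = (g, b)" "g \<in> G" using Cons.prems by auto
  have star: "star_adj (star_gen g) = ncvar (g, True)"
    by (simp add: star_gen_def ncvar_def star_adj_single star_word_def)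
  have "s (ncvar l) \<le> 1"
    using assms(1)[OF l(2)] adj[OF star_polys_gen[OF l(2)]] star
    by (cases b) (simp_all add: l(1) star_gen_def)
  have sp: "ncvar l \<in> star_polys G" "Poly_Mapping.single (FMon ls) 1 \<in> star_polys G"
    using Cons.prems by (auto simp: star_polys_def ncpolys_def ncvar_def)
  have "Poly_Mapping.single (FMon (l # ls)) 1 = ncvar l * Poly_Mapping.single (FMon ls) 1"
    by (simp add: ncvar_def mult_single plus_fmon_def)
  then have "s (Poly_Mapping.single (FMon (l # ls)) 1) \<le> s (ncvar l) * s (Poly_Mapping.single (FMon ls) 1)"
    using submult[OF sp] by simp
  also have "\<dots> \<le> 1 * 1"
    using Cons \<open>s (ncvar l) \<le> 1\<close> sp by (intro mult_mono) (auto intro: nonneg)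
  finally show ?case by simp
qed

lemma poly_le:
  assumes "\<And>g. g \<in> G \<Longrightarrow> s (star_gen g) \<le> 1" and p: "p \<in> star_polys G"
  shows "s p \<le> (\<Sum>w\<in>Poly_Mapping.keys p. cmod (Poly_Mapping.lookup p w))"
proof -
  let ?t = "\<lambda>w. ncconst (Poly_Mapping.lookup p w) * Poly_Mapping.single w 1"
  have *: "p = (\<Sum>w\<in>Poly_Mapping.keys p. ?t w)"
    by (rule poly_mapping_eqI)
       (simp add: lookup_sum lookup_single when_def sum.delta' in_keys_iff ncconst_def mult_single)
  have "s (\<Sum>w\<in>T. ?t w) \<le> (\<Sum>w\<in>T. cmod (Poly_Mapping.lookup p w))"
    if "finite T" "T \<subseteq> Poly_Mapping.keys p" for T
    using that
  proof induction
    case empty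
    show ?case by (simp add: zero)
  next
    case (insert w T)
    have sp: "Poly_Mapping.single v 1 \<in> star_polys G" if "v \<in> Poly_Mapping.keys p" for v
      using that p by (auto simp: star_polys_def ncpolys_def)
    have "s (\<Sum>w\<in>insert w T. ?t w) \<le> s (?t w) + s (\<Sum>w\<in>T. ?t w)"
      unfolding sum.insert[OF insert(1,2)] using insert.prems
      by (intro triangle star_polys_sum star_polys_closed sp) auto
    also have "s (?t w) \<le> cmod (Poly_Mapping.lookup p w)"
      using scale[OF sp[of w]] word_le[OF assms(1), of "letters w"] insert.prems p
      by (auto simp: star_polys_def ncpolys_def mult_left_le)
    finally show ?case using insert by simp
  qed
  from this[of "Poly_Mapping.keys p"] show ?thesis using * by simp
qed

end

lemma cstar_presentation_Mi: "cstar_presentation (Mi_gens n k) (Mi_rels n k)"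
proof
  let ?G = "Mi_gens n k" and ?R = "Mi_rels n k"
  show "?R \<subseteq> star_polys ?G"
    by (auto simp: Mi_rels_def Let_def Mi_gens_def intro!: star_polys_closed star_polys_sum)
  fix a :: "(nat \<times> nat) star_poly" assume a: "a \<in> star_polys ?G"
  show "bdd_above {s a |s. cstar_seminorm ?G s \<and> (\<forall>r\<in>?R. s r = 0)}"
  proof (rule bdd_aboveI, clarify)
    fix s assume s: "cstar_seminorm ?G s" and R: "\<forall>r\<in>?R. s r = 0"
    interpret cstar_seminormed ?G s by unfold_locales (rule s)
    have "s (star_gen g) \<le> 1" if g: "g \<in> ?G" for g
    proof -
      let ?u = "star_gen g"
      have u: "?u \<in> star_polys ?G" using g by simp
      obtain i j where "g = (i, j)" "i \<in> {1..n}" "j \<in> {1..k}" using g by (auto simp: Mi_gens_def)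
      then have "star_adj ?u - ?u \<in> ?R" "?u * ?u - ?u \<in> ?R" unfolding Mi_rels_def Let_def by blast+
      then have 0: "s (star_adj ?u - ?u) = 0" "s (?u * ?u - ?u) = 0" using R by blast+
      have "(s ?u)\<^sup>2 = s ((star_adj ?u - ?u) * ?u + ((?u * ?u - ?u) + ?u))"
        using cstar_id[OF u] by (simp add: algebra_simps)
      also have "\<dots> \<le> s ((star_adj ?u - ?u) * ?u) + s ((?u * ?u - ?u) + ?u)"
        using u by (intro triangle) auto
      also have "\<dots> \<le> s (star_adj ?u - ?u) * s ?u + (s (?u * ?u - ?u) + s ?u)"
        using u by (intro add_mono submult triangle) auto
      finally have "(s ?u)\<^sup>2 \<le> s ?u" by (simp add: 0)
      then show ?thesis using nonneg[OF u]
        by (cases "s ?u = 0") (auto simp: power2_eq_square)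
    qed
    from poly_le[OF this a]
    show "s a \<le> (\<Sum>w\<in>Poly_Mapping.keys a. cmod (Poly_Mapping.lookup a w))" by simp
  qed
qed

theorem unital_cstar_algebra_Mi: "unital_cstar_algebra (Mi n k)"
  unfolding Mi_def
  by (rule cstar_presentation.unital_cstar_algebra_univ_cstar[OF cstar_presentation_Mi])

lemma (in cstar_presentation) univ_class_rel: "r \<in> R \<Longrightarrow> univ_class G R r = \<zero>\<^bsub>univ_cstar G R\<^esub>"
  using rels by (auto simp: univ_class_def U_zero cl_eq_iff C_const I_iff N_rel subset_eq)
subsection \<open>The universal property\<close>

locale cstar_representation = cstar_presentation G R + D: unital_cstar_algebra D
  for G :: "'g set" and R and D :: "('m, 'z) cstar_alg_scheme" +
  fixes v :: "'g \<Rightarrow> 'm"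
  assumes v_closed: "g \<in> G \<Longrightarrow> v g \<in> carrier D"
    and v_rels: "r \<in> R \<Longrightarrow> nc_hom D (\<lambda>(g, b). if b then adjoint D (v g) else v g) r = \<zero>\<^bsub>D\<^esub>"
begin

abbreviation "h \<equiv> \<lambda>(g, b). if b then adjoint D (v g) else v g"
abbreviation "ev \<equiv> nc_hom D h"
abbreviation "W \<equiv> \<lambda>ls. foldr (\<lambda>g t. h g \<otimes>\<^bsub>D\<^esub> t) ls \<one>\<^bsub>D\<^esub>"

lemma h_closed: "l \<in> G \<times> UNIV \<Longrightarrow> h l \<in> carrier D"
  by (auto simp: v_closed D.adjoint_closed)

lemma W_closed: "set ls \<subseteq> G \<times> UNIV \<Longrightarrow> W ls \<in> carrier D"
  by (induction ls) (auto simp: v_closed D.adjoint_closed)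

lemma W_append: "set ls \<subseteq> G \<times> UNIV \<Longrightarrow> set ls' \<subseteq> G \<times> UNIV \<Longrightarrow> W (ls @ ls') = W ls \<otimes>\<^bsub>D\<^esub> W ls'"
proof (induction ls)
  case Nil
  then show ?case using W_closed[of ls'] by simp
next
  case (Cons l ls)
  then show ?case using h_closed[of l] W_closed[of ls] W_closed[of ls'] by (simp add: D.m_assoc)
qed

lemma D_adjoint_one: "adjoint D \<one>\<^bsub>D\<^esub> = \<one>\<^bsub>D\<^esub>"
proof -
  have c: "adjoint D \<one>\<^bsub>D\<^esub> \<in> carrier D" by (simp add: D.adjoint_closed)
  have "\<one>\<^bsub>D\<^esub> = adjoint D (adjoint D \<one>\<^bsub>D\<^esub> \<otimes>\<^bsub>D\<^esub> \<one>\<^bsub>D\<^esub>)" using c by (simp add: D.adjoint_adjoint)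
  also have "\<dots> = adjoint D \<one>\<^bsub>D\<^esub> \<otimes>\<^bsub>D\<^esub> adjoint D (adjoint D \<one>\<^bsub>D\<^esub>)" using c by (subst D.adjoint_mult) auto
  also have "\<dots> = adjoint D \<one>\<^bsub>D\<^esub>" using c by (simp add: D.adjoint_adjoint)
  finally show ?thesis by simp
qed

lemma W_adj: "set ls \<subseteq> G \<times> UNIV \<Longrightarrow> W (rev (map (\<lambda>(g, b). (g, \<not> b)) ls)) = adjoint D (W ls)"
proof (induction ls)
  case Nil
  then show ?case by (simp add: D_adjoint_one)
next
  case (Cons l ls)
  obtain g b where l: "l = (g, b)" "g \<in> G" using Cons.prems by auto
  have *: "set (rev (map (\<lambda>(g, b). (g, \<not> b)) ls)) \<subseteq> G \<times> UNIV" using Cons.prems by auto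
  have h: "h (g, \<not> b) = adjoint D (h l)"
    using l v_closed by (auto simp: D.adjoint_adjoint)
  have hc: "h l \<in> carrier D" "h (g, \<not> b) \<in> carrier D" using l by (auto simp: v_closed D.adjoint_closed)
  have "W (rev (map (\<lambda>(g, b). (g, \<not> b)) (l # ls))) = W (rev (map (\<lambda>(g, b). (g, \<not> b)) ls)) \<otimes>\<^bsub>D\<^esub> W [(g, \<not> b)]"
    using l * by (simp only: list.map rev.simps l(1) prod.case) (rule W_append, auto)
  also have "W [(g, \<not> b)] = adjoint D (h l)" using hc h by simp
  also have "W (rev (map (\<lambda>(g, b). (g, \<not> b)) ls)) = adjoint D (W ls)" using Cons by simp
  also have "adjoint D (W ls) \<otimes>\<^bsub>D\<^esub> adjoint D (h l) = adjoint D (W (l # ls))"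
    using hc W_closed[of ls] Cons.prems by (simp add: D.adjoint_mult)
  finally show ?case .
qed

lemma D_smult_0: "a \<in> carrier D \<Longrightarrow> 0 \<odot>\<^bsub>D\<^esub> a = \<zero>\<^bsub>D\<^esub>"
  using D.cnorm_smult[of a 0] by (simp add: D.cnorm_eq_0 D.smult_closed)

lemma ev_eq:
  assumes "finite T" "Poly_Mapping.keys p \<subseteq> T" "\<And>w. w \<in> T \<Longrightarrow> set (letters w) \<subseteq> G \<times> UNIV"
  shows "ev p = (\<Oplus>\<^bsub>D\<^esub> w\<in>T. Poly_Mapping.lookup p w \<odot>\<^bsub>D\<^esub> W (letters w))"
  unfolding nc_hom_def
proof (rule D.add.finprod_mono_neutral_cong_left)
  show "Poly_Mapping.lookup p w \<odot>\<^bsub>D\<^esub> W (letters w) = \<zero>\<^bsub>D\<^esub>" if "w \<in> T - Poly_Mapping.keys p" for w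
    using that W_closed[OF assms(3)] by (auto simp: in_keys_iff D_smult_0)
  show "(\<lambda>w. Poly_Mapping.lookup p w \<odot>\<^bsub>D\<^esub> W (letters w)) \<in> T \<rightarrow> carrier D"
    using W_closed[OF assms(3)] by (auto simp: D.smult_closed)
qed (use assms in auto)

lemma sp_D: "p \<in> star_polys G \<Longrightarrow> w \<in> Poly_Mapping.keys p \<Longrightarrow> set (letters w) \<subseteq> G \<times> UNIV"
  by (simp add: star_polys_def ncpolys_def)

lemma ev_closed: "p \<in> star_polys G \<Longrightarrow> ev p \<in> carrier D"
  unfolding nc_hom_def by (intro D.finsum_closed) (auto intro!: D.smult_closed W_closed dest: sp_D)

lemma ev_add:
  assumes "p \<in> star_polys G" "q \<in> star_polys G"
  shows "ev (p + q) = ev p \<oplus>\<^bsub>D\<^esub> ev q"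
proof -
  let ?T = "Poly_Mapping.keys p \<union> Poly_Mapping.keys q"
  have T: "finite ?T" "set (letters w) \<subseteq> G \<times> UNIV" if "w \<in> ?T" for w
    using that assms sp_D by auto
  have c: "W (letters w) \<in> carrier D" if "w \<in> ?T" for w using W_closed[OF T(2)[OF that]] .
  have "ev (p + q) = (\<Oplus>\<^bsub>D\<^esub> w\<in>?T. Poly_Mapping.lookup (p + q) w \<odot>\<^bsub>D\<^esub> W (letters w))"
    using keys_add[of p q] T by (intro ev_eq) auto
  also have "\<dots> = (\<Oplus>\<^bsub>D\<^esub> w\<in>?T. Poly_Mapping.lookup p w \<odot>\<^bsub>D\<^esub> W (letters w) \<oplus>\<^bsub>D\<^esub> Poly_Mapping.lookup q w \<odot>\<^bsub>D\<^esub> W (letters w))"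
    using c by (intro D.finsum_cong') (auto simp: lookup_add D.smult_l_distr D.smult_closed)
  also have "\<dots> = (\<Oplus>\<^bsub>D\<^esub> w\<in>?T. Poly_Mapping.lookup p w \<odot>\<^bsub>D\<^esub> W (letters w)) \<oplus>\<^bsub>D\<^esub> (\<Oplus>\<^bsub>D\<^esub> w\<in>?T. Poly_Mapping.lookup q w \<odot>\<^bsub>D\<^esub> W (letters w))"
    using c by (intro D.finsum_addf) (auto simp: D.smult_closed)
  also have "\<dots> = ev p \<oplus>\<^bsub>D\<^esub> ev q"
    using T by (subst (1 2) ev_eq[of ?T]) auto
  finally show ?thesis .
qed

lemma ev_single:
  assumes "set (letters w) \<subseteq> G \<times> UNIV"
  shows "ev (Poly_Mapping.single w c) = c \<odot>\<^bsub>D\<^esub> W (letters w)"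
  using ev_eq[of "{w}" "Poly_Mapping.single w c"] assms W_closed[OF assms] by (simp add: D.smult_closed)

lemma ev_zero: "ev 0 = \<zero>\<^bsub>D\<^esub>"
  by (simp add: nc_hom_def)

lemma star_polys_induct [consumes 1, case_names 0 single add]:
  assumes p: "p \<in> star_polys G" and "P 0"
    and single: "\<And>w c. set (letters w) \<subseteq> G \<times> UNIV \<Longrightarrow> P (Poly_Mapping.single w c)"
    and add: "\<And>p q. p \<in> star_polys G \<Longrightarrow> q \<in> star_polys G \<Longrightarrow> P p \<Longrightarrow> P q \<Longrightarrow> P (p + q)"
  shows "P p"
proof -
  have *: "p = (\<Sum>w\<in>Poly_Mapping.keys p. Poly_Mapping.single w (Poly_Mapping.lookup p w))"
    by (rule poly_mapping_eqI) (simp add: lookup_sum lookup_single when_def in_keys_iff)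
  have "P (\<Sum>w\<in>T. Poly_Mapping.single w (Poly_Mapping.lookup p w))"
    if "finite T" "T \<subseteq> Poly_Mapping.keys p" for T
    using that
  proof induction
    case (insert w T)
    have "Poly_Mapping.single w (Poly_Mapping.lookup p w) \<in> star_polys G" if "w \<in> Poly_Mapping.keys p" for w
      using sp_D[OF p that] by (auto simp: star_polys_def ncpolys_def)
    with insert show ?case by (auto intro!: add single star_polys_sum sp_D[OF p])
  qed (use assms in auto)
  then show ?thesis by (subst *) auto
qed

lemma ev_mult:
  assumes p: "p \<in> star_polys G" and q: "q \<in> star_polys G"
  shows "ev (p * q) = ev p \<otimes>\<^bsub>D\<^esub> ev q"
  using p
proof (induction rule: star_polys_induct)
  case 0
  show ?case using ev_closed[OF q] by (simp add: ev_zero)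
next
  case (add p p')
  then show ?case using ev_closed q by (simp add: distrib_right ev_add D.l_distr)
next
  case (single w c)
  have s: "Poly_Mapping.single w c \<in> star_polys G" using single by (auto simp: star_polys_def ncpolys_def)
  show ?case using q
  proof (induction rule: star_polys_induct)
    case 0
    show ?case using ev_closed[OF s] by (simp add: ev_zero)
  next
    case (add p p')
    then show ?case using ev_closed s by (simp add: distrib_left ev_add D.r_distr)
  next
    case (single w' d)
    have c: "W (letters w) \<in> carrier D" "W (letters w') \<in> carrier D"
      using \<open>set (letters w) \<subseteq> _\<close> single W_closed by blast+
    have "ev (Poly_Mapping.single w c * Poly_Mapping.single w' d) = (c * d) \<odot>\<^bsub>D\<^esub> (W (letters w) \<otimes>\<^bsub>D\<^esub> W (letters w'))"
      using \<open>set (letters w) \<subseteq> _\<close> single by (simp add: mult_single ev_single plus_fmon_def W_append del: foldr_append)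
    also have "\<dots> = (c \<odot>\<^bsub>D\<^esub> W (letters w)) \<otimes>\<^bsub>D\<^esub> (d \<odot>\<^bsub>D\<^esub> W (letters w'))"
      using c by (simp add: D.smult_assoc1 D.smult_closed D.smult_mult_right flip: D.smult_mult_left)
    finally show ?case using \<open>set (letters w) \<subseteq> _\<close> single by (simp add: ev_single)
  qed
qed

lemma ev_scale:
  assumes "p \<in> star_polys G"
  shows "ev (ncconst c * p) = c \<odot>\<^bsub>D\<^esub> ev p"
proof -
  have "ev (ncconst c) = c \<odot>\<^bsub>D\<^esub> \<one>\<^bsub>D\<^esub>" by (simp add: ncconst_def ev_single zero_fmon_def)
  then show ?thesis using assms ev_closed[OF assms]
    by (simp add: ev_mult flip: D.smult_mult_left)
qed

lemma ev_one: "ev 1 = \<one>\<^bsub>D\<^esub>"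
  proof -
  have "letters (0 :: ('g \<times> bool) fmon) = []" by (simp add: zero_fmon_def)
  then show ?thesis using ev_single[of 0 1] by (simp add: D.smult_one)
qed

lemma ev_adj:
  assumes "p \<in> star_polys G"
  shows "ev (star_adj p) = adjoint D (ev p)"
  using assms
proof (induction rule: star_polys_induct)
  case 0
  have "adjoint D \<zero>\<^bsub>D\<^esub> \<oplus>\<^bsub>D\<^esub> adjoint D \<zero>\<^bsub>D\<^esub> = adjoint D \<zero>\<^bsub>D\<^esub>"
    by (simp flip: D.adjoint_add)
  then show ?case by (simp add: ev_zero D.adjoint_closed)
next
  case (add p q)
  then show ?case by (simp add: star_adj_add ev_add ev_closed D.adjoint_add)
next
  case (single w c)
  have "set (letters (star_word w)) \<subseteq> G \<times> UNIV" using single by (auto simp: star_word_def)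
  then show ?case using single W_closed[OF single]
    by (simp add: star_adj_single ev_single D.adjoint_smult star_word_def W_adj)
qed

lemma ev_uminus: "p \<in> star_polys G \<Longrightarrow> ev (- p) = \<ominus>\<^bsub>D\<^esub> ev p"
proof -
  assume p: "p \<in> star_polys G"
  have "ev (- p) \<oplus>\<^bsub>D\<^esub> ev p = \<zero>\<^bsub>D\<^esub>" using ev_add[of "- p" p] p by (simp add: ev_zero)
  then show ?thesis using p by (intro D.minus_equality[symmetric]) (auto simp: ev_closed)
qed

lemma ev_diff: "p \<in> star_polys G \<Longrightarrow> q \<in> star_polys G \<Longrightarrow> ev (p - q) = ev p \<ominus>\<^bsub>D\<^esub> ev q"
  using ev_add[of p "- q"] by (simp add: ev_uminus a_minus_def)

lemma ev_le: "p \<in> star_polys G \<Longrightarrow> cnorm D (ev p) \<le> N p"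
proof (rule le_N, rule CollectI, rule conjI)
  show "cstar_seminorm G (\<lambda>p. cnorm D (ev p))"
    unfolding cstar_seminorm_def
  proof (intro conjI ballI allI)
    show "cnorm D (ev (ncconst c * a)) = cmod c * cnorm D (ev a)" if "a \<in> star_polys G" for a c
      unfolding ev_scale[OF that] using that by (simp add: D.cnorm_smult ev_closed)
  qed (auto simp: ev_closed ev_add ev_mult ev_adj D.cnorm_nonneg D.cnorm_cstar D.cnorm_add D.cnorm_mult)
  show "\<forall>r\<in>R. cnorm D (ev r) = 0" using v_rels by (simp add: D.cnorm_eq_0)
qed

text \<open>\<open>l\<close> is the limit in \<open>D\<close> of the images of the Cauchy sequence \<open>a\<close>.\<close>

definition "lims a l \<longleftrightarrow> a \<in> carrier C \<and> l \<in> carrier D \<and> (\<lambda>i. cnorm D (ev (a i) \<ominus>\<^bsub>D\<^esub> l)) \<longlonglongrightarrow> 0"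

lemma lims_ex:
  assumes a: "a \<in> carrier C"
  shows "\<exists>l. lims a l"
proof -
  have "\<exists>l\<in>carrier D. (\<lambda>i. cnorm D (ev (a i) \<ominus>\<^bsub>D\<^esub> l)) \<longlonglongrightarrow> 0"
  proof (rule D.complete)
    fix e :: real assume "e > 0"
    then obtain L where L: "\<And>i j. i \<ge> L \<Longrightarrow> j \<ge> L \<Longrightarrow> N (a i - a j) < e" using C_D[OF a] by blast
    have "cnorm D (ev (a i) \<ominus>\<^bsub>D\<^esub> ev (a j)) < e" if "i \<ge> L" "j \<ge> L" for i j
      using ev_le[of "a i - a j"] L[OF that] C_poly[OF a] by (simp add: ev_diff)
    then show "\<exists>L. \<forall>i\<ge>L. \<forall>j\<ge>L. cnorm D (ev (a i) \<ominus>\<^bsub>D\<^esub> ev (a j)) < e" by blast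
  qed (use C_poly[OF a] ev_closed in auto)
  then show ?thesis using a by (auto simp: lims_def)
qed

lemma lims_squeeze:
  assumes "a \<in> carrier C" "l \<in> carrier D" "f \<longlonglongrightarrow> 0" "\<And>i. cnorm D (ev (a i) \<ominus>\<^bsub>D\<^esub> l) \<le> f i"
  shows "lims a l"
  unfolding lims_def
proof (intro conjI assms)
  show "(\<lambda>i. cnorm D (ev (a i) \<ominus>\<^bsub>D\<^esub> l)) \<longlonglongrightarrow> 0"
    by (rule tendsto_sandwich[OF _ _ tendsto_const assms(3)])
       (auto intro!: always_eventually D.cnorm_nonneg assms ev_closed C_poly)
qed

lemma lims_norm:
  assumes "lims a l"
  shows "cnorm D l \<le> cnorm U (cl a)"
proof -
  have a: "a \<in> carrier C" "l \<in> carrier D" and lim: "(\<lambda>i. cnorm D (ev (a i) \<ominus>\<^bsub>D\<^esub> l)) \<longlonglongrightarrow> 0"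
    using assms by (auto simp: lims_def)
  have "cnorm D l \<le> N (a i) + cnorm D (ev (a i) \<ominus>\<^bsub>D\<^esub> l)" for i
  proof -
    have c: "ev (a i) \<in> carrier D" using a by (simp add: ev_closed C_poly)
    have "l = ev (a i) \<oplus>\<^bsub>D\<^esub> (-1) \<odot>\<^bsub>D\<^esub> (ev (a i) \<ominus>\<^bsub>D\<^esub> l)"
    proof -
      have m: "(-1) \<odot>\<^bsub>D\<^esub> x = \<ominus>\<^bsub>D\<^esub> x" if "x \<in> carrier D" for x
        using that D.smult_l_distr[of x "-1" 1]
        by (intro D.minus_equality[symmetric]) (auto simp: D.smult_one D_smult_0 D.smult_closed)
      show ?thesis using a c by (simp add: m D.minus_add a_minus_def D.minus_minus D.r_neg2)
    qed
    then have "cnorm D l \<le> cnorm D (ev (a i)) + cnorm D ((-1) \<odot>\<^bsub>D\<^esub> (ev (a i) \<ominus>\<^bsub>D\<^esub> l))"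
      using D.cnorm_add[OF c, of "(-1) \<odot>\<^bsub>D\<^esub> (ev (a i) \<ominus>\<^bsub>D\<^esub> l)"] a c by (simp add: D.smult_closed)
    then show ?thesis using ev_le[OF C_poly[OF a(1), of i]] a c by (simp add: D.cnorm_smult)
  qed
  moreover have "(\<lambda>i. N (a i) + cnorm D (ev (a i) \<ominus>\<^bsub>D\<^esub> l)) \<longlonglongrightarrow> cnorm U (cl a) + 0"
    by (intro tendsto_add U_cnorm_lim a lim)
  ultimately show ?thesis by (intro LIMSEQ_le_const) auto
qed

lemma lims_add:
  assumes "lims a l" "lims b m"
  shows "lims (\<lambda>i. a i + b i) (l \<oplus>\<^bsub>D\<^esub> m)"
proof -
  have a: "a \<in> carrier C" "l \<in> carrier D" "b \<in> carrier C" "m \<in> carrier D"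
    and lim: "(\<lambda>i. cnorm D (ev (a i) \<ominus>\<^bsub>D\<^esub> l)) \<longlonglongrightarrow> 0" "(\<lambda>i. cnorm D (ev (b i) \<ominus>\<^bsub>D\<^esub> m)) \<longlonglongrightarrow> 0"
    using assms by (auto simp: lims_def)
  show ?thesis
  proof (rule lims_squeeze)
    show "(\<lambda>i. cnorm D (ev (a i) \<ominus>\<^bsub>D\<^esub> l) + cnorm D (ev (b i) \<ominus>\<^bsub>D\<^esub> m)) \<longlonglongrightarrow> 0"
      using tendsto_add[OF lim] by simp
    fix i
    have c: "ev (a i) \<in> carrier D" "ev (b i) \<in> carrier D" using a by (auto simp: ev_closed C_poly)
    have "ev (a i + b i) \<ominus>\<^bsub>D\<^esub> (l \<oplus>\<^bsub>D\<^esub> m) = (ev (a i) \<ominus>\<^bsub>D\<^esub> l) \<oplus>\<^bsub>D\<^esub> (ev (b i) \<ominus>\<^bsub>D\<^esub> m)"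
      using a c by (simp add: ev_add C_poly a_minus_def D.minus_add D.a_ac)
    then show "cnorm D (ev (a i + b i) \<ominus>\<^bsub>D\<^esub> (l \<oplus>\<^bsub>D\<^esub> m)) \<le> cnorm D (ev (a i) \<ominus>\<^bsub>D\<^esub> l) + cnorm D (ev (b i) \<ominus>\<^bsub>D\<^esub> m)"
      using a c by (simp add: D.cnorm_add)
  qed (use a in \<open>auto simp: C_add\<close>)
qed

lemma lims_mult:
  assumes "lims a l" "lims b m"
  shows "lims (\<lambda>i. a i * b i) (l \<otimes>\<^bsub>D\<^esub> m)"
proof -
  have a: "a \<in> carrier C" "l \<in> carrier D" "b \<in> carrier C" "m \<in> carrier D"
    and lim: "(\<lambda>i. cnorm D (ev (a i) \<ominus>\<^bsub>D\<^esub> l)) \<longlonglongrightarrow> 0" "(\<lambda>i. cnorm D (ev (b i) \<ominus>\<^bsub>D\<^esub> m)) \<longlonglongrightarrow> 0"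
    using assms by (auto simp: lims_def)
  obtain K where K: "K > 0" "\<And>i. N (a i) \<le> K" using C_bound[OF a(1)] by blast
  show ?thesis
  proof (rule lims_squeeze)
    show "(\<lambda>i. K * cnorm D (ev (b i) \<ominus>\<^bsub>D\<^esub> m) + cnorm D (ev (a i) \<ominus>\<^bsub>D\<^esub> l) * cnorm D m) \<longlonglongrightarrow> 0"
      using tendsto_add[OF tendsto_mult_left[OF lim(2), of K] tendsto_mult_right[OF lim(1), of "cnorm D m"]] by simp
    fix i
    have c: "ev (a i) \<in> carrier D" "ev (b i) \<in> carrier D" using a by (auto simp: ev_closed C_poly)
    have "ev (a i * b i) \<ominus>\<^bsub>D\<^esub> (l \<otimes>\<^bsub>D\<^esub> m) =
        ev (a i) \<otimes>\<^bsub>D\<^esub> (ev (b i) \<ominus>\<^bsub>D\<^esub> m) \<oplus>\<^bsub>D\<^esub> (ev (a i) \<ominus>\<^bsub>D\<^esub> l) \<otimes>\<^bsub>D\<^esub> m"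
      using a c by (simp add: ev_mult C_poly a_minus_def D.l_distr D.r_distr D.l_minus D.r_minus D.a_assoc D.r_neg1)
    then have "cnorm D (ev (a i * b i) \<ominus>\<^bsub>D\<^esub> (l \<otimes>\<^bsub>D\<^esub> m)) \<le>
        cnorm D (ev (a i) \<otimes>\<^bsub>D\<^esub> (ev (b i) \<ominus>\<^bsub>D\<^esub> m)) + cnorm D ((ev (a i) \<ominus>\<^bsub>D\<^esub> l) \<otimes>\<^bsub>D\<^esub> m)"
      using a c by (simp add: D.cnorm_add)
    also have "\<dots> \<le> cnorm D (ev (a i)) * cnorm D (ev (b i) \<ominus>\<^bsub>D\<^esub> m) + cnorm D (ev (a i) \<ominus>\<^bsub>D\<^esub> l) * cnorm D m"
      using a c by (intro add_mono D.cnorm_mult) auto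
    also have "cnorm D (ev (a i)) * cnorm D (ev (b i) \<ominus>\<^bsub>D\<^esub> m) \<le> K * cnorm D (ev (b i) \<ominus>\<^bsub>D\<^esub> m)"
      using a c K(2)[of i] ev_le[OF C_poly[OF a(1), of i]] by (intro mult_right_mono D.cnorm_nonneg) auto
    finally show "cnorm D (ev (a i * b i) \<ominus>\<^bsub>D\<^esub> (l \<otimes>\<^bsub>D\<^esub> m)) \<le>
        K * cnorm D (ev (b i) \<ominus>\<^bsub>D\<^esub> m) + cnorm D (ev (a i) \<ominus>\<^bsub>D\<^esub> l) * cnorm D m" by simp
  qed (use a in \<open>auto simp: C_mult\<close>)
qed

lemma lims_const: "p \<in> star_polys G \<Longrightarrow> lims (\<lambda>_. p) (ev p)"
  using D.cnorm_eq_0[of "\<zero>\<^bsub>D\<^esub>"] by (simp add: lims_def C_const ev_closed D.r_neg a_minus_def)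

lemma lims_scale:
  assumes "lims a l"
  shows "lims (\<lambda>i. ncconst c * a i) (c \<odot>\<^bsub>D\<^esub> l)"
proof -
  have l: "l \<in> carrier D" using assms by (simp add: lims_def)
  have "ev (ncconst c) \<otimes>\<^bsub>D\<^esub> l = c \<odot>\<^bsub>D\<^esub> l"
    using l ev_scale[of 1 c] by (simp add: ev_one flip: D.smult_mult_left)
  then show ?thesis using lims_mult[OF lims_const[of "ncconst c"] assms] by simp
qed

lemma D_cnorm_adjoint_le: "x \<in> carrier D \<Longrightarrow> cnorm D x \<le> cnorm D (adjoint D x)"
proof -
  assume x: "x \<in> carrier D"
  have "cnorm D x * cnorm D x \<le> cnorm D (adjoint D x) * cnorm D x"
    using D.cnorm_mult[of "adjoint D x" x] D.cnorm_cstar[of x] x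
    by (simp add: power2_eq_square D.adjoint_closed)
  then show ?thesis using D.cnorm_nonneg[OF x] D.cnorm_nonneg[OF D.adjoint_closed[OF x]]
    by (cases "cnorm D x = 0") auto
qed

lemma lims_adj:
  assumes "lims a l"
  shows "lims (\<lambda>i. star_adj (a i)) (adjoint D l)"
proof -
  have a: "a \<in> carrier C" "l \<in> carrier D" and lim: "(\<lambda>i. cnorm D (ev (a i) \<ominus>\<^bsub>D\<^esub> l)) \<longlonglongrightarrow> 0"
    using assms by (auto simp: lims_def)
  show ?thesis
  proof (rule lims_squeeze)
    fix i
    have c: "ev (a i) \<in> carrier D" using a by (auto simp: ev_closed C_poly)
    have "ev (a i) = (ev (a i) \<ominus>\<^bsub>D\<^esub> l) \<oplus>\<^bsub>D\<^esub> l"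
      using a c by (simp add: a_minus_def D.a_assoc D.l_neg)
    then have "adjoint D (ev (a i)) = adjoint D (ev (a i) \<ominus>\<^bsub>D\<^esub> l) \<oplus>\<^bsub>D\<^esub> adjoint D l"
      using a c D.adjoint_add[of "ev (a i) \<ominus>\<^bsub>D\<^esub> l" l] by simp
    then have "ev (star_adj (a i)) \<ominus>\<^bsub>D\<^esub> adjoint D l = adjoint D (ev (a i) \<ominus>\<^bsub>D\<^esub> l)"
      using a c by (simp add: ev_adj C_poly a_minus_def D.a_assoc D.r_neg D.adjoint_closed)
    then show "cnorm D (ev (star_adj (a i)) \<ominus>\<^bsub>D\<^esub> adjoint D l) \<le> cnorm D (ev (a i) \<ominus>\<^bsub>D\<^esub> l)"
      using D_cnorm_adjoint_le[of "adjoint D (ev (a i) \<ominus>\<^bsub>D\<^esub> l)"] a c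
      by (simp add: D.adjoint_closed D.adjoint_adjoint)
  qed (use a lim in \<open>auto simp: C_adj D.adjoint_closed\<close>)
qed

lemma lims_unique:
  assumes "lims a l" "lims b m" "cl a = cl b"
  shows "l = m"
proof -
  have a: "a \<in> carrier C" "l \<in> carrier D" "b \<in> carrier C" "m \<in> carrier D"
    using assms by (auto simp: lims_def)
  let ?d = "\<lambda>i. a i + ncconst (-1) * b i"
  have lim: "lims ?d (l \<oplus>\<^bsub>D\<^esub> (-1) \<odot>\<^bsub>D\<^esub> m)" by (rule lims_add[OF assms(1) lims_scale[OF assms(2)]])
  have "cl ?d = \<zero>\<^bsub>U\<^esub>" using assms(3) a by (simp add: U_zero cl_eq_iff C_diff C_const)
  then have "cnorm D (l \<oplus>\<^bsub>D\<^esub> (-1) \<odot>\<^bsub>D\<^esub> m) \<le> cnorm U \<zero>\<^bsub>U\<^esub>" using lims_norm[OF lim] by simp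
  also have "cnorm U \<zero>\<^bsub>U\<^esub> = 0"
    using unital_cstar_algebra.cnorm_eq_0[OF unital_cstar_algebra_univ_cstar, of "\<zero>\<^bsub>U\<^esub>"] by simp
  finally have "l \<oplus>\<^bsub>D\<^esub> (-1) \<odot>\<^bsub>D\<^esub> m = \<zero>\<^bsub>D\<^esub>"
    using a D.cnorm_nonneg[of "l \<oplus>\<^bsub>D\<^esub> (-1) \<odot>\<^bsub>D\<^esub> m"] D.cnorm_eq_0[of "l \<oplus>\<^bsub>D\<^esub> (-1) \<odot>\<^bsub>D\<^esub> m"]
    by (simp add: D.smult_closed)
  moreover have "m \<oplus>\<^bsub>D\<^esub> (-1) \<odot>\<^bsub>D\<^esub> m = \<zero>\<^bsub>D\<^esub>"
    using D.smult_l_distr[of m 1 "-1"] a by (simp add: D.smult_one D_smult_0)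
  ultimately have "l \<oplus>\<^bsub>D\<^esub> (-1) \<odot>\<^bsub>D\<^esub> m = m \<oplus>\<^bsub>D\<^esub> (-1) \<odot>\<^bsub>D\<^esub> m" by simp
  then show ?thesis using a by (simp add: D.smult_closed)
qed

definition "univ_map X = (THE l. \<exists>a. X = cl a \<and> lims a l)"

lemma univ_map_eq: "lims a l \<Longrightarrow> univ_map (cl a) = l"
  unfolding univ_map_def
proof (rule the_equality)
  assume l: "lims a l"
  then show "\<exists>b. cl a = cl b \<and> lims b l" by blast
  fix m assume "\<exists>b. cl a = cl b \<and> lims b m"
  then obtain b where "cl a = cl b" "lims b m" by blast
  then show "m = l" using lims_unique[of b m a l] l by simp
qed

theorem universal_property:
  shows "univ_map \<in> ring_hom U D"
    and "X \<in> carrier U \<Longrightarrow> univ_map (c \<odot>\<^bsub>U\<^esub> X) = c \<odot>\<^bsub>D\<^esub> univ_map X"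
    and "X \<in> carrier U \<Longrightarrow> univ_map (adjoint U X) = adjoint D (univ_map X)"
    and "X \<in> carrier U \<Longrightarrow> cnorm D (univ_map X) \<le> cnorm U X"
    and "g \<in> G \<Longrightarrow> univ_map (univ_class G R (star_gen g)) = v g"
proof -
  have ex: "\<exists>a l. X = cl a \<and> lims a l" if "X \<in> carrier U" for X
    using that lims_ex by (auto simp: carrier_U)
  have C: "a \<in> carrier C" "l \<in> carrier D" if "lims a l" for a l using that by (auto simp: lims_def)
  show "univ_map \<in> ring_hom U D"
  proof (rule ring_hom_memI)
    fix X Y assume "X \<in> carrier U" "Y \<in> carrier U"
    then obtain a l b m where X: "X = cl a" "lims a l" and Y: "Y = cl b" "lims b m" by (metis ex)
    show "univ_map X \<in> carrier D" using X C by (simp add: univ_map_eq)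
    show "univ_map (X \<otimes>\<^bsub>U\<^esub> Y) = univ_map X \<otimes>\<^bsub>D\<^esub> univ_map Y"
      using X Y C univ_map_eq[OF lims_mult[OF X(2) Y(2)]] by (simp add: univ_map_eq)
    show "univ_map (X \<oplus>\<^bsub>U\<^esub> Y) = univ_map X \<oplus>\<^bsub>D\<^esub> univ_map Y"
      using X Y C univ_map_eq[OF lims_add[OF X(2) Y(2)]] by (simp add: univ_map_eq)
  next
    show "univ_map \<one>\<^bsub>U\<^esub> = \<one>\<^bsub>D\<^esub>"
      using univ_map_eq[OF lims_const[of 1]] by (simp add: U_one ev_one)
  qed
  {
    assume "X \<in> carrier U"
    then obtain a l where X: "X = cl a" "lims a l" by (metis ex)
    show "univ_map (c \<odot>\<^bsub>U\<^esub> X) = c \<odot>\<^bsub>D\<^esub> univ_map X"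
      using X C univ_map_eq[OF lims_scale[OF X(2), of c]] by (simp add: univ_map_eq)
    show "univ_map (adjoint U X) = adjoint D (univ_map X)"
      using X C univ_map_eq[OF lims_adj[OF X(2)]] by (simp add: univ_map_eq)
    show "cnorm D (univ_map X) \<le> cnorm U X" using X lims_norm by (simp add: univ_map_eq)
  }
  assume g: "g \<in> G"
  have "ev (star_gen g) = v g"
    using g v_closed[OF g] by (simp add: star_gen_def ncvar_def ev_single D.smult_one)
  then show "univ_map (univ_class G R (star_gen g)) = v g"
    using univ_map_eq[OF lims_const[OF star_polys_gen[OF g]]] by (simp add: univ_class_def)
qed

end

end

theory Submission
  imports Defs
begin

text \<open>Both sides are linear in \<open>p\<close>, so let \<open>p = X\<^bsub>j\<^sub>1\<^esub> \<cdots> X\<^bsub>j\<^sub>m\<^esub>\<close>. In \<open>M\<^sub>i(n,k)\<close> the product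
  \<open>u\<^bsub>i\<^sub>1j\<^sub>1\<^esub> \<cdots> u\<^bsub>i\<^sub>mj\<^sub>m\<^esub>\<close> vanishes unless consecutive \<open>i\<close>'s are ordered (or equal) exactly as the
  corresponding \<open>j\<close>'s. For equal neighbours this is the orthogonality of \<open>u\<^bsub>1,j\<^esub>, \<dots>, u\<^bsub>n,j\<^esub>\<close>, which
  is not among the relations but follows from \<open>P\<^sub>j\<close> being a projection.

  Equal neighbours are merged into one element of \<open>B\<langle>X\<rangle>\<^sub>0\<close>. Otherwise a letter with maximal \<open>j\<close> is a
  strict peak of the \<open>j\<close>'s and hence of the \<open>i\<close>'s, so monotone independence replaces its factor by its
  expectation, an element of \<open>B\<close> that does not depend on \<open>i\<close> and is absorbed by a neighbour. The sum
  over this \<open>i\<close> then produces \<open>P\<^sub>j\<close>, which is absorbed by a neighbouring \<open>u\<close>. When one letter is left,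
  \<open>P\<^sub>1 P\<^sub>j P\<^sub>1 = P\<^sub>1\<close> finishes the argument.

  All computations take place in the free *-algebra modulo a C*-seminorm.\<close>

section \<open>Calculating modulo a C*-seminorm\<close>

lemma ncconst_0 [simp]: "ncconst 0 = 0"
  by (simp add: ncconst_def)

lemma mult_ncconst_left: "a * (ncconst c * b) = ncconst c * (a * b)"
  by (metis mult.assoc ncconst_comm)

context cstar_seminormed
begin

text \<open>Equality in the quotient by the null ideal of the seminorm. Membership belongs to the
  relation because \<open>s\<close> obeys its laws on \<open>star_polys G\<close> only.\<close>

definition eqv :: "'g star_poly \<Rightarrow> 'g star_poly \<Rightarrow> bool" (infix "\<asymp>" 50) where
  "a \<asymp> b \<longleftrightarrow> a \<in> star_polys G \<and> b \<in> star_polys G \<and> s (a - b) = 0"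

lemma eqvD:
  assumes "a \<asymp> b"
  shows "a \<in> star_polys G" "b \<in> star_polys G" "s (a - b) = 0"
  using assms by (auto simp: eqv_def)

lemma eqv_refl: "a \<in> star_polys G \<Longrightarrow> a \<asymp> a"
  by (simp add: eqv_def zero)

lemma eqv_sym: "a \<asymp> b \<Longrightarrow> b \<asymp> a"
  using diff_commute by (auto simp: eqv_def)

lemma eqv_trans [trans]:
  assumes "a \<asymp> b" "b \<asymp> c"
  shows "a \<asymp> c"
  using triangle[of "a - b" "b - c"] nonneg[of "a - c"] assms by (auto simp: eqv_def)

lemma eq_eqv_trans [trans]: "a = b \<Longrightarrow> b \<asymp> c \<Longrightarrow> a \<asymp> c"
  and eqv_eq_trans [trans]: "a \<asymp> b \<Longrightarrow> b = c \<Longrightarrow> a \<asymp> c"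
  by simp_all

lemma eqv_s: "a \<asymp> b \<Longrightarrow> s a = s b"
  using abs_diff[of a b] by (auto simp: eqv_def)

lemma eqv_0_iff: "a \<asymp> 0 \<longleftrightarrow> a \<in> star_polys G \<and> s a = 0"
  by (simp add: eqv_def)

lemma eqv_add:
  assumes "a \<asymp> b" "c \<asymp> d"
  shows "a + c \<asymp> b + d"
  using triangle[of "a - b" "c - d"] nonneg[of "a + c - (b + d)"] assms
  by (auto simp: eqv_def algebra_simps)

lemma eqv_mult:
  assumes "a \<asymp> b" "c \<asymp> d"
  shows "a * c \<asymp> b * d"
proof -
  have e: "a * c - b * d = (a - b) * c + b * (c - d)" by (simp add: algebra_simps)
  have "s (a * c - b * d) \<le> s ((a - b) * c) + s (b * (c - d))"
    unfolding e using assms by (intro triangle) (auto simp: eqv_def)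
  also have "\<dots> \<le> s (a - b) * s c + s b * s (c - d)"
    using assms by (intro add_mono submult) (auto simp: eqv_def)
  also have "\<dots> = 0" using assms by (simp add: eqv_def)
  finally show ?thesis
    using nonneg[of "a * c - b * d"] assms by (auto simp: eqv_def)
qed

lemma eqv_mult_left: "a \<asymp> b \<Longrightarrow> c \<in> star_polys G \<Longrightarrow> c * a \<asymp> c * b"
  by (simp add: eqv_mult eqv_refl)

lemma eqv_mult_right: "a \<asymp> b \<Longrightarrow> c \<in> star_polys G \<Longrightarrow> a * c \<asymp> b * c"
  by (simp add: eqv_mult eqv_refl)

lemma eqv_scale: "a \<asymp> b \<Longrightarrow> ncconst c * a \<asymp> ncconst c * b"
  by (simp add: eqv_mult_left)

lemma eqv_uminus: "a \<asymp> b \<Longrightarrow> - a \<asymp> - b"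
  using eqv_scale[of a b "-1"] by simp

lemma eqv_diff: "a \<asymp> b \<Longrightarrow> c \<asymp> d \<Longrightarrow> a - c \<asymp> b - d"
  using eqv_add[of a b "- c" "- d"] eqv_uminus[of c d] by simp

lemma eqv_sum: "(\<And>i. i \<in> A \<Longrightarrow> f i \<asymp> g i) \<Longrightarrow> sum f A \<asymp> sum g A"
  by (induction A rule: infinite_finite_induct) (auto intro: eqv_add eqv_refl)

lemma eqv_star_adj: "a \<asymp> b \<Longrightarrow> star_adj a \<asymp> star_adj b"
  using adj[of "a - b"] by (auto simp: eqv_def star_adj_diff)

text \<open>Taking adjoints reverses the product. The relations of the algebra are one-sided, and
  this supplies their mirror images.\<close>

lemma eqv_mult_adj:
  assumes ab: "a * b \<asymp> c" and "star_adj a \<asymp> a" "star_adj b \<asymp> b" "star_adj c \<asymp> c"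
  shows "b * a \<asymp> c"
proof -
  have "b * a \<asymp> star_adj b * star_adj a" by (intro eqv_mult eqv_sym[OF assms(2)] eqv_sym[OF assms(3)])
  also have "\<dots> = star_adj (a * b)" by (simp add: star_adj_mult)
  also have "\<dots> \<asymp> star_adj c" by (intro eqv_star_adj ab)
  also have "\<dots> \<asymp> c" by fact
  finally show ?thesis .
qed

section \<open>Extreme points of the unit ball and orthogonality of projections\<close>

lemma s_sum_le:
  assumes "\<And>i. i \<in> A \<Longrightarrow> f i \<in> star_polys G" "\<And>i. i \<in> A \<Longrightarrow> s (f i) \<le> c"
  shows "s (sum f A) \<le> real (card A) * c"
  using assms
proof (induction A rule: infinite_finite_induct)
  case (insert i A)
  have "s (f i + sum f A) \<le> s (f i) + s (sum f A)"
    using insert.prems by (intro triangle star_polys_sum) auto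
  also have "\<dots> \<le> c + real (card A) * c"
    using insert by (intro add_mono) auto
  finally show ?case using insert(1,2) by (simp add: algebra_simps)
qed (simp_all add: zero)

text \<open>The unit of a C*-algebra is an extreme point of the unit ball. Weighting the products of
  \<open>N\<close> factors \<open>p \<plusminus> h\<close> by \<open>(r + S)\<^sup>2\<close>, where \<open>S\<close> is the sum of the signs, and averaging gives the
  bound below; \<open>r = 0\<close> and \<open>N \<rightarrow> \<infinity>\<close> yield \<open>h\<^sup>2 = 0\<close>.\<close>

lemma extreme_unit_bound:
  fixes N :: nat and r :: real
  assumes p: "p \<in> star_polys G" and h: "h \<in> star_polys G"
    and pp: "p * p \<asymp> p" and ph: "p * h \<asymp> h" and hp: "h * p \<asymp> h"
    and s: "s p \<le> 1" "s (p + h) \<le> 1" "s (p - h) \<le> 1"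
  shows "s (ncconst (of_real (r\<^sup>2 + N)) * p + ncconst (of_real (2 * r * N)) * h
      + ncconst (of_real ((real N)\<^sup>2 - real N)) * (h * h)) \<le> r\<^sup>2 + N"
proof (induction N arbitrary: r)
  case 0
  have "s (ncconst (of_real (r\<^sup>2)) * p) = r\<^sup>2 * s p" using scale[OF p] by (simp add: norm_power)
  also have "\<dots> \<le> r\<^sup>2 * 1" using s by (intro mult_left_mono) auto
  finally show ?case by simp
next
  case (Suc N)
  \<comment> \<open>The span of \<open>p\<close>, \<open>h\<close> and \<open>h * h\<close> contains
    every weighted average: a weight quadratic in the signs is orthogonal to products of three or
    more distinct signs.\<close>
  define F where "F a b c = ncconst a * p + ncconst b * h + ncconst c * (h * h)" for a b c
  have F: "F a b c \<in> star_polys G" for a b c using p h by (auto simp: F_def)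
  have pF: "p * F a b c \<asymp> F a b c" for a b c
  proof -
    have "p * F a b c = ncconst a * (p * p) + ncconst b * (p * h) + ncconst c * ((p * h) * h)"
      by (simp add: F_def distrib_left mult_ncconst_left mult.assoc)
    also have "\<dots> \<asymp> F a b c" unfolding F_def
      by (intro eqv_add eqv_scale pp ph eqv_mult_right h)
    finally show ?thesis .
  qed
  have hF: "h * F a b c \<asymp> ncconst a * h + ncconst b * (h * h) + ncconst c * (h * (h * h))" for a b c
  proof -
    have "h * F a b c = ncconst a * (h * p) + ncconst b * (h * h) + ncconst c * (h * (h * h))"
      by (simp add: F_def distrib_left mult_ncconst_left)
    also have "\<dots> \<asymp> ncconst a * h + ncconst b * (h * h) + ncconst c * (h * (h * h))"
      using h by (intro eqv_add eqv_scale hp eqv_refl) auto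
    finally show ?thesis .
  qed
  \<comment> \<open>Equal coefficients of \<open>h * h\<close> in both summands make the cubic terms
    cancel.\<close>
  have step: "(p + h) * F a b c + (p - h) * F a' b' c \<asymp>
      F (a + a') (a - a' + (b + b')) (b - b' + (c + c))" for a b a' b' c
  proof -
    have "(p + h) * F a b c + (p - h) * F a' b' c =
        (p * F a b c + h * F a b c) + (p * F a' b' c - h * F a' b' c)"
      by (simp add: algebra_simps)
    also have "\<dots> \<asymp> (F a b c + (ncconst a * h + ncconst b * (h * h) + ncconst c * (h * (h * h)))) +
        (F a' b' c - (ncconst a' * h + ncconst b' * (h * h) + ncconst c * (h * (h * h))))"
      by (intro eqv_add eqv_diff pF hF)
    also have "\<dots> = F (a + a') (a - a' + (b + b')) (b - b' + (c + c))"
    proof -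
      have minus: "ncconst (c - d) = ncconst c - ncconst d" for c d
        by (simp add: ncconst_def single_diff)
      show ?thesis unfolding F_def minus ncconst_add by (simp add: algebra_simps)
    qed
    finally show ?thesis .
  qed
  have bound: "s (q * F a b c) \<le> d" if "q \<in> star_polys G" "s q \<le> 1" "s (F a b c) \<le> d" for q a b c d
  proof -
    have "s (q * F a b c) \<le> s q * s (F a b c)" using that F by (intro submult) auto
    also have "\<dots> \<le> 1 * d" using that F by (intro mult_mono) (auto intro: nonneg)
    finally show ?thesis by simp
  qed
  let ?a = "\<lambda>r :: real. of_real (r\<^sup>2 + N) :: complex" and ?b = "\<lambda>r :: real. of_real (2 * r * N) :: complex"
    and ?c = "of_real ((real N)\<^sup>2 - real N) :: complex"
  have s2: "s (ncconst 2 * F a b c) = 2 * s (F a b c)" for a b c using scale[OF F, of 2] by simp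
  have IH: "s (F (?a r) (?b r) ?c) \<le> r\<^sup>2 + N" for r using Suc.IH[of r] by (simp add: F_def)
  let ?T = "F (of_real (r\<^sup>2 + Suc N)) (of_real (2 * r * Suc N)) (of_real ((real (Suc N))\<^sup>2 - real (Suc N)))"
  \<comment> \<open>Splitting off the outermost factor: its sign \<open>\<plusminus>1\<close> moves
    the weight parameter from \<open>r\<close> to \<open>r + 1\<close> or \<open>r - 1\<close>, and
    the 2 clears the average over this sign.\<close>
  have "ncconst 2 * ?T =
     F (?a (r + 1) + ?a (r - 1)) (?a (r + 1) - ?a (r - 1) + (?b (r + 1) + ?b (r - 1)))
       (?b (r + 1) - ?b (r - 1) + (?c + ?c))"
  proof -
    have "ncconst 2 * F a b c = F (2 * a) (2 * b) (2 * c)" for a b c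
      by (simp add: F_def distrib_left ncconst_mult mult.assoc)
    moreover have "2 * of_real (r\<^sup>2 + Suc N) = ?a (r + 1) + ?a (r - 1)"
      and "2 * of_real (2 * r * Suc N) = ?a (r + 1) - ?a (r - 1) + (?b (r + 1) + ?b (r - 1))"
      and "2 * of_real ((real (Suc N))\<^sup>2 - real (Suc N)) = ?b (r + 1) - ?b (r - 1) + (?c + ?c)"
      by (simp_all add: algebra_simps power2_eq_square)
    ultimately show ?thesis by metis
  qed
  then have "2 * s ?T = s ((p + h) * F (?a (r + 1)) (?b (r + 1)) ?c + (p - h) * F (?a (r - 1)) (?b (r - 1)) ?c)"
    by (simp only: s2[symmetric] eqv_s[OF step])
  also have "\<dots> \<le> s ((p + h) * F (?a (r + 1)) (?b (r + 1)) ?c) + s ((p - h) * F (?a (r - 1)) (?b (r - 1)) ?c)"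
    using p h F by (intro triangle) auto
  also have "\<dots> \<le> ((r + 1)\<^sup>2 + N) + ((r - 1)\<^sup>2 + N)"
    using p h s by (intro add_mono bound IH) auto
  also have "\<dots> = 2 * (r\<^sup>2 + Suc N)" by (simp add: power2_eq_square algebra_simps)
  finally show ?case by (simp add: F_def)
qed

text \<open>At \<open>r = 0\<close> the bound has no linear term in \<open>h\<close>, and the
  coefficient of \<open>h * h\<close> grows quadratically against a linear bound. So
  \<open>h * h\<close> is null, and self-adjointness passes this on to \<open>h\<close> by the
  C*-identity.\<close>

lemma extreme_unit:
  assumes p: "p \<in> star_polys G" and h: "star_adj h \<asymp> h"
    and pp: "p * p \<asymp> p" and ph: "p * h \<asymp> h" and hp: "h * p \<asymp> h"
    and s: "s p \<le> 1" "s (p + h) \<le> 1" "s (p - h) \<le> 1"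
  shows "s h = 0"
proof -
  have hG: "h \<in> star_polys G" using eqvD[OF h] by simp
  have *: "real N * s (h * h) \<le> 2" for N
  proof -
    \<comment> \<open>The bound is used with \<open>N + 1\<close> factors, where the coefficient of
      \<open>h * h\<close> is \<open>(N + 1) * N\<close> and one factor \<open>N + 1\<close>
      cancels.\<close>
    let ?M = "Suc N" and ?T = "ncconst (of_real ((real (Suc N))\<^sup>2 - real (Suc N))) * (h * h)"
    have b: "s (ncconst (of_nat ?M) * p + ?T) \<le> ?M"
      using extreme_unit_bound[OF p hG pp ph hp s, of 0 ?M] by simp
    have t: "s ?T \<le> s (ncconst (of_nat ?M) * p + ?T) + s (ncconst (of_nat ?M) * p)"
      using diff[of "ncconst (of_nat ?M) * p + ?T" "ncconst (of_nat ?M) * p"] p hG by auto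
    have b': "s (ncconst (of_nat ?M) * p) \<le> ?M"
      using scale[OF p, of "of_nat ?M"] s(1) by (simp add: mult_left_le del: of_nat_Suc)
    have "s ?T \<le> 2 * real ?M" using order_trans[OF t add_mono[OF b b']] by (simp only: mult_2)
    moreover have "(real ?M)\<^sup>2 - real ?M = real ?M * real N" by (simp add: power2_eq_square algebra_simps)
    then have "s ?T = real ?M * real N * s (h * h)"
      using scale[of "h * h" "of_real ((real (Suc N))\<^sup>2 - real (Suc N))"] hG
      by (simp only: star_polys_closed norm_of_real) (simp del: of_nat_Suc)
    ultimately have "real ?M * (real N * s (h * h)) \<le> real ?M * 2" by (simp add: algebra_simps)
    then show ?thesis by (rule mult_left_le_imp_le) simp
  qed
  have "s (h * h) \<le> 0"
  proof (rule ccontr)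
    assume "\<not> s (h * h) \<le> 0"
    moreover obtain N where "2 < real N * s (h * h)"
      using reals_Archimedean3[of "s (h * h)"] calculation by (auto simp: not_le)
    ultimately show False using *[of N] by simp
  qed
  then have "s (h * h) = 0" using nonneg[of "h * h"] hG by auto
  moreover have "(s h)\<^sup>2 = s (h * h)"
    using cstar_id[OF hG] eqv_s[OF eqv_mult_right[OF h hG]] by simp
  ultimately show ?thesis by simp
qed

lemma projection_le_1:
  assumes "star_adj p \<asymp> p" "p * p \<asymp> p"
  shows "s p \<le> 1"
proof -
  have p: "p \<in> star_polys G" using eqvD[OF assms(1)] by simp
  have "(s p)\<^sup>2 = s p"
    using cstar_id[OF p] eqv_s[OF eqv_mult_right[OF assms(1) p]] eqv_s[OF assms(2)] by simp
  then show ?thesis using nonneg[OF p] by (auto simp: power2_eq_square)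
qed

text \<open>In the corner with unit \<open>p = u\<^sub>i\<close> the elements \<open>y\<^sub>l = p u\<^sub>l p\<close>, \<open>l \<noteq> i\<close>, satisfy
  \<open>\<parallel>p - y\<^sub>l\<parallel> \<le> 1\<close> and add up to \<open>0\<close>, so that a multiple of \<open>p\<close> is the midpoint of a segment in
  direction \<open>y\<^sub>l\<close> inside the corresponding ball.\<close>

lemma projections_orthogonal:
  assumes A: "finite A" and i: "i \<in> A" and l: "l \<in> A" and il: "i \<noteq> l"
    and sa: "\<And>i. i \<in> A \<Longrightarrow> star_adj (u i) \<asymp> u i"
    and idem: "\<And>i. i \<in> A \<Longrightarrow> u i * u i \<asymp> u i"
    and sum: "\<And>i. i \<in> A \<Longrightarrow> sum u A * u i \<asymp> u i"
  shows "u l * u i \<asymp> 0"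
proof -
  have uG: "u j \<in> star_polys G" if "j \<in> A" for j using eqvD[OF sa[OF that]] by simp
  define p where "p = u i"
  have p: "p \<in> star_polys G" "star_adj p \<asymp> p" "p * p \<asymp> p" "s p \<le> 1"
    using i uG sa idem projection_le_1 by (auto simp: p_def)
  define y where "y j = p * u j * p" for j
  have yG: "y j \<in> star_polys G" if "j \<in> A" for j using p uG[OF that] by (auto simp: y_def)
  have py: "p * y j \<asymp> y j" and yp: "y j * p \<asymp> y j" if "j \<in> A" for j
  proof -
    show "p * y j \<asymp> y j"
      using eqv_mult_right[OF p(3), of "u j * p"] p uG[OF that] by (auto simp: y_def mult.assoc)
    show "y j * p \<asymp> y j"
      using eqv_mult_left[OF p(3), of "p * u j"] p uG[OF that] by (auto simp: y_def mult.assoc)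
  qed
  have ysa: "star_adj (y j) \<asymp> y j" if "j \<in> A" for j
    using p sa[OF that] by (auto simp: y_def star_adj_mult mult.assoc intro!: eqv_mult)
  \<comment> \<open>Up to null elements \<open>1 - u j\<close> is again a projection, and
    \<open>p - y j\<close> is its compression by \<open>p\<close>.\<close>
  have le: "s (p - y j) \<le> 1" if j: "j \<in> A" for j
  proof -
    have "star_adj (1 - u j) \<asymp> 1 - u j"
      using sa[OF j] by (auto simp: star_adj_diff intro!: eqv_diff eqv_refl)
    moreover have "(1 - u j) * (1 - u j) \<asymp> 1 - u j"
    proof -
      have "(1 - u j) * (1 - u j) = (1 - u j) - (u j - u j * u j)" by (simp add: algebra_simps)
      also have "\<dots> \<asymp> (1 - u j) - (u j - u j)"
        using uG[OF j] idem[OF j] by (intro eqv_diff eqv_refl) auto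
      finally show ?thesis by simp
    qed
    ultimately have q: "s (1 - u j) \<le> 1" by (rule projection_le_1)
    have "p * (1 - u j) * p = p * p - y j" by (simp add: y_def algebra_simps)
    also have "\<dots> \<asymp> p - y j" using yG[OF j] p by (intro eqv_diff eqv_refl)
    finally have "s (p - y j) = s (p * (1 - u j) * p)" using eqv_s by simp
    also have "\<dots> \<le> s (p * (1 - u j)) * s p" using p uG[OF j] by (intro submult) auto
    also have "\<dots> \<le> s (p * (1 - u j)) * 1" using p uG[OF j] by (intro mult_left_mono nonneg) auto
    also have "\<dots> \<le> s p * s (1 - u j)" using p uG[OF j] by (simp add: submult)
    also have "\<dots> \<le> 1 * 1" using p q uG[OF j] by (intro mult_mono nonneg) auto
    finally show ?thesis by simp
  qed
  let ?R = "A - {i, l}"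
  \<comment> \<open>One more than the number of remaining indices, so that division by
    \<open>T\<close> stays possible when \<open>A\<close> consists of \<open>i\<close> and
    \<open>l\<close> alone.\<close>
  define T where "T = real (card ?R) + 1"
  have T: "T > 0" by (simp add: T_def)
  have "sum y A = p * (sum u A * p)" by (simp add: y_def sum_distrib_left sum_distrib_right mult.assoc)
  also have "\<dots> \<asymp> p * p" unfolding p_def using sum[OF i] uG[OF i] by (intro eqv_mult_left)
  also have "\<dots> \<asymp> p" by (rule p)
  finally have "sum y A \<asymp> p" .
  moreover have "y i \<asymp> p"
    using eqv_trans[OF eqv_mult_right[OF p(3) p(1)] p(3)] by (simp add: y_def flip: p_def)
  ultimately have "sum y A - y i \<asymp> p - p" by (rule eqv_diff)
  moreover have "sum y A = y i + (y l + sum y ?R)"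
  proof -
    have "sum y A = y i + sum y (A - {i})" by (rule sum.remove[OF A i])
    also have "sum y (A - {i}) = y l + sum y (A - {i} - {l})"
      using A l il by (intro sum.remove) auto
    also have "A - {i} - {l} = ?R" by blast
    finally show ?thesis .
  qed
  ultimately have "y l + sum y ?R \<asymp> 0" by simp
  \<comment> \<open>Adding \<open>p - y j\<close> over \<open>?R\<close> cancels the unknown
    \<open>y j\<close> and leaves a multiple of \<open>p\<close> plus \<open>y l\<close>, now
    expressed as a sum of elements of norm at most 1.\<close>
  then have "(y l + sum y ?R) + (\<Sum>j\<in>?R. p - y j) \<asymp> 0 + (\<Sum>j\<in>?R. p - y j)"
    using p yG by (intro eqv_add eqv_refl star_polys_sum) auto
  then have e: "of_nat (card ?R) * p + y l \<asymp> (\<Sum>j\<in>?R. p - y j)"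
    by (simp add: sum_subtractf algebra_simps)
  have "s (of_nat (card ?R) * p + y l) \<le> real (card ?R) * 1"
    unfolding eqv_s[OF e] using p yG le by (intro s_sum_le) auto
  moreover have Tp: "ncconst (of_real T) * p = p + of_nat (card ?R) * p"
  proof -
    have "ncconst (of_nat m) = (of_nat m :: 'g star_poly)" for m
      by (induction m) (auto simp: ncconst_add)
    then show ?thesis by (simp add: T_def ncconst_add algebra_simps)
  qed
  moreover have cG: "of_nat (card ?R) * p \<in> star_polys G"
    using star_polys_sum[of ?R "\<lambda>_. p"] p by simp
  ultimately have plus: "s (ncconst (of_real T) * p + y l) \<le> T"
    using triangle[of p "of_nat (card ?R) * p + y l"] p yG[OF l] by (auto simp: T_def add.assoc)
  have cle: "s (of_nat (card ?R) * p) \<le> real (card ?R)"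
    using s_sum_le[of ?R "\<lambda>_. p" 1] p by simp
  have minus: "s (ncconst (of_real T) * p - y l) \<le> T"
    unfolding Tp using triangle[of "of_nat (card ?R) * p" "p - y l"] p yG[OF l] le[OF l] cG cle
    by (auto simp: T_def algebra_simps)
  \<comment> \<open>Division by \<open>T\<close> brings both \<open>p + h\<close> and
    \<open>p - h\<close> into the unit ball.\<close>
  define h where "h = ncconst (of_real (1 / T)) * y l"
  have "s h = 0"
  proof (rule extreme_unit[where p = p])
    have TT: "ncconst (of_real (1 / T)) * (ncconst (of_real T) * a) = a" for a :: "'g star_poly"
      using T by (simp flip: mult.assoc ncconst_mult)
    have sc: "s (ncconst (of_real (1 / T)) * a) \<le> 1" if "a \<in> star_polys G" "s a \<le> T" for a
      using scale[OF that(1), of "of_real (1 / T)"] that(2) T by (simp add: norm_divide)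
    have "p + h = ncconst (of_real (1 / T)) * (ncconst (of_real T) * p + y l)"
      by (simp only: distrib_left TT h_def)
    then show "s (p + h) \<le> 1"
      using sc[OF _ plus] p yG[OF l] by simp
    have "p - h = ncconst (of_real (1 / T)) * (ncconst (of_real T) * p - y l)"
      by (simp only: right_diff_distrib TT h_def)
    then show "s (p - h) \<le> 1"
      using sc[OF _ minus] p yG[OF l] by simp
    have "star_adj h = ncconst (of_real (1 / T)) * star_adj (y l)"
      by (simp add: h_def star_adj_mult star_adj_const ncconst_comm)
    then show "star_adj h \<asymp> h" using ysa[OF l] by (simp add: h_def eqv_scale)
    show "p * h \<asymp> h" using py[OF l] by (simp add: h_def mult_ncconst_left eqv_scale)
    show "h * p \<asymp> h" using yp[OF l] by (simp add: h_def mult.assoc eqv_scale)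
  qed (use p in auto)
  then have "s (y l) = 0" using scale[OF yG[OF l], of "of_real (1 / T)"] T by (simp add: h_def)
  \<comment> \<open>Modulo the seminorm \<open>y l\<close> is \<open>star_adj a * a\<close> for
    \<open>a = u l * p\<close>, so the C*-identity carries its vanishing over to
    \<open>a\<close>.\<close>
  moreover have "star_adj (u l * p) * (u l * p) \<asymp> y l"
  proof -
    have "star_adj (u l * p) * (u l * p) = star_adj p * (star_adj (u l) * u l) * p"
      by (simp add: star_adj_mult mult.assoc)
    also have "\<dots> \<asymp> p * u l * p"
      by (intro eqv_mult p eqv_refl eqv_trans[OF eqv_mult_right[OF sa[OF l] uG[OF l]] idem[OF l]])
    finally show ?thesis by (simp add: y_def)
  qed
  ultimately have "(s (u l * p))\<^sup>2 = 0"
    using cstar_id[of "u l * p"] p uG[OF l] eqv_s by auto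
  then show ?thesis using p uG[OF l] by (auto simp: eqv_0_iff p_def)
qed

end

section \<open>The relations of \<open>M\<^sub>i(n,k)\<close>\<close>

lemma take_nth_nth_drop:
  "Suc q < length xs \<Longrightarrow> xs = take q xs @ xs ! q # xs ! Suc q # drop (Suc (Suc q)) xs"
  by (simp add: Cons_nth_drop_Suc)

definition idx :: "nat \<Rightarrow> nat \<Rightarrow> nat list set" where
  "idx n m = {is. length is = m \<and> set is \<subseteq> {1..n}}"

lemma finite_idx [simp]: "finite (idx n m)"
  using finite_lists_length_eq[of "{1..n}" m] by (simp add: idx_def conj_commute)

lemma sum_idx_append:
  "(\<Sum>is\<in>idx n (a + b). g is) = (\<Sum>xs\<in>idx n a. \<Sum>ys\<in>idx n b. g (xs @ ys))"
  unfolding sum.cartesian_product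
  by (rule sum.reindex_bij_witness[of _ "\<lambda>(xs, ys). xs @ ys" "\<lambda>is. (take a is, drop a is)"])
     (auto simp: idx_def dest: in_set_takeD in_set_dropD)

lemma sum_idx_1: "(\<Sum>is\<in>idx n (Suc 0). g is) = (\<Sum>i=1..n. g [i])"
  by (rule sum.reindex_bij_witness[of _ "\<lambda>i. [i]" "\<lambda>is. hd is"])
     (auto simp: idx_def length_Suc_conv)

lemma sum_idx_Suc: "(\<Sum>is\<in>idx n (Suc m). g is) = (\<Sum>i=1..n. \<Sum>is\<in>idx n m. g (i # is))"
  using sum_idx_append[of g n 1 m] by (simp add: sum_idx_1)

definition gen_word :: "nat list \<Rightarrow> nat list \<Rightarrow> (nat \<times> nat) star_poly" where
  "gen_word is js = prod_list (map2 (\<lambda>i j. star_gen (i, j)) is js)"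

lemma gen_word_simps [simp]:
  "gen_word [] [] = 1" "gen_word (i # is) (j # js) = star_gen (i, j) * gen_word is js"
  by (simp_all add: gen_word_def)

lemma gen_word_append:
  "length is = length js \<Longrightarrow> gen_word (is @ is') (js @ js') = gen_word is js * gen_word is' js'"
  by (simp add: gen_word_def)

lemma gen_word_star_polys:
  assumes "is \<in> idx n (length js)" "set js \<subseteq> {1..k}"
  shows "gen_word is js \<in> star_polys (Mi_gens n k)"
proof -
  have "length is = length js" "set is \<subseteq> {1..n}" using assms by (auto simp: idx_def)
  then show ?thesis using assms(2)
    by (induction "is" js rule: list_induct2) (auto simp: Mi_gens_def)
qed

text \<open>An index list violating this makes the word vanish, by \<open>u_u_less\<close> or
  \<open>u_u_greater\<close>. Equal neighbours in \<open>js\<close> are left free, since they are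
  merged instead.\<close>

definition compat :: "nat list \<Rightarrow> nat list \<Rightarrow> bool" where
  "compat is js \<longleftrightarrow> (\<forall>l. Suc l < length js \<longrightarrow>
     (js ! l < js ! Suc l \<longrightarrow> is ! l < is ! Suc l) \<and> (js ! Suc l < js ! l \<longrightarrow> is ! Suc l < is ! l))"

text \<open>The computation is carried out for any C*-seminorm that kills the relations; the
  universal norm is inserted only at the end.\<close>

locale Mi_seminormed = cstar_seminormed "Mi_gens n k" s for n k s +
  assumes rel: "r \<in> Mi_rels n k \<Longrightarrow> s r = 0"
begin

notation eqv (infix "\<asymp>" 50)

abbreviation u :: "nat \<Rightarrow> nat \<Rightarrow> (nat \<times> nat) star_poly" where "u i j \<equiv> star_gen (i, j)"

definition P :: "nat \<Rightarrow> (nat \<times> nat) star_poly" where "P j = (\<Sum>i=1..n. u i j)"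

lemma u_poly [simp]: "i \<in> {1..n} \<Longrightarrow> j \<in> {1..k} \<Longrightarrow> u i j \<in> star_polys (Mi_gens n k)"
  by (auto simp: Mi_gens_def)

lemma P_poly [simp]: "j \<in> {1..k} \<Longrightarrow> P j \<in> star_polys (Mi_gens n k)"
  unfolding P_def by (intro star_polys_sum u_poly)

lemma relations:
  shows u_adj: "\<lbrakk>i \<in> {1..n}; j \<in> {1..k}\<rbrakk> \<Longrightarrow> star_adj (u i j) \<asymp> u i j"
    and u_idem: "\<lbrakk>i \<in> {1..n}; j \<in> {1..k}\<rbrakk> \<Longrightarrow> u i j * u i j \<asymp> u i j"
    and P_u: "\<lbrakk>j \<in> {1..k}; i' \<in> {1..n}; j' \<in> {1..k}; j' \<le> j\<rbrakk> \<Longrightarrow> P j * u i' j' \<asymp> u i' j'"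
    and P_P1: "j \<in> {1..k} \<Longrightarrow> P j * P 1 \<asymp> P 1"
    and u_u_less: "\<lbrakk>i \<in> {1..n}; j \<in> {1..k}; i' \<in> {1..n}; j' \<in> {1..k}; j < j'; i' \<le> i\<rbrakk> \<Longrightarrow>
          u i j * u i' j' \<asymp> 0"
proof -
  have eq: "a \<asymp> b"
    if "a - b \<in> Mi_rels n k" "a \<in> star_polys (Mi_gens n k)" "b \<in> star_polys (Mi_gens n k)" for a b
    using that rel by (auto simp: eqv_def)
  {
    assume i: "i \<in> {1..n}" "j \<in> {1..k}"
    show "star_adj (u i j) \<asymp> u i j"
    proof (rule eq)
      show "star_adj (u i j) - u i j \<in> Mi_rels n k"
        unfolding Mi_rels_def Let_def using i by blast
    qed (use i in auto)
    show "u i j * u i j \<asymp> u i j"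
    proof (rule eq)
      show "u i j * u i j - u i j \<in> Mi_rels n k"
        unfolding Mi_rels_def Let_def using i by blast
    qed (use i in auto)
  next
    assume i: "j \<in> {1..k}" "i' \<in> {1..n}" "j' \<in> {1..k}" "j' \<le> j"
    show "P j * u i' j' \<asymp> u i' j'"
    proof (rule eq)
      show "P j * u i' j' - u i' j' \<in> Mi_rels n k"
        unfolding Mi_rels_def Let_def P_def using i by blast
    qed (use i in auto)
  next
    assume j: "j \<in> {1..k}"
    show "P j * P 1 \<asymp> P 1"
    proof (rule eq)
      show "P j * P 1 - P 1 \<in> Mi_rels n k"
        unfolding Mi_rels_def Let_def P_def using j by blast
    qed (use j in auto)
  next
    assume i: "i \<in> {1..n}" "j \<in> {1..k}" "i' \<in> {1..n}" "j' \<in> {1..k}" "j < j'" "i' \<le> i"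
    have "u i j * u i' j' \<in> Mi_rels n k"
      unfolding Mi_rels_def Let_def using i by blast
    then show "u i j * u i' j' \<asymp> 0" using i by (intro eq) auto
  }
qed

lemma P_adj: "j \<in> {1..k} \<Longrightarrow> star_adj (P j) \<asymp> P j"
proof -
  assume j: "j \<in> {1..k}"
  have "star_adj (P j) = (\<Sum>i=1..n. star_adj (u i j))"
    unfolding P_def by (induction n) (auto simp: star_adj_add)
  then show ?thesis using j by (auto simp: P_def intro!: eqv_sum u_adj)
qed

lemma u_P:
  assumes "j \<in> {1..k}" "i' \<in> {1..n}" "j' \<in> {1..k}" "j' \<le> j"
  shows "u i' j' * P j \<asymp> u i' j'"
  using assms by (intro eqv_mult_adj[OF P_u] P_adj u_adj)

lemma P1_P: "j \<in> {1..k} \<Longrightarrow> P 1 * P j \<asymp> P 1"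
  by (intro eqv_mult_adj[OF P_P1] P_adj) auto

lemma u_u_greater:
  assumes "i \<in> {1..n}" "j \<in> {1..k}" "i' \<in> {1..n}" "j' \<in> {1..k}" "j' < j" "i \<le> i'"
  shows "u i j * u i' j' \<asymp> 0"
proof (rule eqv_mult_adj[OF u_u_less])
  show "star_adj 0 \<asymp> 0" by (simp add: eqv_refl)
qed (use assms in \<open>auto intro: u_adj\<close>)

text \<open>For distinct indices, \<open>P_u\<close> with both second indices equal to
  \<open>j\<close> says that the sum of the projections \<open>u 1 j\<close>, ...,
  \<open>u n j\<close> fixes each of them, which is what \<open>projections_orthogonal\<close> asks
  for.\<close>

lemma u_u_same:
  assumes "i \<in> {1..n}" "i' \<in> {1..n}" "j \<in> {1..k}"
  shows "u i j * u i' j \<asymp> (if i = i' then u i j else 0)"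
proof (cases "i = i'")
  case False
  have "u i j * u i' j \<asymp> 0"
    by (rule projections_orthogonal[of "{1..n}" i' i "\<lambda>i. u i j"])
       (use assms False P_u in \<open>auto intro: u_adj u_idem simp: P_def\<close>)
  then show ?thesis using False by simp
qed (use assms in \<open>simp add: u_idem\<close>)

text \<open>A violated neighbour condition exhibits two adjacent generators whose product is
  null.\<close>

lemma gen_word_incompat:
  assumes "is": "is \<in> idx n (length js)" and js: "set js \<subseteq> {1..k}" and "\<not> compat is js"
  shows "gen_word is js \<asymp> 0"
proof -
  obtain l where l: "Suc l < length js"
    and *: "js ! l < js ! Suc l \<and> is ! Suc l \<le> is ! l \<or> js ! Suc l < js ! l \<and> is ! l \<le> is ! Suc l"
    using assms(3) by (auto simp: compat_def not_less)
  have len: "length is = length js" and set: "set is \<subseteq> {1..n}" using "is" by (auto simp: idx_def)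
  have nth: "is ! q \<in> {1..n}" "js ! q \<in> {1..k}" if "q < length js" for q
    using subsetD[OF set nth_mem] subsetD[OF js nth_mem] that len by auto
  let ?A = "gen_word (take l is) (take l js)" and ?B = "gen_word (drop (Suc (Suc l)) is) (drop (Suc (Suc l)) js)"
  have "gen_word is js = gen_word (take l is @ is ! l # is ! Suc l # drop (Suc (Suc l)) is)
      (take l js @ js ! l # js ! Suc l # drop (Suc (Suc l)) js)"
    using l len by (intro arg_cong2[where f = gen_word] take_nth_nth_drop) auto
  also have "\<dots> = ?A * (u (is ! l) (js ! l) * u (is ! Suc l) (js ! Suc l) * ?B)"
    using len by (simp add: gen_word_append mult.assoc)
  finally have "gen_word is js = ?A * (u (is ! l) (js ! l) * u (is ! Suc l) (js ! Suc l) * ?B)" .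
  moreover have "?A * (u (is ! l) (js ! l) * u (is ! Suc l) (js ! Suc l) * ?B) \<asymp> ?A * (0 * ?B)"
  proof (intro eqv_mult_left eqv_mult_right)
    show "u (is ! l) (js ! l) * u (is ! Suc l) (js ! Suc l) \<asymp> 0"
      using * l nth by (auto intro: u_u_less u_u_greater)
    have "drop (Suc (Suc l)) is \<in> idx n (length (drop (Suc (Suc l)) js))" "take l is \<in> idx n (length (take l js))"
      using len set by (auto simp: idx_def dest!: in_set_takeD in_set_dropD)
    moreover have "set (drop (Suc (Suc l)) js) \<subseteq> {1..k}" "set (take l js) \<subseteq> {1..k}"
      using js by (auto dest!: in_set_takeD in_set_dropD)
    ultimately show "?A \<in> star_polys (Mi_gens n k)" "?B \<in> star_polys (Mi_gens n k)"
      using gen_word_star_polys by blast+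
  qed
  ultimately show ?thesis by simp
qed

end

section \<open>Moments of monotonically independent variables\<close>

lemma list_prod_Cons: "xs \<noteq> [] \<Longrightarrow> list_prod (a # xs) = a * list_prod xs"
  by (cases xs) auto

lemma list_prod_merge: "list_prod (xs @ a # b # ys) = list_prod (xs @ (a * b) # ys)"
proof (induction xs)
  case Nil
  show ?case by (cases ys) (auto simp: mult.assoc)
qed (simp add: list_prod_Cons)

context operator_valued_probability_space
begin

section \<open>Formal monomials with coefficients in \<open>B\<close> or the scalars\<close>

lemma B_mult: "a \<in> B \<Longrightarrow> b \<in> B \<Longrightarrow> a * b \<in> B"
  using subalgebra_B by (simp add: subalgebra_def)

lemma B_scale: "a \<in> B \<Longrightarrow> scl c a \<in> B"
  using subalgebra_B by (auto simp: subalgebra_def intro: subspace_scale)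

lemma coef_left_mult: "coef_left scl c a * a' = coef_left scl c (a * a')"
  by (cases c) (auto simp: scl_mult_left mult.assoc)

lemma coef_right_mult: "coef_right scl a c * a' = a * coef_left scl c a'"
  by (cases c) (auto simp: mult.assoc, metis scl_mult_left scl_mult_right)

text \<open>A product with a factor in \<open>B\<close> stays in \<open>B\<close>, and two scalars
  give a scalar. Scalars cannot be moved into \<open>B\<close>, which need not have a unit.\<close>

lemma coef_mult_ex:
  assumes "set_coef c \<subseteq> B" "set_coef d \<subseteq> B"
  shows "\<exists>e. set_coef e \<subseteq> B \<and> (\<forall>a. coef_left scl e a = coef_left scl c (coef_left scl d a)) \<and>
    (\<forall>a. coef_right scl a e = coef_right scl (coef_right scl a c) d)"
proof (cases c; cases d)
  fix a b assume "c = Elem a" "d = Elem b"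
  then show ?thesis using assms by (intro exI[of _ "Elem (a * b)"]) (auto simp: B_mult mult.assoc)
next
  fix a b assume "c = Elem a" "d = Scalar b"
  then show ?thesis using assms by (intro exI[of _ "Elem (scl b a)"])
    (auto simp: B_scale simp flip: scl_mult_left scl_mult_right)
next
  fix a b assume "c = Scalar a" "d = Elem b"
  then show ?thesis using assms by (intro exI[of _ "Elem (scl a b)"])
    (auto simp: B_scale simp flip: scl_mult_left scl_mult_right)
next
  fix a b assume "c = Scalar a" "d = Scalar b"
  then show ?thesis by (intro exI[of _ "Scalar (a * b)"]) (auto simp: mult.commute)
qed

text \<open>The new monomial is found before the argument \<open>y\<close>, here and in the next two
  lemmas, so one formal monomial serves all variables simultaneously.\<close>

lemma bmonom_coef_left_ex:
  assumes "set_coef c \<subseteq> B" "set_bmonom M \<subseteq> B"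
  shows "\<exists>M'. set_bmonom M' \<subseteq> B \<and> (\<forall>y. bmonom_eval scl y M' = coef_left scl c (bmonom_eval scl y M))"
proof (cases M)
  case (MonX b b')
  obtain e where "set_coef e \<subseteq> B" "\<And>a. coef_left scl e a = coef_left scl c (coef_left scl b a)"
    using coef_mult_ex[of c b] assms unfolding MonX bmonom.set by blast
  then show ?thesis using assms MonX by (intro exI[of _ "MonX e b'"]) auto
next
  case (MonCons b M1)
  obtain e where "set_coef e \<subseteq> B" "\<And>a. coef_left scl e a = coef_left scl c (coef_left scl b a)"
    using coef_mult_ex[of c b] assms unfolding MonCons bmonom.set by blast
  then show ?thesis using assms MonCons by (intro exI[of _ "MonCons e M1"]) auto
qed

lemma bmonom_mult_right_ex:
  assumes "b \<in> B" "set_bmonom M \<subseteq> B"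
  shows "\<exists>M'. set_bmonom M' \<subseteq> B \<and> (\<forall>y. bmonom_eval scl y M' = bmonom_eval scl y M * b)"
  using assms(2)
proof (induction M)
  case (MonX c c')
  obtain e where "set_coef e \<subseteq> B" "\<And>a. coef_right scl a e = coef_right scl (coef_right scl a c') (Elem b)"
    using coef_mult_ex[of c' "Elem b"] assms(1) MonX unfolding bmonom.set coef.set by blast
  then show ?case using MonX by (intro exI[of _ "MonX c e"]) (auto simp: coef_left_mult)
next
  case (MonCons c M)
  then obtain M' where "set_bmonom M' \<subseteq> B" "\<And>y. bmonom_eval scl y M' = bmonom_eval scl y M * b" by auto
  then show ?case using MonCons.prems
    by (intro exI[of _ "MonCons c M'"]) (auto simp: coef_left_mult mult.assoc)
qed

lemma bmonom_mult_ex: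
  assumes "set_bmonom M1 \<subseteq> B" "set_bmonom M2 \<subseteq> B"
  shows "\<exists>M. set_bmonom M \<subseteq> B \<and> (\<forall>y. bmonom_eval scl y M = bmonom_eval scl y M1 * bmonom_eval scl y M2)"
  using assms(1)
proof (induction M1)
  case (MonX b b')
  then obtain M where "set_bmonom M \<subseteq> B" "\<And>y. bmonom_eval scl y M = coef_left scl b' (bmonom_eval scl y M2)"
    using bmonom_coef_left_ex[of b' M2] assms(2) by auto
  then show ?case using MonX
    by (intro exI[of _ "MonCons b M"]) (auto simp: coef_left_mult coef_right_mult)
next
  case (MonCons b M1)
  then obtain M where "set_bmonom M \<subseteq> B"
    "\<And>y. bmonom_eval scl y M = bmonom_eval scl y M1 * bmonom_eval scl y M2" by auto
  then show ?case using MonCons.prems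
    by (intro exI[of _ "MonCons b M"]) (auto simp: coef_left_mult mult.assoc)
qed

end

section \<open>Families given by one monomial, and their moments\<close>

locale monotone_iid = operator_valued_probability_space scl B E
  for scl :: "complex \<Rightarrow> 'a::ring \<Rightarrow> 'a" and B E +
  fixes n :: nat and x :: "nat \<Rightarrow> 'a" and \<phi> :: "'a \<Rightarrow> complex"
  assumes ident: "identically_distributed scl B E n x"
    and monotone: "monotonically_independent scl B E n x"
    and phi_E: "\<phi> a = \<phi> (E a)"
begin

text \<open>A factor of a product is kept as a function of the index of its variable, since that
  index will be summed over. Single monomials suffice: they are closed under products and under
  multiplication by \<open>B\<close>.\<close>

definition Fam :: "(nat \<Rightarrow> 'a) set" where
  "Fam = {\<lambda>i. bmonom_eval scl (x i) M | M. set_bmonom M \<subseteq> B}"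

lemma x_Fam: "x \<in> Fam"
  \<comment> \<open>Scalar coefficients represent \<open>X\<close> itself even when \<open>B\<close>
    has no unit.\<close>
  unfolding Fam_def by (rule CollectI, rule exI[of _ "MonX (Scalar 1) (Scalar 1)"]) auto

lemma Fam_E:
  assumes "a \<in> Fam"
  obtains M where "set_bmonom M \<subseteq> B" "a = (\<lambda>i. bmonom_eval scl (x i) M)"
  using assms by (auto simp: Fam_def)

lemma Fam_I: "set_bmonom M \<subseteq> B \<Longrightarrow> (\<And>i. a i = bmonom_eval scl (x i) M) \<Longrightarrow> a \<in> Fam"
  unfolding Fam_def by (intro CollectI exI[of _ M]) auto

lemma Fam_mult:
  assumes "a \<in> Fam" "b \<in> Fam"
  shows "(\<lambda>i. a i * b i) \<in> Fam"
proof -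
  obtain M M' where M: "set_bmonom M \<subseteq> B" "a = (\<lambda>i. bmonom_eval scl (x i) M)"
    "set_bmonom M' \<subseteq> B" "b = (\<lambda>i. bmonom_eval scl (x i) M')"
    using assms by (meson Fam_E)
  then show ?thesis using bmonom_mult_ex[of M M'] by (auto intro: Fam_I)
qed

lemma Fam_mult_left:
  assumes "b \<in> B" "a \<in> Fam"
  shows "(\<lambda>i. b * a i) \<in> Fam"
proof -
  obtain M where M: "set_bmonom M \<subseteq> B" "a = (\<lambda>i. bmonom_eval scl (x i) M)"
    using assms by (meson Fam_E)
  then show ?thesis using bmonom_coef_left_ex[of "Elem b" M] assms(1) by (auto intro: Fam_I)
qed

lemma Fam_mult_right:
  assumes "b \<in> B" "a \<in> Fam"
  shows "(\<lambda>i. a i * b) \<in> Fam"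
proof -
  obtain M where M: "set_bmonom M \<subseteq> B" "a = (\<lambda>i. bmonom_eval scl (x i) M)"
    using assms by (meson Fam_E)
  then show ?thesis using bmonom_mult_right_ex[of b M] assms(1) by (auto intro: Fam_I)
qed

lemma bpoly_eval_single: "bpoly_eval scl y (Poly_Mapping.single M 1) = bmonom_eval scl y M"
  by (simp add: bpoly_eval_def)

lemma single_bpolys0: "set_bmonom M \<subseteq> B \<Longrightarrow> Poly_Mapping.single M 1 \<in> bpolys0 B"
  by (simp add: bpolys0_def)

lemma E_Fam: "a \<in> Fam \<Longrightarrow> i \<in> {1..n} \<Longrightarrow> j \<in> {1..n} \<Longrightarrow> E (a i) = E (a j)"
  using ident single_bpolys0 unfolding identically_distributed_def Fam_def
  by (fastforce simp flip: bpoly_eval_single)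

definition vals :: "nat list \<Rightarrow> (nat \<Rightarrow> 'a) list \<Rightarrow> 'a list" where
  "vals is as = map2 (\<lambda>i a. a i) is as"

lemma vals_simps [simp]:
  "vals (i # is) (a # as) = a i # vals is as" "vals [] as = []" "length (vals is as) = min (length is) (length as)"
  by (simp_all add: vals_def)

lemma vals_append [simp]: "length is = length as \<Longrightarrow> vals (is @ is') (as @ as') = vals is as @ vals is' as'"
  by (simp add: vals_def)

text \<open>Meaningful for nonempty lists only, because \<open>list_prod []\<close> is
  \<open>undefined\<close>; the empty word is treated separately when polynomials are
  assembled.\<close>

definition moment :: "nat list \<Rightarrow> (nat \<Rightarrow> 'a) list \<Rightarrow> complex" where
  "moment is as = \<phi> (list_prod (vals is as))"

lemma independence:
  assumes len: "length is = length as" and "is": "set is \<subseteq> {1..n}" and as: "set as \<subseteq> Fam"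
    and l: "l < length is" and ne: "\<And>q. Suc q < length is \<Longrightarrow> is ! q \<noteq> is ! Suc q"
    and left: "0 < l \<Longrightarrow> is ! (l - 1) < is ! l" and right: "Suc l < length is \<Longrightarrow> is ! Suc l < is ! l"
  shows "E (list_prod (vals is as)) = E (list_prod ((vals is as)[l := E ((as ! l) (is ! l))]))"
proof -
  have "\<forall>q. \<exists>M. q < length as \<longrightarrow> set_bmonom M \<subseteq> B \<and> as ! q = (\<lambda>i. bmonom_eval scl (x i) M)"
    using as nth_mem by (fastforce simp: Fam_def)
  then obtain M where M: "\<And>q. q < length as \<Longrightarrow> set_bmonom (M q) \<subseteq> B"
    "\<And>q. q < length as \<Longrightarrow> as ! q = (\<lambda>i. bmonom_eval scl (x i) (M q))"
    by metis
  \<comment> \<open>Lists count positions from 0, monotone independence from 1: hence the shifts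
    \<open>q - 1\<close> and \<open>Suc l\<close>.\<close>
  let ?m = "length is" and ?p = "\<lambda>q. Poly_Mapping.single (M (q - 1)) 1" and ?i = "\<lambda>q. is ! (q - 1)"
  have "\<forall>q\<in>{1..?m}. ?p q \<in> bpolys0 B \<and> ?i q \<in> {1..n}"
  proof
    fix q assume "q \<in> {1..?m}"
    then have "q - 1 < length is" by auto
    then show "?p q \<in> bpolys0 B \<and> ?i q \<in> {1..n}"
      using M(1)[of "q - 1"] len subsetD[OF "is" nth_mem[of "q - 1"]] single_bpolys0 by simp
  qed
  moreover have "\<forall>q\<in>{1..<?m}. ?i q \<noteq> ?i (q + 1)"
  proof
    fix q assume "q \<in> {1..<?m}"
    then show "?i q \<noteq> ?i (q + 1)" using ne[of "q - 1"] by simp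
  qed
  moreover have "Suc l \<in> {1..?m}" using l by auto
  moreover have "1 < Suc l \<longrightarrow> ?i (Suc l - 1) < ?i (Suc l)" using left by simp
  moreover have "Suc l < ?m \<longrightarrow> ?i (Suc l) > ?i (Suc l + 1)" using right by simp
  ultimately have "E (list_prod (map (\<lambda>q. bpoly_eval scl (x (?i q)) (?p q)) [1..<?m + 1])) =
      E (list_prod (map (\<lambda>q. if q = Suc l then E (bpoly_eval scl (x (?i (Suc l))) (?p (Suc l)))
                                else bpoly_eval scl (x (?i q)) (?p q)) [1..<?m + 1]))"
    using monotone[unfolded monotonically_independent_def, THEN spec[where x = ?m],
        THEN spec[where x = ?p], THEN spec[where x = ?i], THEN bspec[where x = "Suc l"]] by blast
  moreover have "map (\<lambda>q. bpoly_eval scl (x (?i q)) (?p q)) [1..<?m + 1] = vals is as"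
    by (rule nth_equalityI) (auto simp: bpoly_eval_single vals_def len M(2) simp del: upt_Suc)
  moreover have "map (\<lambda>q. if q = Suc l then E (bpoly_eval scl (x (?i (Suc l))) (?p (Suc l)))
      else bpoly_eval scl (x (?i q)) (?p q)) [1..<?m + 1] = (vals is as)[l := E ((as ! l) (is ! l))]"
    using l by (intro nth_equalityI) (auto simp: bpoly_eval_single vals_def len M(2) nth_list_update simp del: upt_Suc)
  ultimately show ?thesis by simp
qed

lemma moment_merge:
  assumes "length is = length as"
  shows "moment (is @ i # i # is') (as @ a # b # as') = moment (is @ i # is') (as @ (\<lambda>i. a i * b i) # as')"
  using assms by (simp add: moment_def list_prod_merge)

lemma moment_single: "a \<in> Fam \<Longrightarrow> i \<in> {1..n} \<Longrightarrow> j \<in> {1..n} \<Longrightarrow> moment [i] [a] = moment [j] [a]"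
  using E_Fam[of a i j] phi_E[of "a i"] phi_E[of "a j"] by (simp add: moment_def)

text \<open>The expectation of the peak factor is an element of \<open>B\<close> that is the same
  for every index, so a neighbouring family can absorb it. The families \<open>bs\<close> are
  obtained before the indices, which later allows the index of the peak to be summed freely.\<close>

lemma moment_peak:
  assumes "as \<noteq> [] \<or> as' \<noteq> []" and Fam: "set (as @ a # as') \<subseteq> Fam"
  obtains bs where "length bs = length as + length as'" "set bs \<subseteq> Fam"
    "\<And>is i is'. \<lbrakk>length is = length as; length is' = length as'; set (is @ i # is') \<subseteq> {1..n};
       \<And>q. Suc q < length (is @ i # is') \<Longrightarrow> (is @ i # is') ! q \<noteq> (is @ i # is') ! Suc q;
       is \<noteq> [] \<Longrightarrow> last is < i; is' \<noteq> [] \<Longrightarrow> hd is' < i\<rbrakk>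
       \<Longrightarrow> moment (is @ i # is') (as @ a # as') = moment (is @ is') bs"
proof -
  \<comment> \<open>The index 1 is arbitrary: \<open>E_Fam\<close> gives the same expectation for
    every index in \<open>{1..n}\<close>.\<close>
  define b where "b = E (a 1)"
  have b: "b \<in> B" by (simp add: b_def E_in_B)
  have *: "moment (is @ i # is') (as @ a # as') = \<phi> (list_prod (vals is as @ b # vals is' as'))"
    if len: "length is = length as" "length is' = length as'" and "is": "set (is @ i # is') \<subseteq> {1..n}"
      and ne: "\<And>q. Suc q < length (is @ i # is') \<Longrightarrow> (is @ i # is') ! q \<noteq> (is @ i # is') ! Suc q"
      and left: "is \<noteq> [] \<Longrightarrow> last is < i" and right: "is' \<noteq> [] \<Longrightarrow> hd is' < i" for "is" i is'
  proof -
    have "E (list_prod (vals (is @ i # is') (as @ a # as'))) =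
      E (list_prod ((vals (is @ i # is') (as @ a # as'))
         [length is := E (((as @ a # as') ! length is) ((is @ i # is') ! length is))]))"
    proof (rule independence)
      show "(is @ i # is') ! (length is - 1) < (is @ i # is') ! length is" if "0 < length is"
        using left that by (simp add: nth_append last_conv_nth)
      show "(is @ i # is') ! Suc (length is) < (is @ i # is') ! length is"
        if "Suc (length is) < length (is @ i # is')"
        using right that by (simp add: nth_append hd_conv_nth)
    qed (use len "is" Fam ne in auto)
    also have "(vals (is @ i # is') (as @ a # as'))
         [length is := E (((as @ a # as') ! length is) ((is @ i # is') ! length is))]
         = vals is as @ E (a i) # vals is' as'"
      using len nth_append_length[of "is" i is'] by (simp add: list_update_append)
    also have "E (a i) = b" unfolding b_def using "is" Fam by (intro E_Fam) auto
    finally show ?thesis using phi_E by (metis moment_def)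
  qed
  \<comment> \<open>The expectation moves into the right neighbour if the peak is the first factor,
    and into the left neighbour otherwise.\<close>
  show thesis
  proof (cases "as = []")
    case True
    then obtain c cs where c: "as' = c # cs" using assms(1) by (cases as') auto
    show thesis
    proof (rule that[of "(\<lambda>i. b * c i) # cs"])
      show "set ((\<lambda>i. b * c i) # cs) \<subseteq> Fam" using Fam c b by (auto intro: Fam_mult_left)
    next
      fix "is" i is'
      assume a: "length is = length as" "length is' = length as'" "set (is @ i # is') \<subseteq> {1..n}"
        "\<And>q. Suc q < length (is @ i # is') \<Longrightarrow> (is @ i # is') ! q \<noteq> (is @ i # is') ! Suc q"
        "is \<noteq> [] \<Longrightarrow> last is < i" "is' \<noteq> [] \<Longrightarrow> hd is' < i"
      obtain i0 is0 where "is' = i0 # is0" using a c by (cases is') auto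
      then show "moment (is @ i # is') (as @ a # as') = moment (is @ is') ((\<lambda>i. b * c i) # cs)"
        using *[OF a] a True c list_prod_merge[of "[]" b] by (simp add: moment_def)
    qed (use True c in auto)
  next
    case False
    then obtain c cs where c: "as = cs @ [c]" by (cases as rule: rev_cases) auto
    show thesis
    proof (rule that[of "cs @ (\<lambda>i. c i * b) # as'"])
      show "set (cs @ (\<lambda>i. c i * b) # as') \<subseteq> Fam" using Fam c b by (auto intro: Fam_mult_right)
    next
      fix "is" i is'
      assume a: "length is = length as" "length is' = length as'" "set (is @ i # is') \<subseteq> {1..n}"
        "\<And>q. Suc q < length (is @ i # is') \<Longrightarrow> (is @ i # is') ! q \<noteq> (is @ i # is') ! Suc q"
        "is \<noteq> [] \<Longrightarrow> last is < i" "is' \<noteq> [] \<Longrightarrow> hd is' < i"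
      obtain i0 is0 where "is = is0 @ [i0]" using a c by (cases "is" rule: rev_cases) auto
      then show "moment (is @ i # is') (as @ a # as') = moment (is @ is') (cs @ (\<lambda>i. c i * b) # as')"
        using *[OF a] a c by (simp add: moment_def list_prod_merge)
    qed (use c in auto)
  qed
qed

end

section \<open>Reduction of words\<close>

text \<open>The bound \<open>k \<le> n\<close> makes every letter \<open>j\<close> also an
  admissible index, so that \<open>js\<close> itself can serve as an index list.\<close>

locale monotone_spreading = monotone_iid scl B E n x \<phi> + Mi_seminormed n k s
  for scl :: "complex \<Rightarrow> 'a::ring \<Rightarrow> 'a" and B E n x \<phi> k s +
  assumes k: "1 \<le> k" "k \<le> n"
begin

text \<open>If all families equal \<open>x\<close> and \<open>js\<close> is nonempty, this
  represents in the free *-algebra the image of the word \<open>js\<close> under \<alpha> followed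
  by \<mu> \<otimes> id. Other families arise during the reduction.\<close>

definition spread :: "(nat \<Rightarrow> 'a) list \<Rightarrow> nat list \<Rightarrow> (nat \<times> nat) star_poly" where
  "spread as js = (\<Sum>is\<in>idx n (length js). ncconst (moment is as) * gen_word is js)"

lemma spread_split:
  "spread as (js @ j # js') = (\<Sum>xs\<in>idx n (length js). \<Sum>i=1..n. \<Sum>ys\<in>idx n (length js').
     ncconst (moment (xs @ i # ys) as) * gen_word (xs @ i # ys) (js @ j # js'))"
  by (simp only: spread_def length_append length_Cons sum_idx_append sum_idx_Suc)

text \<open>Orthogonality of the \<open>u i j\<close> for fixed \<open>j\<close> leaves only equal
  indices at the two positions; there both families are evaluated at the same variable.\<close>

lemma spread_merge:
  assumes "length as = length js" "length as' = length js'" and k: "set js \<subseteq> {1..k}" "j \<in> {1..k}" "set js' \<subseteq> {1..k}"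
  shows "spread (as @ a # b # as') (js @ j # j # js') \<asymp> spread (as @ (\<lambda>i. a i * b i) # as') (js @ j # js')"
proof -
  let ?F = "\<lambda>xs i ys. ncconst (moment (xs @ i # ys) (as @ (\<lambda>i. a i * b i) # as')) *
    gen_word (xs @ i # ys) (js @ j # js')"
  have "spread (as @ a # b # as') (js @ j # j # js') =
      (\<Sum>xs\<in>idx n (length js). \<Sum>i=1..n. \<Sum>i'=1..n. \<Sum>ys\<in>idx n (length js').
        ncconst (moment (xs @ i # i' # ys) (as @ a # b # as')) * gen_word (xs @ i # i' # ys) (js @ j # j # js'))"
    unfolding spread_split by (simp add: sum_idx_Suc)
  also have "\<dots> \<asymp> (\<Sum>xs\<in>idx n (length js). \<Sum>i=1..n. \<Sum>i'=1..n. \<Sum>ys\<in>idx n (length js').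
      if i = i' then ?F xs i ys else 0)"
  proof (intro eqv_sum)
    fix xs i i' ys
    assume xs: "xs \<in> idx n (length js)" and ys: "ys \<in> idx n (length js')" and i: "i \<in> {1..n}" "i' \<in> {1..n}"
    have len: "length xs = length js" using xs by (simp add: idx_def)
    let ?A = "gen_word xs js" and ?B = "gen_word ys js'"
    let ?c = "ncconst (moment (xs @ i # i' # ys) (as @ a # b # as'))"
    have AB: "?A \<in> star_polys (Mi_gens n k)" "?B \<in> star_polys (Mi_gens n k)"
      using xs ys k gen_word_star_polys by auto
    have "?c * gen_word (xs @ i # i' # ys) (js @ j # j # js') = ?c * (?A * ((u i j * u i' j) * ?B))"
      using len by (simp add: gen_word_append mult.assoc)
    also have "\<dots> \<asymp> ?c * (?A * ((if i = i' then u i j else 0) * ?B))"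
      using i k AB by (intro eqv_mult_left eqv_mult_right u_u_same) auto
    also have "\<dots> = (if i = i' then ?F xs i ys else 0)"
    proof (cases "i = i'")
      case True
      have "length xs = length as" using len assms(1) by simp
      then show ?thesis using True len by (simp add: gen_word_append moment_merge)
    qed simp
    finally show "?c * gen_word (xs @ i # i' # ys) (js @ j # j # js') \<asymp> (if i = i' then ?F xs i ys else 0)" .
  qed
  also have "\<dots> = (\<Sum>xs\<in>idx n (length js). \<Sum>i=1..n. \<Sum>ys\<in>idx n (length js'). ?F xs i ys)"
  proof (rule sum.cong[OF refl], rule sum.cong[OF refl])
    fix xs i assume i: "i \<in> {1..n}"
    have "(\<Sum>i'=1..n. \<Sum>ys\<in>idx n (length js'). if i = i' then ?F xs i ys else 0) =
        (\<Sum>i'=1..n. if i = i' then \<Sum>ys\<in>idx n (length js'). ?F xs i ys else 0)"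
      by (rule sum.cong[OF refl]) simp
    then show "(\<Sum>i'=1..n. \<Sum>ys\<in>idx n (length js'). if i = i' then ?F xs i ys else 0) =
        (\<Sum>ys\<in>idx n (length js'). ?F xs i ys)"
      using i by (simp add: sum.delta)
  qed
  finally show ?thesis by (simp add: spread_split)
qed

text \<open>Incompatible index lists contribute nothing; in the others the maximal letter is a
  strict peak of the indices, so its factor can be removed, with \<open>bs\<close> the same for all
  of them. The remaining sum over its index is \<open>P j\<close>. The moment identity records that
  the index list \<open>js\<close> reduces in the same way.\<close>

lemma spread_peak:
  assumes "length as = length js" "length as' = length js'" "js \<noteq> [] \<or> js' \<noteq> []"
    and k': "set (js @ j # js') \<subseteq> {1..k}"
    and Fam: "set (as @ a # as') \<subseteq> Fam"
    and ne: "\<And>q. Suc q < length (js @ j # js') \<Longrightarrow> (js @ j # js') ! q \<noteq> (js @ j # js') ! Suc q"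
    and max: "\<And>j'. j' \<in> set (js @ js') \<Longrightarrow> j' \<le> j"
  obtains bs where "length bs = length (js @ js')" "set bs \<subseteq> Fam"
    "moment (js @ j # js') (as @ a # as') = moment (js @ js') bs"
    "spread (as @ a # as') (js @ j # js') \<asymp> spread bs (js @ js')"
proof -
  have "as \<noteq> [] \<or> as' \<noteq> []" using assms(1-3) by auto
  from moment_peak[OF this Fam] obtain bs where bs: "length bs = length as + length as'" "set bs \<subseteq> Fam"
    and peak: "\<And>is i is'. \<lbrakk>length is = length as; length is' = length as'; set (is @ i # is') \<subseteq> {1..n};
       \<And>q. Suc q < length (is @ i # is') \<Longrightarrow> (is @ i # is') ! q \<noteq> (is @ i # is') ! Suc q;
       is \<noteq> [] \<Longrightarrow> last is < i; is' \<noteq> [] \<Longrightarrow> hd is' < i\<rbrakk>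
       \<Longrightarrow> moment (is @ i # is') (as @ a # as') = moment (is @ is') bs"
    by blast
  \<comment> \<open>Distinct neighbours turn the maximality of \<open>j\<close> into a strict
    inequality.\<close>
  have last: "last js < j" if "js \<noteq> []"
    using ne[of "length js - 1"] max[of "last js"] that by (auto simp: nth_append last_conv_nth)
  have hd: "hd js' < j" if "js' \<noteq> []"
    using ne[of "length js"] max[of "hd js'"] that by (auto simp: nth_append hd_conv_nth)
  have moment: "moment (xs @ i # ys) (as @ a # as') = moment (xs @ ys) bs"
    if xs: "xs \<in> idx n (length js)" and ys: "ys \<in> idx n (length js')" and i: "i \<in> {1..n}"
      and compat: "compat (xs @ i # ys) (js @ j # js')" for xs i ys
  proof (rule peak)
    have len: "length xs = length js" "length ys = length js'" using xs ys by (auto simp: idx_def)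
    show "length xs = length as" "length ys = length as'" "set (xs @ i # ys) \<subseteq> {1..n}"
      using xs ys i assms(1,2) by (auto simp: idx_def)
    show "(xs @ i # ys) ! q \<noteq> (xs @ i # ys) ! Suc q" if "Suc q < length (xs @ i # ys)" for q
      using compat ne[of q] that len unfolding compat_def by (metis length_Cons length_append less_irrefl nat_neq_iff)
    show "last xs < i" if "xs \<noteq> []"
    proof -
      have "js \<noteq> []" using that len by auto
      then show ?thesis
        using compat[unfolded compat_def, THEN spec[where x = "length js - 1"]] last len that
        by (auto simp: nth_append last_conv_nth)
    qed
    show "hd ys < i" if "ys \<noteq> []"
    proof -
      have "js' \<noteq> []" using that len by auto
      then show ?thesis
        using compat[unfolded compat_def, THEN spec[where x = "length js"]] hd len that
        by (auto simp: nth_append hd_conv_nth)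
    qed
  qed
  let ?W = "\<lambda>xs i ys. gen_word (xs @ i # ys) (js @ j # js')"
  have W: "?W xs i ys = gen_word xs js * (u i j * gen_word ys js')" if "xs \<in> idx n (length js)" for xs i ys
    using that by (simp add: gen_word_append idx_def)
  \<comment> \<open>Maximality of \<open>j\<close> allows either neighbour to absorb
    \<open>P j\<close>: the left one if nothing follows, the right one otherwise.\<close>
  have absorb: "gen_word xs js * (P j * gen_word ys js') \<asymp> gen_word (xs @ ys) (js @ js')"
    if xs: "xs \<in> idx n (length js)" and ys: "ys \<in> idx n (length js')" for xs ys
  proof (cases js')
    case Nil
    then obtain j0 js0 where js: "js = js0 @ [j0]" using assms(3) by (cases js rule: rev_cases) auto
    then obtain i0 xs0 where xs': "xs = xs0 @ [i0]" using xs by (cases xs rule: rev_cases) (auto simp: idx_def)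
    have len: "length xs0 = length js0" using xs js xs' by (simp add: idx_def)
    have "gen_word xs0 js0 * (u i0 j0 * P j) \<asymp> gen_word xs0 js0 * u i0 j0"
      using js xs' xs k' max by (intro eqv_mult_left u_P gen_word_star_polys) (auto simp: idx_def)
    then show ?thesis using Nil ys js xs' len by (simp add: gen_word_append idx_def mult.assoc)
  next
    case (Cons j0 js0)
    then obtain i0 ys0 where ys': "ys = i0 # ys0" using ys by (cases ys) (auto simp: idx_def)
    have len: "length xs = length js" using xs by (simp add: idx_def)
    have "gen_word xs js * ((P j * u i0 j0) * gen_word ys0 js0) \<asymp> gen_word xs js * (u i0 j0 * gen_word ys0 js0)"
      using Cons ys' xs ys k' max
      by (intro eqv_mult_left eqv_mult_right P_u gen_word_star_polys) (auto simp: idx_def)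
    then show ?thesis using Cons ys' len by (simp add: gen_word_append mult.assoc)
  qed
  have "spread (as @ a # as') (js @ j # js') \<asymp>
      (\<Sum>xs\<in>idx n (length js). \<Sum>i=1..n. \<Sum>ys\<in>idx n (length js'). ncconst (moment (xs @ ys) bs) * ?W xs i ys)"
    unfolding spread_split
  proof (intro eqv_sum)
    fix xs i ys
    assume xs: "xs \<in> idx n (length js)" and ys: "ys \<in> idx n (length js')" and i: "i \<in> {1..n}"
    then have idx: "xs @ i # ys \<in> idx n (length (js @ j # js'))" by (auto simp: idx_def)
    show "ncconst (moment (xs @ i # ys) (as @ a # as')) * ?W xs i ys \<asymp> ncconst (moment (xs @ ys) bs) * ?W xs i ys"
    proof (cases "compat (xs @ i # ys) (js @ j # js')")
      case True
      then show ?thesis using moment[OF xs ys i] gen_word_star_polys[OF idx k'] by (simp add: eqv_refl)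
    next
      case False
      then have W0: "?W xs i ys \<asymp> 0" by (rule gen_word_incompat[OF idx k'])
      \<comment> \<open>The two moments may differ here, but both multiply a null word.\<close>
      have z: "ncconst c * ?W xs i ys \<asymp> 0" for c using eqv_scale[OF W0, of c] by simp
      show ?thesis by (rule eqv_trans[OF z eqv_sym[OF z]])
    qed
  qed
  \<comment> \<open>The moment no longer contains \<open>i\<close>, so the sum over \<open>i\<close>
    acts on the single generator \<open>u i j\<close> and yields \<open>P j\<close>.\<close>
  also have "\<dots> = (\<Sum>xs\<in>idx n (length js). \<Sum>ys\<in>idx n (length js').
      ncconst (moment (xs @ ys) bs) * (gen_word xs js * (P j * gen_word ys js')))"
  proof (intro sum.cong refl)
    fix xs assume xs: "xs \<in> idx n (length js)"
    show "(\<Sum>i=1..n. \<Sum>ys\<in>idx n (length js'). ncconst (moment (xs @ ys) bs) * ?W xs i ys) =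
      (\<Sum>ys\<in>idx n (length js'). ncconst (moment (xs @ ys) bs) * (gen_word xs js * (P j * gen_word ys js')))"
      unfolding W[OF xs] by (subst sum.swap) (simp add: P_def sum_distrib_left sum_distrib_right)
  qed
  also have "\<dots> \<asymp> (\<Sum>xs\<in>idx n (length js). \<Sum>ys\<in>idx n (length js').
      ncconst (moment (xs @ ys) bs) * gen_word (xs @ ys) (js @ js'))"
    by (intro eqv_sum eqv_scale absorb)
  also have "\<dots> = spread bs (js @ js')" by (simp add: spread_def sum_idx_append)
  finally have "spread (as @ a # as') (js @ j # js') \<asymp> spread bs (js @ js')" .
  \<comment> \<open>The list \<open>js @ j # js'\<close> is compatible with itself, and its letters
    are valid indices because \<open>k \<le> n\<close>.\<close>
  moreover have "moment (js @ j # js') (as @ a # as') = moment (js @ js') bs"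
    using k k' by (intro moment) (auto simp: idx_def compat_def)
  ultimately show thesis using that bs assms(1,2) by simp
qed

text \<open>Induction on the length of the word: merging equal neighbours or removing a maximal
  letter shortens it, and the spread sum and the moment along \<open>js\<close> are reduced to the
  same new families.\<close>

lemma P1_spread_P1:
  assumes "js \<noteq> []" "set js \<subseteq> {1..k}" "length as = length js" "set as \<subseteq> Fam"
  shows "P 1 * spread as js * P 1 \<asymp> ncconst (moment js as) * P 1"
  using assms
proof (induction "length js" arbitrary: js as rule: less_induct)
  case less
  have one: "1 \<in> {1..k}" using k by simp
  have via: "P 1 * spread as js * P 1 \<asymp> ncconst (moment js as) * P 1"
    if "spread as js \<asymp> spread bs js'" "moment js as = moment js' bs" "length js' < length js" "js' \<noteq> []"
      "set js' \<subseteq> {1..k}" "length bs = length js'" "set bs \<subseteq> Fam" for js' bs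
  proof -
    have "P 1 * spread as js * P 1 \<asymp> P 1 * spread bs js' * P 1"
      using that(1) one by (intro eqv_mult_left eqv_mult_right P_poly)
    also have "\<dots> \<asymp> ncconst (moment js' bs) * P 1" using that by (intro less.hyps)
    finally show ?thesis using that(2) by simp
  qed
  show ?case
  proof (cases "\<exists>q. Suc q < length js \<and> js ! q = js ! Suc q")
    case True
    then obtain q where q: "Suc q < length js" "js ! q = js ! Suc q" by blast
    have len: "q < length js" "Suc q < length as" "length (take q as) = q" "length (take q js) = q"
      using q less.prems(3) by auto
    obtain js1 j js2 where js: "js = js1 @ j # j # js2" "length js1 = q"
      using take_nth_nth_drop[OF q(1)] q(2) len by metis
    obtain as1 a b as2 where as: "as = as1 @ a # b # as2" "length as1 = q"
      using take_nth_nth_drop[OF len(2)] len by metis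
    have len: "length as1 = length js1" "length as2 = length js2" using js as less.prems(3) by auto
    show ?thesis
    proof (rule via)
      show "spread as js \<asymp> spread (as1 @ (\<lambda>i. a i * b i) # as2) (js1 @ j # js2)"
        unfolding js as using len less.prems(2) js by (intro spread_merge) auto
      show "moment js as = moment (js1 @ j # js2) (as1 @ (\<lambda>i. a i * b i) # as2)"
        unfolding js as using len by (simp add: moment_merge)
    qed (use js as len less.prems in \<open>auto intro: Fam_mult\<close>)
  next
    case False
    \<comment> \<open>No equal neighbours remain, so a letter of maximal value exceeds its
      neighbours strictly.\<close>
    define j where "j = Max (set js)"
    have j: "j \<in> set js" "\<And>j'. j' \<in> set js \<Longrightarrow> j' \<le> j" using less.prems(1) by (auto simp: j_def)
    obtain js1 js2 where js: "js = js1 @ j # js2" using split_list[OF j(1)] by blast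
    obtain as1 a as2 where as: "as = as1 @ a # as2" "length as1 = length js1" "length as2 = length js2"
    proof -
      have "as = take (length js1) as @ as ! length js1 # drop (Suc (length js1)) as"
        using js less.prems(3) by (intro id_take_nth_drop) simp
      then show thesis using js less.prems(3)
        by (intro that[of "take (length js1) as" "as ! length js1" "drop (Suc (length js1)) as"]) auto
    qed
    show ?thesis
    proof (cases "js1 = [] \<and> js2 = []")
      case True
      have jk: "j \<in> {1..k}" using js less.prems(2) by auto
      have a: "a \<in> Fam" using as less.prems(4) by simp
      \<comment> \<open>By identical distribution the moment of a single factor does not depend on
        its index and leaves the sum; evaluating it at \<open>j\<close> gives the moment along
        \<open>js\<close>.\<close>
      have "spread as js = ncconst (moment [j] [a]) * P j"
      proof -
        have "spread as js = (\<Sum>i=1..n. ncconst (moment [i] [a]) * u i j)"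
          using True js as by (simp add: spread_def sum_idx_1)
        also have "\<dots> = (\<Sum>i=1..n. ncconst (moment [j] [a]) * u i j)"
        proof (intro sum.cong refl)
          fix i assume "i \<in> {1..n}"
          then have "moment [i] [a] = moment [j] [a]" using a jk k by (intro moment_single) auto
          then show "ncconst (moment [i] [a]) * u i j = ncconst (moment [j] [a]) * u i j" by simp
        qed
        finally show ?thesis by (simp add: P_def sum_distrib_left)
      qed
      then have "P 1 * spread as js * P 1 = ncconst (moment js as) * (P 1 * P j * P 1)"
        using True js as by (simp add: mult_ncconst_left mult.assoc)
      also have "P 1 * P j * P 1 \<asymp> P 1"
        by (rule eqv_trans[OF eqv_mult_right[OF P1_P[OF jk] P_poly[OF one]] P_P1[OF one]])
      then have "ncconst (moment js as) * (P 1 * P j * P 1) \<asymp> ncconst (moment js as) * P 1"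
        by (rule eqv_scale)
      finally show ?thesis .
    next
      case nonempty: False
      obtain bs where "length bs = length (js1 @ js2)" "set bs \<subseteq> Fam"
        "moment js as = moment (js1 @ js2) bs" "spread as js \<asymp> spread bs (js1 @ js2)"
      proof (rule spread_peak[of as1 js1 as2 js2 j a])
        show "(js1 @ j # js2) ! q \<noteq> (js1 @ j # js2) ! Suc q" if "Suc q < length (js1 @ j # js2)" for q
          using False that js by blast
      qed (use js as nonempty less.prems j in auto)
      moreover have "set (js1 @ js2) \<subseteq> {1..k}" using js less.prems(2) by simp
      ultimately show ?thesis using js nonempty by (intro via[of bs "js1 @ js2"]) auto
    qed
  qed
qed

end

section \<open>From polynomials to the universal algebra\<close>

context cstar_presentation
begin

lemma univ_class_closed: "a \<in> star_polys G \<Longrightarrow> univ_class G R a \<in> carrier U"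
  and univ_class_smult: "a \<in> star_polys G \<Longrightarrow> c \<odot>\<^bsub>U\<^esub> univ_class G R a = univ_class G R (ncconst c * a)"
  by (auto simp: univ_class_def carrier_U C_const)

lemma
  assumes "a \<in> star_polys G" "b \<in> star_polys G"
  shows univ_class_add: "univ_class G R a \<oplus>\<^bsub>U\<^esub> univ_class G R b = univ_class G R (a + b)"
    and univ_class_mult: "univ_class G R a \<otimes>\<^bsub>U\<^esub> univ_class G R b = univ_class G R (a * b)"
  using assms by (auto simp: univ_class_def C_const)

lemma univ_class_zero: "\<zero>\<^bsub>U\<^esub> = univ_class G R 0"
  by (simp add: univ_class_def U_zero)

lemma univ_class_one: "\<one>\<^bsub>U\<^esub> = univ_class G R 1"
  by (simp add: univ_class_def U_one)

text \<open>Constant sequences with null difference define the same class; this turns the calculus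
  modulo the seminorm into equalities in the completion.\<close>

lemma univ_class_eqv: "N.eqv a b \<Longrightarrow> univ_class G R a = univ_class G R b"
  using N.eqvD[of a b] by (simp add: univ_class_def cl_eq_iff C_const I_iff)

lemma univ_class_sum:
  assumes "\<And>i. i \<in> A \<Longrightarrow> f i \<in> star_polys G"
  shows "(\<Oplus>\<^bsub>U\<^esub> i\<in>A. univ_class G R (f i)) = univ_class G R (sum f A)"
  using assms
proof (induction A rule: infinite_finite_induct)
  case (insert i A)
  have "(\<Oplus>\<^bsub>U\<^esub> i\<in>insert i A. univ_class G R (f i)) =
      univ_class G R (f i) \<oplus>\<^bsub>U\<^esub> (\<Oplus>\<^bsub>U\<^esub> i\<in>A. univ_class G R (f i))"
    using insert by (intro U.finsum_insert) (auto intro!: univ_class_closed)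
  then show ?case using insert by (simp add: univ_class_add star_polys_sum)
qed (simp_all add: univ_class_zero)

end

lemmas Mi_class_closed = cstar_presentation.univ_class_closed[OF cstar_presentation_Mi, folded Mi_def]
  and Mi_class_mult = cstar_presentation.univ_class_mult[OF cstar_presentation_Mi, folded Mi_def]
  and Mi_class_smult = cstar_presentation.univ_class_smult[OF cstar_presentation_Mi, folded Mi_def]
  and Mi_class_zero = cstar_presentation.univ_class_zero[OF cstar_presentation_Mi, folded Mi_def]
  and Mi_class_one = cstar_presentation.univ_class_one[OF cstar_presentation_Mi, folded Mi_def]
  and Mi_class_eqv = cstar_presentation.univ_class_eqv[OF cstar_presentation_Mi]
  and Mi_class_sum = cstar_presentation.univ_class_sum[OF cstar_presentation_Mi, folded Mi_def]

lemma ring_Mi: "ring (Mi n k)"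
  using cstar_presentation.ring_U[OF cstar_presentation_Mi] by (simp add: Mi_def)

section \<open>Sums in the tensor algebra\<close>

lemma abelian_monoid_nc_tensor:
  fixes G :: "'g set" and M :: "('a, 'z) cstar_alg_scheme"
  assumes "ring M"
  shows "abelian_monoid (nc_tensor G M)"
proof -
  interpret M: ring M by fact
  show ?thesis
  proof (rule abelian_monoidI)
    fix f g assume f: "f \<in> carrier (nc_tensor G M)" and g: "g \<in> carrier (nc_tensor G M)"
    have "{w. f w \<oplus>\<^bsub>M\<^esub> g w \<noteq> \<zero>\<^bsub>M\<^esub>} \<subseteq> {w. f w \<noteq> \<zero>\<^bsub>M\<^esub>} \<union> {w. g w \<noteq> \<zero>\<^bsub>M\<^esub>}" by auto
    then have "finite {w. f w \<oplus>\<^bsub>M\<^esub> g w \<noteq> \<zero>\<^bsub>M\<^esub>}"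
      using f g by (auto simp: nc_tensor_def intro: finite_subset)
    moreover have "set (letters w) \<subseteq> G" if "f w \<oplus>\<^bsub>M\<^esub> g w \<noteq> \<zero>\<^bsub>M\<^esub>" for w
      using f g that by (cases "f w = \<zero>\<^bsub>M\<^esub>") (auto simp: nc_tensor_def)
    ultimately show "f \<oplus>\<^bsub>nc_tensor G M\<^esub> g \<in> carrier (nc_tensor G M)"
      using f g by (auto simp: nc_tensor_def)
  qed (auto simp: nc_tensor_def M.a_ac)
qed

lemma nc_tensor_finsum:
  fixes G :: "'g set" and M :: "('a, 'z) cstar_alg_scheme"
  assumes M: "ring M" and "finite A" "\<And>a. a \<in> A \<Longrightarrow> F a \<in> carrier (nc_tensor G M)"
  shows "finsum (nc_tensor G M) F A w = (\<Oplus>\<^bsub>M\<^esub> a\<in>A. F a w)"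
  using assms(2,3)
proof induction
  interpret M: ring M by fact
  interpret T: abelian_monoid "nc_tensor G M" by (rule abelian_monoid_nc_tensor[OF M])
  have add: "(f \<oplus>\<^bsub>nc_tensor G M\<^esub> g) w = f w \<oplus>\<^bsub>M\<^esub> g w" for f g by (simp add: nc_tensor_def)
  have F: "f w \<in> carrier M" if "f \<in> carrier (nc_tensor G M)" for f w using that by (simp add: nc_tensor_def)
  {
    case empty
    show ?case unfolding T.finsum_empty M.finsum_empty by (simp add: nc_tensor_def)
  next
    case (insert a A)
    have "finsum (nc_tensor G M) F (insert a A) = F a \<oplus>\<^bsub>nc_tensor G M\<^esub> finsum (nc_tensor G M) F A"
      using insert by (intro T.finsum_insert) auto
    moreover have "(\<Oplus>\<^bsub>M\<^esub> a\<in>insert a A. F a w) = F a w \<oplus>\<^bsub>M\<^esub> (\<Oplus>\<^bsub>M\<^esub> a\<in>A. F a w)"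
      using insert F by (intro M.finsum_insert) auto
    ultimately show ?case using insert by (simp add: add)
  }
qed

section \<open>Coefficients of \<alpha> on words\<close>

lemma finite_fmon_splits: "finite {q :: 'g fmon \<times> 'g fmon. fst q + snd q = w}"
proof (rule finite_subset)
  show "{q. fst q + snd q = w} \<subseteq>
      (\<lambda>l. (FMon (take l (letters w)), FMon (drop l (letters w)))) ` {..length (letters w)}"
  proof
    fix q :: "'g fmon \<times> 'g fmon" assume "q \<in> {q. fst q + snd q = w}"
    then show "q \<in> (\<lambda>l. (FMon (take l (letters w)), FMon (drop l (letters w)))) ` {..length (letters w)}"
      by (intro image_eqI[of _ _ "length (letters (fst q))"]) (auto simp: plus_fmon_def prod_eq_iff)
  qed
qed simp

text \<open>Represents the coefficient of the word \<open>w\<close> in the image of the word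
  \<open>js\<close> under \<alpha>, before passing to classes.\<close>

definition word_coeff :: "nat \<Rightarrow> nat list \<Rightarrow> nat fmon \<Rightarrow> (nat \<times> nat) star_poly" where
  "word_coeff n js w = (if letters w \<in> idx n (length js) then gen_word (letters w) js else 0)"

lemma word_coeff_poly: "set js \<subseteq> {1..k} \<Longrightarrow> word_coeff n js w \<in> star_polys (Mi_gens n k)"
  by (simp add: word_coeff_def gen_word_star_polys)

text \<open>Of all cuts of \<open>w\<close> only the one after its first letter contributes, because
  the coefficient for \<open>[j]\<close> vanishes off words of length 1.\<close>

lemma word_coeff_Cons:
  "(\<Sum>q | fst q + snd q = w. word_coeff n [j] (fst q) * word_coeff n js (snd q)) = word_coeff n (j # js) w"
proof (cases "letters w")
  case Nil
  have "(\<Sum>q | fst q + snd q = w. word_coeff n [j] (fst q) * word_coeff n js (snd q)) = 0"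
    using Nil by (intro sum.neutral) (auto simp: word_coeff_def idx_def plus_fmon_def)
  then show ?thesis using Nil by (simp add: word_coeff_def idx_def)
next
  case (Cons i ws)
  let ?q = "(FMon [i], FMon ws)"
  have w: "w = FMon (i # ws)" using Cons by (cases w) simp
  have "(\<Sum>q | fst q + snd q = w. word_coeff n [j] (fst q) * word_coeff n js (snd q)) =
      (\<Sum>q\<in>{?q}. word_coeff n [j] (fst q) * word_coeff n js (snd q))"
  proof (rule sum.mono_neutral_right)
    show "\<forall>q\<in>{q. fst q + snd q = w} - {?q}. word_coeff n [j] (fst q) * word_coeff n js (snd q) = 0"
    proof
      fix q assume q: "q \<in> {q. fst q + snd q = w} - {?q}"
      obtain v v' where v: "q = (FMon v, FMon v')" by (metis fmon.exhaust prod.exhaust)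
      have "length v \<noteq> 1" using q v w by (cases v) (auto simp: plus_fmon_def)
      then show "word_coeff n [j] (fst q) * word_coeff n js (snd q) = 0"
        by (simp add: v word_coeff_def idx_def)
    qed
  qed (rule finite_fmon_splits, auto simp: w plus_fmon_def)
  also have "\<dots> = word_coeff n (j # js) w"
    by (auto simp: word_coeff_def idx_def w)
  finally show ?thesis .
qed

abbreviation Mi_class :: "nat \<Rightarrow> nat \<Rightarrow> (nat \<times> nat) star_poly \<Rightarrow> Mi_elem" where
  "Mi_class n k \<equiv> univ_class (Mi_gens n k) (Mi_rels n k)"

abbreviation Mi_tensor :: "nat \<Rightarrow> nat \<Rightarrow> (complex, nat fmon \<Rightarrow> Mi_elem) module" where
  "Mi_tensor n k \<equiv> nc_tensor {1..n} (Mi n k)"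

lemma word_coeff_tensor:
  assumes "set js \<subseteq> {1..k}"
  shows "(\<lambda>w. Mi_class n k (ncconst c * word_coeff n js w)) \<in> carrier (Mi_tensor n k)"
proof -
  have 0: "Mi_class n k (ncconst c * word_coeff n js w) = \<zero>\<^bsub>Mi n k\<^esub>" if "letters w \<notin> idx n (length js)" for w
    using that by (simp add: word_coeff_def Mi_class_zero)
  have "{w. Mi_class n k (ncconst c * word_coeff n js w) \<noteq> \<zero>\<^bsub>Mi n k\<^esub>} \<subseteq> FMon ` idx n (length js)"
  proof
    fix w assume "w \<in> {w. Mi_class n k (ncconst c * word_coeff n js w) \<noteq> \<zero>\<^bsub>Mi n k\<^esub>}"
    then have "letters w \<in> idx n (length js)" using 0 by blast
    then show "w \<in> FMon ` idx n (length js)" by (intro image_eqI[of _ _ "letters w"]) auto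
  qed
  then have "finite {w. Mi_class n k (ncconst c * word_coeff n js w) \<noteq> \<zero>\<^bsub>Mi n k\<^esub>}"
    by (rule finite_subset) simp
  moreover have "set (letters w) \<subseteq> {1..n}" if "Mi_class n k (ncconst c * word_coeff n js w) \<noteq> \<zero>\<^bsub>Mi n k\<^esub>" for w
    using 0[of w] that by (auto simp: idx_def)
  moreover have "Mi_class n k (ncconst c * word_coeff n js w) \<in> carrier (Mi n k)" for w
    using word_coeff_poly[OF assms] by (intro Mi_class_closed) auto
  ultimately show ?thesis by (auto simp: nc_tensor_def)
qed

lemma alpha_var:
  assumes j: "j \<in> {1..k}"
  shows "(\<Oplus>\<^bsub>Mi_tensor n k\<^esub> i\<in>{1..n}. pure_tensor (Mi n k) (ncvar i) (Mi_u n k i j)) =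
    (\<lambda>w. Mi_class n k (word_coeff n [j] w))"
proof
  fix w :: "nat fmon"
  have u: "star_gen (i, j) \<in> star_polys (Mi_gens n k)" if "i \<in> {1..n}" for i
    using that j by (auto simp: Mi_gens_def)
  have pt: "pure_tensor (Mi n k) (ncvar i) (Mi_u n k i j) w =
      Mi_class n k (if w = FMon [i] then star_gen (i, j) else 0)" if i: "i \<in> {1..n}" for i w
    using u[OF i] by (auto simp: pure_tensor_def Mi_u_def Mi_class_smult ncvar_def lookup_single when_def)
  have T: "pure_tensor (Mi n k) (ncvar i) (Mi_u n k i j) \<in> carrier (Mi_tensor n k)" if i: "i \<in> {1..n}" for i
  proof -
    have "{w. pure_tensor (Mi n k) (ncvar i) (Mi_u n k i j) w \<noteq> \<zero>\<^bsub>Mi n k\<^esub>} \<subseteq> {FMon [i]}"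
      using i by (auto simp: pt Mi_class_zero)
    moreover have "set (letters w) \<subseteq> {1..n}"
      if "pure_tensor (Mi n k) (ncvar i) (Mi_u n k i j) w \<noteq> \<zero>\<^bsub>Mi n k\<^esub>" for w
      using that i by (auto simp: pt Mi_class_zero split: if_splits)
    moreover have "pure_tensor (Mi n k) (ncvar i) (Mi_u n k i j) w \<in> carrier (Mi n k)" for w
      unfolding pt[OF i] using u[OF i] by (intro Mi_class_closed) auto
    ultimately show ?thesis by (auto simp: nc_tensor_def intro: finite_subset)
  qed
  have "(\<Oplus>\<^bsub>Mi_tensor n k\<^esub> i\<in>{1..n}. pure_tensor (Mi n k) (ncvar i) (Mi_u n k i j)) w =
      (\<Oplus>\<^bsub>Mi n k\<^esub> i\<in>{1..n}. pure_tensor (Mi n k) (ncvar i) (Mi_u n k i j) w)"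
    by (rule nc_tensor_finsum[OF ring_Mi finite_atLeastAtMost T])
  also have "\<dots> = (\<Oplus>\<^bsub>Mi n k\<^esub> i\<in>{1..n}. Mi_class n k (if w = FMon [i] then star_gen (i, j) else 0))"
  proof -
    interpret M: ring "Mi n k" by (rule ring_Mi)
    show ?thesis using pt u by (intro M.finsum_cong') (auto intro!: Mi_class_closed)
  qed
  also have "\<dots> = Mi_class n k (\<Sum>i=1..n. if w = FMon [i] then star_gen (i, j) else 0)"
    using u by (intro Mi_class_sum) auto
  also have "(\<Sum>i=1..n. if w = FMon [i] then star_gen (i, j) else 0) = word_coeff n [j] w"
  proof (cases "\<exists>i. w = FMon [i]")
    case True
    then obtain i where "w = FMon [i]" by blast
    then show ?thesis by (auto simp: word_coeff_def idx_def sum.delta)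
  next
    case False
    then have "length (letters w) \<noteq> 1" by (cases w) (auto simp: length_Suc_conv)
    then show ?thesis using False by (auto simp: word_coeff_def idx_def)
  qed
  finally show "(\<Oplus>\<^bsub>Mi_tensor n k\<^esub> i\<in>{1..n}. pure_tensor (Mi n k) (ncvar i) (Mi_u n k i j)) w =
    Mi_class n k (word_coeff n [j] w)" .
qed

text \<open>Each further variable convolves the coefficients as in
  \<open>word_coeff_Cons\<close>.\<close>

lemma alpha_word:
  assumes "set js \<subseteq> {1..k}"
  shows "foldr (\<lambda>j t. (\<Oplus>\<^bsub>Mi_tensor n k\<^esub> i\<in>{1..n}. pure_tensor (Mi n k) (ncvar i) (Mi_u n k i j)) \<otimes>\<^bsub>Mi_tensor n k\<^esub> t)
    js \<one>\<^bsub>Mi_tensor n k\<^esub> = (\<lambda>w. Mi_class n k (word_coeff n js w))"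
  using assms
proof (induction js)
  case Nil
  have "word_coeff n [] w = (if w = 0 then 1 else 0)" for w
    by (cases w) (auto simp: word_coeff_def idx_def zero_fmon_def)
  then show ?case by (auto simp: fun_eq_iff nc_tensor_def Mi_class_one Mi_class_zero)
next
  case (Cons j js)
  have js: "j \<in> {1..k}" "set js \<subseteq> {1..k}" using Cons.prems by auto
  have poly: "word_coeff n [j] v \<in> star_polys (Mi_gens n k)" "word_coeff n js v \<in> star_polys (Mi_gens n k)" for v
    using js by (auto intro!: word_coeff_poly)
  have "(\<lambda>w. Mi_class n k (word_coeff n [j] w)) \<otimes>\<^bsub>Mi_tensor n k\<^esub> (\<lambda>w. Mi_class n k (word_coeff n js w)) =
      (\<lambda>w. \<Oplus>\<^bsub>Mi n k\<^esub> q\<in>{q. fst q + snd q = w}.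
        Mi_class n k (word_coeff n [j] (fst q) * word_coeff n js (snd q)))"
    using poly by (simp add: nc_tensor_def Mi_class_mult)
  also have "\<dots> = (\<lambda>w. Mi_class n k (word_coeff n (j # js) w))"
    using poly by (auto simp: Mi_class_sum word_coeff_Cons)
  finally show ?case using Cons.IH[OF js(2)] alpha_var[OF js(1), of n] by simp
qed

lemma alpha_apply:
  assumes p: "p \<in> ncpolys {1..k}"
  shows "alpha n k p w = Mi_class n k
    (\<Sum>v\<in>Poly_Mapping.keys p. ncconst (Poly_Mapping.lookup p v) * word_coeff n (letters v) w)"
proof -
  let ?F = "\<lambda>v w. Mi_class n k (ncconst (Poly_Mapping.lookup p v) * word_coeff n (letters v) w)"
  interpret T: abelian_monoid "Mi_tensor n k" by (rule abelian_monoid_nc_tensor[OF ring_Mi])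
  have k: "set (letters v) \<subseteq> {1..k}" if "v \<in> Poly_Mapping.keys p" for v
    using p that by (auto simp: ncpolys_def)
  have poly: "word_coeff n (letters v) w \<in> star_polys (Mi_gens n k)" if "v \<in> Poly_Mapping.keys p" for v w
    using k[OF that] by (rule word_coeff_poly)
  have "alpha n k p = (\<Oplus>\<^bsub>Mi_tensor n k\<^esub> v\<in>Poly_Mapping.keys p. ?F v)"
    unfolding alpha_def Let_def nc_hom_def
  proof (rule T.finsum_cong'[OF refl])
    show "?F \<in> Poly_Mapping.keys p \<rightarrow> carrier (Mi_tensor n k)" using k word_coeff_tensor by auto
    fix v assume v: "v \<in> Poly_Mapping.keys p"
    show "Poly_Mapping.lookup p v \<odot>\<^bsub>Mi_tensor n k\<^esub>
        foldr (\<lambda>j t. (\<Oplus>\<^bsub>Mi_tensor n k\<^esub> i\<in>{1..n}. pure_tensor (Mi n k) (ncvar i) (Mi_u n k i j)) \<otimes>\<^bsub>Mi_tensor n k\<^esub> t)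
          (letters v) \<one>\<^bsub>Mi_tensor n k\<^esub> = ?F v"
      unfolding alpha_word[OF k[OF v]] using poly[OF v] by (simp add: nc_tensor_def Mi_class_smult)
  qed
  then have "alpha n k p w = (\<Oplus>\<^bsub>Mi n k\<^esub> v\<in>Poly_Mapping.keys p. ?F v w)"
    using nc_tensor_finsum[OF ring_Mi, of "Poly_Mapping.keys p" ?F "{1..n}" n k w] k word_coeff_tensor by auto
  then show ?thesis using poly by (simp add: Mi_class_sum)
qed

lemma tensor_id_alpha:
  assumes p: "p \<in> ncpolys {1..k}"
  shows "tensor_id (Mi n k) \<mu> (alpha n k p) = Mi_class n k
    (\<Sum>v\<in>Poly_Mapping.keys p. ncconst (Poly_Mapping.lookup p v) *
      (\<Sum>is\<in>idx n (length (letters v)). ncconst (\<mu> (Poly_Mapping.single (FMon is) 1)) * gen_word is (letters v)))"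
proof -
  interpret M: ring "Mi n k" by (rule ring_Mi)
  let ?K = "Poly_Mapping.keys p" and ?c = "\<lambda>v. ncconst (Poly_Mapping.lookup p v)"
    and ?m = "\<lambda>w. ncconst (\<mu> (Poly_Mapping.single w 1))"
  let ?g = "\<lambda>w. \<Sum>v\<in>?K. ?c v * word_coeff n (letters v) w"
  \<comment> \<open>The exact support of \<open>alpha n k p\<close> depends on which classes vanish.
    \<open>S\<close> is an explicit finite set containing it, and the additional terms are
    zero.\<close>
  define S where "S = (\<Union>v\<in>?K. FMon ` idx n (length (letters v)))"
  have S: "finite S" by (simp add: S_def)
  have k: "set (letters v) \<subseteq> {1..k}" if "v \<in> ?K" for v
    using p that by (auto simp: ncpolys_def)
  have g: "?g w \<in> star_polys (Mi_gens n k)" for w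
    using k by (intro star_polys_sum star_polys_closed word_coeff_poly)
  have notin: "word_coeff n (letters v) w = 0" if "v \<in> ?K" "w \<notin> FMon ` idx n (length (letters v))" for v w
    using that by (auto simp: word_coeff_def image_iff)
  have zero: "alpha n k p w = \<zero>\<^bsub>Mi n k\<^esub>" if "w \<notin> S" for w
  proof -
    have "?g w = 0" using that notin by (intro sum.neutral) (auto simp: S_def)
    then show ?thesis by (simp add: alpha_apply[OF p] Mi_class_zero)
  qed
  have "tensor_id (Mi n k) \<mu> (alpha n k p) =
      (\<Oplus>\<^bsub>Mi n k\<^esub> w\<in>S. \<mu> (Poly_Mapping.single w 1) \<odot>\<^bsub>Mi n k\<^esub> alpha n k p w)"
    unfolding tensor_id_def
  proof (rule M.add.finprod_mono_neutral_cong_left[OF S])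
    show "{w. alpha n k p w \<noteq> \<zero>\<^bsub>Mi n k\<^esub>} \<subseteq> S" using zero by blast
    show "\<And>w. w \<in> S - {w. alpha n k p w \<noteq> \<zero>\<^bsub>Mi n k\<^esub>} \<Longrightarrow>
        \<mu> (Poly_Mapping.single w 1) \<odot>\<^bsub>Mi n k\<^esub> alpha n k p w = \<zero>\<^bsub>Mi n k\<^esub>"
      by (simp add: Mi_class_zero Mi_class_smult)
    show "(\<lambda>w. \<mu> (Poly_Mapping.single w 1) \<odot>\<^bsub>Mi n k\<^esub> alpha n k p w) \<in> S \<rightarrow> carrier (Mi n k)"
      using g by (auto simp: alpha_apply[OF p] Mi_class_smult intro!: Mi_class_closed)
  qed simp
  also have "\<dots> = Mi_class n k (\<Sum>w\<in>S. ?m w * ?g w)"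
    using g by (simp add: alpha_apply[OF p] Mi_class_smult Mi_class_sum)
  also have "(\<Sum>w\<in>S. ?m w * ?g w) = (\<Sum>v\<in>?K. ?c v * (\<Sum>w\<in>S. ?m w * word_coeff n (letters v) w))"
  proof -
    have "(\<Sum>w\<in>S. ?m w * ?g w) = (\<Sum>w\<in>S. \<Sum>v\<in>?K. ?c v * (?m w * word_coeff n (letters v) w))"
      unfolding sum_distrib_left
      by (rule sum.cong[OF refl], rule sum.cong[OF refl], rule mult_ncconst_left)
    then show ?thesis by (subst (asm) sum.swap) (simp add: sum_distrib_left)
  qed
  also have "\<dots> = (\<Sum>v\<in>?K. ?c v * (\<Sum>is\<in>idx n (length (letters v)). ?m (FMon is) * gen_word is (letters v)))"
  proof (rule sum.cong[OF refl])
    fix v assume v: "v \<in> ?K"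
    have "(\<Sum>w\<in>S. ?m w * word_coeff n (letters v) w) =
        (\<Sum>w\<in>FMon ` idx n (length (letters v)). ?m w * word_coeff n (letters v) w)"
      using S v notin[OF v] by (intro sum.mono_neutral_right) (auto simp: S_def)
    also have "\<dots> = (\<Sum>is\<in>idx n (length (letters v)). ?m (FMon is) * gen_word is (letters v))"
      by (subst sum.reindex) (auto simp: inj_on_def word_coeff_def)
    finally show "?c v * (\<Sum>w\<in>S. ?m w * word_coeff n (letters v) w) =
        ?c v * (\<Sum>is\<in>idx n (length (letters v)). ?m (FMon is) * gen_word is (letters v))" by simp
  qed
  finally show ?thesis .
qed

section \<open>The spreadability identity\<close>

lemma Mi_P_class:
  assumes "j \<in> {1..k}"
  shows "Mi_P n k j = Mi_class n k (\<Sum>i=1..n. star_gen (i, j))"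
  unfolding Mi_P_def Mi_u_def using assms by (intro Mi_class_sum) (auto simp: Mi_gens_def)

lemma ncconst_sum: "ncconst (sum f A) = (\<Sum>a\<in>A. ncconst (f a))"
  by (induction A rule: infinite_finite_induct) (auto simp: ncconst_add)

lemma joint_distribution_single:
  "joint_distribution \<phi> x (Poly_Mapping.single w 1) = (if w = 0 then 1 else \<phi> (list_prod (map x (letters w))))"
  by (simp add: joint_distribution_def)

text \<open>The required identity before passing to classes, obtained word by word from
  \<open>P1_spread_P1\<close>.\<close>

lemma (in monotone_spreading) P1_joint_distribution_P1:
  assumes p: "p \<in> ncpolys {1..k}"
  shows "P 1 * (\<Sum>v\<in>Poly_Mapping.keys p. ncconst (Poly_Mapping.lookup p v) *
      (\<Sum>is\<in>idx n (length (letters v)).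
        ncconst (joint_distribution \<phi> x (Poly_Mapping.single (FMon is) 1)) * gen_word is (letters v))) * P 1
    \<asymp> ncconst (joint_distribution \<phi> x p) * P 1"
proof -
  let ?\<mu> = "\<lambda>w. joint_distribution \<phi> x (Poly_Mapping.single w 1)"
  let ?K = "Poly_Mapping.keys p" and ?c = "\<lambda>v. ncconst (Poly_Mapping.lookup p v)"
  let ?I = "\<lambda>v. \<Sum>is\<in>idx n (length (letters v)). ncconst (?\<mu> (FMon is)) * gen_word is (letters v)"
  have one: "1 \<in> {1..k}" using k by simp
  have letters: "set (letters v) \<subseteq> {1..k}" if "v \<in> ?K" for v using p that by (auto simp: ncpolys_def)
  have moment: "?\<mu> (FMon is) = moment is (replicate (length is) x)" if "is \<noteq> []" for "is"
  proof -
    have "vals is (replicate (length is) x) = map x is" by (induction "is") auto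
    then show ?thesis using that by (simp add: joint_distribution_single moment_def zero_fmon_def)
  qed
  have word: "P 1 * ?I v * P 1 \<asymp> ncconst (?\<mu> v) * P 1" if v: "v \<in> ?K" for v
  proof (cases "letters v = []")
    \<comment> \<open>For the empty word the joint distribution is 1 by convention, and the claim is
      that \<open>P 1\<close> is idempotent modulo the seminorm.\<close>
    case True
    then have "v = 0" by (cases v) (simp add: zero_fmon_def)
    moreover have "idx n 0 = {[]}" by (auto simp: idx_def)
    ultimately show ?thesis using P_P1[OF one] True by (simp add: joint_distribution_single zero_fmon_def)
  next
    case False
    have "?I v = spread (replicate (length (letters v)) x) (letters v)"
      unfolding spread_def
    proof (rule sum.cong[OF refl])
      fix "is" assume "is \<in> idx n (length (letters v))"
      then have "length is = length (letters v)" "is \<noteq> []" using False by (auto simp: idx_def)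
      then show "ncconst (?\<mu> (FMon is)) * gen_word is (letters v) =
          ncconst (moment is (replicate (length (letters v)) x)) * gen_word is (letters v)"
        using moment[of "is"] by simp
    qed
    moreover have "?\<mu> v = moment (letters v) (replicate (length (letters v)) x)"
      using moment[OF False] by simp
    ultimately show ?thesis
      using P1_spread_P1[OF False letters[OF v], of "replicate (length (letters v)) x"] x_Fam
      by (simp add: set_replicate_conv_if)
  qed
  have "P 1 * (\<Sum>v\<in>?K. ?c v * ?I v) * P 1 = (\<Sum>v\<in>?K. ?c v * (P 1 * ?I v * P 1))"
    by (simp only: sum_distrib_left[of "P 1"] sum_distrib_right[of _ _ "P 1"] mult_ncconst_left mult.assoc)
  also have "\<dots> \<asymp> (\<Sum>v\<in>?K. ?c v * (ncconst (?\<mu> v) * P 1))"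
    by (intro eqv_sum eqv_scale word)
  also have "\<dots> = ncconst (joint_distribution \<phi> x p) * P 1"
  proof -
    have "joint_distribution \<phi> x p = (\<Sum>v\<in>?K. Poly_Mapping.lookup p v * ?\<mu> v)"
      by (simp add: joint_distribution_single) (simp add: joint_distribution_def)
    then show ?thesis by (simp add: ncconst_sum sum_distrib_right ncconst_mult mult.assoc)
  qed
  finally show ?thesis .
qed

theorem (in monotone_iid) monotonically_spreadable: "monotonically_spreadable \<phi> n x"
  unfolding monotonically_spreadable_def
proof (intro ballI)
  fix k p assume k: "k \<in> {1..n - 1}" and p: "p \<in> ncpolys {1..k}"
  interpret C: cstar_presentation "Mi_gens n k" "Mi_rels n k" by (rule cstar_presentation_Mi)
  \<comment> \<open>The universal norm is a C*-seminorm killing the relations, so the whole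
    reduction applies to it, and elements congruent modulo this norm have the same class.\<close>
  interpret monotone_spreading scl B E n x \<phi> k "univ_norm (Mi_gens n k) (Mi_rels n k)"
    using k by unfold_locales (auto simp: C.N_rel)
  let ?Q = "\<Sum>v\<in>Poly_Mapping.keys p. ncconst (Poly_Mapping.lookup p v) *
      (\<Sum>is\<in>idx n (length (letters v)).
        ncconst (joint_distribution \<phi> x (Poly_Mapping.single (FMon is) 1)) * gen_word is (letters v))"
  have one: "1 \<in> {1..k}" using k by simp
  have P: "Mi_P n k 1 = Mi_class n k (P 1)" using Mi_P_class[OF one] by (simp add: P_def)
  have Q: "?Q \<in> star_polys (Mi_gens n k)"
    using p by (intro star_polys_sum star_polys_closed gen_word_star_polys) (auto simp: ncpolys_def)
  show "joint_distribution \<phi> x p \<odot>\<^bsub>Mi n k\<^esub> Mi_P n k 1 = Mi_P n k 1 \<otimes>\<^bsub>Mi n k\<^esub>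
      tensor_id (Mi n k) (joint_distribution \<phi> x) (alpha n k p) \<otimes>\<^bsub>Mi n k\<^esub> Mi_P n k 1"
    unfolding P tensor_id_alpha[OF p]
    using P_poly[OF one] Q Mi_class_eqv[OF P1_joint_distribution_P1[OF p]]
    by (simp add: Mi_class_mult Mi_class_smult)
qed

theorem proposition5p17:
  fixes scl :: "complex \<Rightarrow> 'a::ring \<Rightarrow> 'a"
    and B :: "'a set" and E :: "'a \<Rightarrow> 'a"
    and n :: nat and x :: "nat \<Rightarrow> 'a" and \<phi> :: "'a \<Rightarrow> complex"
  assumes "operator_valued_probability_space scl B E"
    and "identically_distributed scl B E n x"
    and "monotonically_independent scl B E n x"
    and "is_state scl \<phi>"
    and "\<And>a. \<phi> a = \<phi> (E a)"
  shows "monotonically_spreadable \<phi> n x"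
proof -
  interpret operator_valued_probability_space scl B E by fact
  interpret monotone_iid scl B E n x \<phi> by unfold_locales fact+
  show ?thesis by (rule monotonically_spreadable)
qed

end
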